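(* For every $m\in\mathbb Z$, let $\mathcal B^{(m)}(z,w)$ be the $\mathbb Z$-linear map from $B$ to formal series in $z^{\pm1},w^{\pm1}$ with coefficients in $B$ defined by $(\mathcal B^{(m)}(z,w)\Delta_\lambda(H))[\mathbf b]_m=\delta_m(z,w)[\mathbf b]_{m+\lambda}$ for all partitions $\lambda$, where $\delta_m(z,w)=\sum_{i,j\in\mathbb Z}\delta_m(\mathcal B_{ij})z^iw^{-j}$. Then $$\mathcal B^{(m)}(z,w)=\frac{z^m}{w^m}\,i_{z,w}\frac{z}{z-w}\,\Gamma(z,w),\qquad\text{where}\qquad \Gamma(z,w)=\frac{E(w)}{E(z)}\,\overline\sigma_-(z)\sigma_-(w).$$
   Context: Exterior algebra and Schubert derivations. $M=\bigoplus_{i\in\mathbb Z}\mathbb Z b_i$ is a free abelian group with basis $(b_i)_{i\in\mathbb Z}$, $\bigwedge M$ its exterior algebra over $\mathbb Z$, and $M^*=\bigoplus_j\mathbb Z\beta_j$ with $\beta_j(b_i)=\delta_{ij}$. A Hasse–Schmidt (HS) derivation on $\bigwedge M$ is a $\mathbb Z$-linear map $\mathcal D(z):\bigwedge M\to\bigwedge M[[z]]$ (or $\bigwedge M[[z^{-1}]]$) with $\mathcal D(z)(u\wedge v)=\mathcal D(z)u\wedge\mathcal D(z)v$. The Schubert derivations $\sigma_\pm(z)=\sum_{i\ge0}\sigma_{\pm i}z^{\pm i}$ are the unique HS derivations with $\sigma_\pm(z)b_j=\sum_{i\ge0}b_{j\pm i}z^{\pm i}$; the formal inverse $\overline\sigma_-(z)$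 of $\sigma_-(z)$ is the unique HS derivation with $\overline\sigma_-(z)b_j=b_j-b_{j-1}z^{-1}$. Fermionic Fock space. $\mathcal P$ is the set of partitions, $\mathcal P_r$ those of length $\ell(\lambda)\le r$. For $\lambda\in\mathcal P_r$, $\mathbf b^r_{m+\lambda}:=b_{m+\lambda_1}\wedge b_{m-1+\lambda_2}\wedge\cdots\wedge b_{m-r+1+\lambda_r}$. Let $[M]$ be the free $\mathbb Z$-module with basis $([\mathbf b]_m)_{m\in\mathbb Z}$, and $F:=(\bigwedge M\otimes_{\mathbb Z}[M])/W$ where $W$ is the $\bigwedge M$-submodule generated by all $b_m\otimes[\mathbf b]_{m-1}-1\otimes[\mathbf b]_m$ and $b_m\otimes[\mathbf b]_m$, $m\in\mathbb Z$. The class of $u\otimes[\mathbf b]_m$ is written $u\wedge[\mathbf b]_m$. Put $[\mathbf b]_{m+\lambda}:=\mathbf b^r_{m+\lambda}\wedge[\mathbf b]_{m-r}$ for any $r\ge\ell(\lambda)$ (independent of $r$). Then $F=\bigoplus_m F_m$, $F_m=\bigoplus_{\lambda\in\mathcal P}\mathbb Z[\mathbf b]_{m+\lambda}$. Extension to $F_m$. Put $\sigma_+(z)[\mathbf b]_m=(\sigma_+(z)b_m)\wedge[\mathbf b]_{m-1}$, $\sigma_-(z)[\mathbf b]_m=\overline\sigma_-(z)[\mathbf b]_m=[\mathbf b]_m$, and for $\tau(z)\in\{\sigma_+(z),\sigma_-(z),\overline\sigma_-(z)\}$ put $\tau(z)[\mathbf b]_{m+\lambda}=\tau(z)\mathbf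 b^r_{m+\lambda}\wedge\tau(z)[\mathbf b]_{m-r}$ ($r\ge\ell(\lambda)$), extended $\mathbb Z$-linearly to $F_m$. Boson–Fermion correspondence. $B=\mathbb Z[e_1,e_2,\ldots]$, $E(z)=1+\sum_{j\ge1}(-1)^je_jz^j$, $\sum_{j}h_jz^j=1/E(z)$ ($h_j=0$ for $j<0$), $\Delta_\lambda(H)=\det(h_{\lambda_j-j+i})_{1\le i,j\le r}$ for any $r\ge\ell(\lambda)$; the $\Delta_\lambda(H)$, $\lambda\in\mathcal P$, form a $\mathbb Z$-basis of $B$. Each $F_m$ is a $B$-module via $h_iu=\sigma_iu$ ($i\ge0$), free of rank one on $[\mathbf b]_m$, with $\Delta_\lambda(H)[\mathbf b]_m=[\mathbf b]_{m+\lambda}$. The maps $\sigma_-(z),\overline\sigma_-(z):B\to B[z^{-1}]$ are the $\mathbb Z$-linear maps defined by $(\sigma_-(z)\Delta_\lambda(H))[\mathbf b]_0=\sigma_-(z)[\mathbf b]_{0+\lambda}$ and $(\overline\sigma_-(z)\Delta_\lambda(H))[\mathbf b]_0=\overline\sigma_-(z)[\mathbf b]_{0+\lambda}$. In $\Gamma(z,w)$, one first applies $\sigma_-(w)$, then $\overline\sigma_-(z)$ coefficientwise, and then multiplies by $E(w)/E(z)\in B[[z,w]]$. Lie algebra action. $\mathcal B_{ij}=b_i\otimes\beta_j\in \mathrm{End}_{\mathbb Z}(M)$, i.e. $\mathcal B_{ij}(b_k)=\delta_{jk}b_i$. $\delta(\mathcal B_{ij})$ is the derivation of $\bigwedge M$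 ($\delta(A)(u\wedge v)=\delta(A)u\wedge v+u\wedge\delta(A)v$) with $\delta(\mathcal B_{ij})u=\mathcal B_{ij}u$ for $u\in M$. $\delta_m(\mathcal B_{ij})\in\mathrm{End}_{\mathbb Z}(F_m)$ is defined by $\delta_m(\mathcal B_{ij})[\mathbf b]_{m+\lambda}=(\delta(\mathcal B_{ij})\mathbf b^r_{m+\lambda})\wedge[\mathbf b]_{m-r}$ for any $r\ge\ell(\lambda)$ with $m-r<j$ (independent of $r$). $i_{z,w}$ denotes expansion as a power series in $w/z$; thus $i_{z,w}\frac{z}{z-w}=\sum_{k\ge0}(w/z)^k$. *)

theory Defs
  imports
    "HOL-Library.Poly_Mapping"
    "HOL-Computational_Algebra.Polynomial"
    "HOL-Computational_Algebra.Formal_Power_Series"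
    "Jordan_Normal_Form.Determinant"
begin

section \<open>The exterior algebra of an abelian group\<close>

instantiation list :: (type) monoid_add
begin

definition zero_list_def: "0 = []"
definition plus_list_def: "xs + ys = xs @ ys"

instance
  by standard (simp_all add: zero_list_def plus_list_def)

end

text \<open>
  With concatenation as addition on lists, \<open>'a list \<Rightarrow>\<^sub>0 int\<close> is the free associative unital
  ring on the set \<open>'a\<close>. Dividing out additivity of the generators gives the tensor algebra
  over the integers of the abelian group \<open>'a\<close>; dividing out the squares as well gives the
  exterior algebra.
\<close>

inductive_set exterior_ideal :: "('a::ab_group_add list \<Rightarrow>\<^sub>0 int) set" where
  zero: "0 \<in> exterior_ideal"
| linear: "frag_of [x + y] - frag_of [x] - frag_of [y] \<in> exterior_ideal"
| square: "frag_of [x, x] \<in> exterior_ideal"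
| add: "p \<in> exterior_ideal \<Longrightarrow> q \<in> exterior_ideal \<Longrightarrow> p + q \<in> exterior_ideal"
| mult_left: "p \<in> exterior_ideal \<Longrightarrow> a * p \<in> exterior_ideal"
| mult_right: "p \<in> exterior_ideal \<Longrightarrow> p * a \<in> exterior_ideal"

lemma exterior_ideal_uminus: "p \<in> exterior_ideal \<Longrightarrow> - p \<in> exterior_ideal"
  using exterior_ideal.mult_left[of p "- 1"] by simp

lemma exterior_ideal_diff:
  "p \<in> exterior_ideal \<Longrightarrow> q \<in> exterior_ideal \<Longrightarrow> p - q \<in> exterior_ideal"
  using exterior_ideal.add[OF _ exterior_ideal_uminus, of p q] by simp

lemma lookup_times_Nil:
  fixes p q :: "'a list \<Rightarrow>\<^sub>0 int"
  assumes *: "Poly_Mapping.lookup p [] = 0 \<or> Poly_Mapping.lookup q [] = 0"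
  shows "Poly_Mapping.lookup (p * q) [] = 0"
proof -
  have "Poly_Mapping.lookup p l * (\<Sum>k. Poly_Mapping.lookup q k when [] = l + k) = 0" for l
  proof (cases "l = []")
    case True
    have "(\<Sum>k. Poly_Mapping.lookup q k when [] = l + k) = Poly_Mapping.lookup q []"
      using True by (simp add: plus_list_def)
    then show ?thesis
      using * True by auto
  next
    case False
    then have "(\<Sum>k. Poly_Mapping.lookup q k when [] = l + k) = 0"
      by (simp add: plus_list_def)
    then show ?thesis by simp
  qed
  then show ?thesis
    by (simp only: lookup_mult) simp
qed

lemma exterior_ideal_lookup_Nil: "p \<in> exterior_ideal \<Longrightarrow> Poly_Mapping.lookup p [] = 0"
  by (induction rule: exterior_ideal.induct)
     (auto simp: lookup_add lookup_minus lookup_single lookup_times_Nil)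

quotient_type (overloaded) 'a exterior =
  "'a::ab_group_add list \<Rightarrow>\<^sub>0 int" / "\<lambda>p q. p - q \<in> exterior_ideal"
proof (rule equivpI)
  show "reflp (\<lambda>p q. p - q \<in> (exterior_ideal :: ('a list \<Rightarrow>\<^sub>0 int) set))"
    by (simp add: reflp_def exterior_ideal.zero)
  show "symp (\<lambda>p q. p - q \<in> (exterior_ideal :: ('a list \<Rightarrow>\<^sub>0 int) set))"
    using exterior_ideal_uminus by (fastforce simp: symp_def)
  show "transp (\<lambda>p q. p - q \<in> (exterior_ideal :: ('a list \<Rightarrow>\<^sub>0 int) set))"
    using exterior_ideal.add by (fastforce simp: transp_def)
qed

instantiation exterior :: (ab_group_add) ring_1
begin

lift_definition zero_exterior :: "'a exterior" is 0 .

lift_definition one_exterior :: "'a exterior" is 1 .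

lift_definition plus_exterior :: "'a exterior \<Rightarrow> 'a exterior \<Rightarrow> 'a exterior" is "(+)"
proof -
  fix p p' q q' :: "'a list \<Rightarrow>\<^sub>0 int"
  assume "p - p' \<in> exterior_ideal" "q - q' \<in> exterior_ideal"
  from exterior_ideal.add[OF this] show "p + q - (p' + q') \<in> exterior_ideal"
    by (simp add: algebra_simps)
qed

lift_definition uminus_exterior :: "'a exterior \<Rightarrow> 'a exterior" is uminus
  using exterior_ideal_uminus by fastforce

lift_definition minus_exterior :: "'a exterior \<Rightarrow> 'a exterior \<Rightarrow> 'a exterior" is "(-)"
proof -
  fix p p' q q' :: "'a list \<Rightarrow>\<^sub>0 int"
  assume "p - p' \<in> exterior_ideal" "q - q' \<in> exterior_ideal"
  from exterior_ideal_diff[OF this] show "p - q - (p' - q') \<in> exterior_ideal"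
    by (simp add: algebra_simps)
qed

lift_definition times_exterior :: "'a exterior \<Rightarrow> 'a exterior \<Rightarrow> 'a exterior" is "(*)"
proof -
  fix p p' q q' :: "'a list \<Rightarrow>\<^sub>0 int"
  assume "p - p' \<in> exterior_ideal" "q - q' \<in> exterior_ideal"
  then have "(p - p') * q + p' * (q - q') \<in> exterior_ideal"
    by (intro exterior_ideal.intros)
  then show "p * q - p' * q' \<in> exterior_ideal"
    by (simp add: algebra_simps)
qed

instance
proof
  show "(0 :: 'a exterior) \<noteq> 1"
  proof transfer
    show "(0 :: 'a list \<Rightarrow>\<^sub>0 int) - 1 \<notin> exterior_ideal"
    proof
      assume "(0 :: 'a list \<Rightarrow>\<^sub>0 int) - 1 \<in> exterior_ideal"
      from exterior_ideal_lookup_Nil[OF this] show False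
        by (simp add: lookup_one zero_list_def)
    qed
  qed
qed (transfer, simp add: algebra_simps exterior_ideal.zero)+

end

lift_definition exterior_incl :: "'a::ab_group_add \<Rightarrow> 'a exterior" is "\<lambda>x. frag_of [x]" .


section \<open>The fermionic Fock space\<close>

type_synonym M = "int \<Rightarrow>\<^sub>0 int"

definition b :: "int \<Rightarrow> M exterior" where
  "b i = exterior_incl (frag_of i)"

text \<open>
  The tensor product of the exterior algebra with the free abelian group on the symbols
  \<open>[b]\<^sub>m\<close> is \<open>int \<Rightarrow>\<^sub>0 M exterior\<close>, with \<open>Poly_Mapping.single m u\<close> for \<open>u \<otimes> [b]\<^sub>m\<close>.
\<close>

inductive_set fock_rel :: "(int \<Rightarrow>\<^sub>0 M exterior) set" where
  zero: "0 \<in> fock_rel"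
| absorb: "Poly_Mapping.single (m - 1) (b m) - Poly_Mapping.single m 1 \<in> fock_rel"
| kill: "Poly_Mapping.single m (b m) \<in> fock_rel"
| add: "x \<in> fock_rel \<Longrightarrow> y \<in> fock_rel \<Longrightarrow> x + y \<in> fock_rel"
| act: "x \<in> fock_rel \<Longrightarrow> Poly_Mapping.map ((*) u) x \<in> fock_rel"

lemma lookup_map_times: "Poly_Mapping.lookup (Poly_Mapping.map ((*) u) x) k = u * Poly_Mapping.lookup x k"
  for u :: "'a::mult_zero"
  by (simp add: Poly_Mapping.map.rep_eq when_def)

lemma fock_rel_uminus: "x \<in> fock_rel \<Longrightarrow> - x \<in> fock_rel"
proof -
  assume "x \<in> fock_rel"
  then have "Poly_Mapping.map ((*) (- 1)) x \<in> fock_rel"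
    by (rule fock_rel.act)
  also have "Poly_Mapping.map ((*) (- 1)) x = - x"
    by (rule poly_mapping_eqI) (simp add: lookup_map_times)
  finally show ?thesis .
qed

quotient_type fock = "int \<Rightarrow>\<^sub>0 M exterior" / "\<lambda>x y. x - y \<in> fock_rel"
proof (rule equivpI)
  show "reflp (\<lambda>x y. x - y \<in> fock_rel)"
    by (simp add: reflp_def fock_rel.zero)
  show "symp (\<lambda>x y. x - y \<in> fock_rel)"
    using fock_rel_uminus by (fastforce simp: symp_def)
  show "transp (\<lambda>x y. x - y \<in> fock_rel)"
    using fock_rel.add by (fastforce simp: transp_def)
qed

instantiation fock :: ab_group_add
begin

lift_definition zero_fock :: fock is 0 .

lift_definition plus_fock :: "fock \<Rightarrow> fock \<Rightarrow> fock" is "(+)"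
proof -
  fix x x' y y' :: "int \<Rightarrow>\<^sub>0 M exterior"
  assume "x - x' \<in> fock_rel" "y - y' \<in> fock_rel"
  from fock_rel.add[OF this] show "x + y - (x' + y') \<in> fock_rel"
    by (simp add: algebra_simps)
qed

lift_definition uminus_fock :: "fock \<Rightarrow> fock" is uminus
  using fock_rel_uminus by fastforce

lift_definition minus_fock :: "fock \<Rightarrow> fock \<Rightarrow> fock" is "(-)"
proof -
  fix x x' y y' :: "int \<Rightarrow>\<^sub>0 M exterior"
  assume "x - x' \<in> fock_rel" "y - y' \<in> fock_rel"
  from fock_rel.add[OF this(1) fock_rel_uminus[OF this(2)]]
  show "x - y - (x' - y') \<in> fock_rel"
    by (simp add: algebra_simps)
qed

instance
  by standard (transfer, simp add: algebra_simps fock_rel.zero)+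

end

lift_definition wedge :: "M exterior \<Rightarrow> fock \<Rightarrow> fock"
  is "\<lambda>u :: M exterior. Poly_Mapping.map ((*) u) :: (int \<Rightarrow>\<^sub>0 M exterior) \<Rightarrow> _"
proof -
  fix u and x y :: "int \<Rightarrow>\<^sub>0 M exterior"
  assume "x - y \<in> fock_rel"
  then have "Poly_Mapping.map ((*) u) (x - y) \<in> fock_rel"
    by (rule fock_rel.act)
  also have "Poly_Mapping.map ((*) u) (x - y)
      = Poly_Mapping.map ((*) u) x - Poly_Mapping.map ((*) u) y"
    by (rule poly_mapping_eqI) (simp add: lookup_map_times lookup_minus algebra_simps)
  finally show "Poly_Mapping.map ((*) u) x - Poly_Mapping.map ((*) u) y \<in> fock_rel" .
qed

lift_definition vac :: "int \<Rightarrow> fock" is "\<lambda>m. Poly_Mapping.single m 1" .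

definition is_partition :: "nat list \<Rightarrow> bool" where
  "is_partition l \<longleftrightarrow> sorted_wrt (\<ge>) l \<and> 0 \<notin> set l"

definition b_wedge :: "nat \<Rightarrow> int \<Rightarrow> nat list \<Rightarrow> M exterior" where
  "b_wedge r m l = prod_list (map (\<lambda>i. b (m - int i + int (nth_default 0 l i))) [0..<r])"

definition fock_basis :: "int \<Rightarrow> nat list \<Rightarrow> fock" where
  "fock_basis m l = wedge (b_wedge (length l) m l) (vac (m - int (length l)))"

lemma wedge_b_vac: "wedge (b m) (vac (m - 1)) = vac m"
proof transfer
  fix m
  have "Poly_Mapping.map ((*) (b m)) (Poly_Mapping.single (m - 1) 1)
      = Poly_Mapping.single (m - 1) (b m)"
    by (rule poly_mapping_eqI) (simp add: lookup_map_times lookup_single when_def)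
  then show "Poly_Mapping.map ((*) (b m)) (Poly_Mapping.single (m - 1) 1)
      - Poly_Mapping.single m 1 \<in> fock_rel"
    using fock_rel.absorb[of m] by simp
qed

lemma wedge_wedge: "wedge u (wedge v x) = wedge (u * v) x"
proof (transfer fixing: u v)
  fix x :: "int \<Rightarrow>\<^sub>0 M exterior"
  have "Poly_Mapping.map ((*) u) (Poly_Mapping.map ((*) v) x) = Poly_Mapping.map ((*) (u * v)) x"
    by (rule poly_mapping_eqI) (simp add: lookup_map_times mult.assoc)
  then show "Poly_Mapping.map ((*) u) (Poly_Mapping.map ((*) v) x)
      - Poly_Mapping.map ((*) (u * v)) x \<in> fock_rel"
    by (simp add: fock_rel.zero)
qed

lemma fock_basis_eq:
  assumes "length l \<le> r"
  shows "fock_basis m l = wedge (b_wedge r m l) (vac (m - int r))"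
  using assms
proof (induction r rule: dec_induct)
  case base
  show ?case by (simp add: fock_basis_def)
next
  case (step r)
  have "b_wedge (Suc r) m l = b_wedge r m l * b (m - int r)"
    using step.hyps by (simp add: b_wedge_def nth_default_def)
  moreover have "wedge (b (m - int r)) (vac (m - int (Suc r))) = vac (m - int r)"
    using wedge_b_vac[of "m - int r"] by (simp add: algebra_simps)
  ultimately show ?case
    using step.IH by (simp flip: wedge_wedge)
qed


section \<open>Schubert derivations\<close>

text \<open>
  Series in \<open>z\<close> and series in \<open>z\<^sup>-\<^sup>1\<close> are both elements of type \<open>fps\<close>; for the subscript
  \<open>minus\<close> the coefficient at \<open>n\<close> is that of \<open>z\<^sup>-\<^sup>n\<close>. Being \<open>\<int>\<close>-linear is the same as
  being additive.
\<close>

definition HS_derivation :: "('a::ab_group_add exterior \<Rightarrow> 'a exterior fps) \<Rightarrow> bool" where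
  "HS_derivation D \<longleftrightarrow> Modules.additive D \<and> (\<forall>u v. D (u * v) = D u * D v)"

definition sigma_plus :: "M exterior \<Rightarrow> M exterior fps" where
  "sigma_plus = (THE D. HS_derivation D \<and> (\<forall>j. D (b j) = Abs_fps (\<lambda>i. b (j + int i))))"

definition sigma_minus :: "M exterior \<Rightarrow> M exterior fps" where
  "sigma_minus = (THE D. HS_derivation D \<and> (\<forall>j. D (b j) = Abs_fps (\<lambda>i. b (j - int i))))"

definition sigma_minus_bar :: "M exterior \<Rightarrow> M exterior fps" where
  "sigma_minus_bar = (THE D. HS_derivation D \<and>
     (\<forall>j. D (b j) = fps_const (b j) - fps_const (b (j - 1)) * fps_X))"

definition fps_wedge :: "M exterior fps \<Rightarrow> fock fps \<Rightarrow> fock fps" where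
  "fps_wedge U X = Abs_fps (\<lambda>n. \<Sum>i=0..n. wedge (fps_nth U i) (fps_nth X (n - i)))"

text \<open>
  The Fock space is the direct sum of its charge \<open>m\<close> components, so an endomorphism
  given on each component is one endomorphism of the whole space.
\<close>

definition fock_extension ::
  "(M exterior \<Rightarrow> M exterior fps) \<Rightarrow> (int \<Rightarrow> fock fps) \<Rightarrow> fock \<Rightarrow> fock fps" where
  "fock_extension D v = (THE T. Modules.additive T \<and>
     (\<forall>m l r. is_partition l \<longrightarrow> length l \<le> r \<longrightarrow>
        T (fock_basis m l) = fps_wedge (D (b_wedge r m l)) (v (m - int r))))"

definition sigma_plus_fock :: "fock \<Rightarrow> fock fps" where
  "sigma_plus_fock = fock_extension sigma_plus
     (\<lambda>m. fps_wedge (sigma_plus (b m)) (fps_const (vac (m - 1))))"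

definition sigma_minus_fock :: "fock \<Rightarrow> fock fps" where
  "sigma_minus_fock = fock_extension sigma_minus (\<lambda>m. fps_const (vac m))"

definition sigma_minus_bar_fock :: "fock \<Rightarrow> fock fps" where
  "sigma_minus_bar_fock = fock_extension sigma_minus_bar (\<lambda>m. fps_const (vac m))"


section \<open>The boson-fermion correspondence\<close>

text \<open>
  The polynomial ring in \<open>e\<^sub>1, e\<^sub>2, \<dots>\<close>: monomials are exponent vectors \<open>nat \<Rightarrow>\<^sub>0 nat\<close>, in which
  position \<open>k\<close> is the exponent of \<open>e\<^bsub>k+1\<^esub>\<close>.
\<close>

type_synonym B = "(nat \<Rightarrow>\<^sub>0 nat) \<Rightarrow>\<^sub>0 int"

definition e :: "nat \<Rightarrow> B" where
  "e j = (if j = 0 then 1 else Poly_Mapping.single (Poly_Mapping.single (j - 1) 1) 1)"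

definition E :: "B fps" where
  "E = Abs_fps (\<lambda>j. (- 1) ^ j * e j)"

definition E_inv :: "B fps" where
  "E_inv = fps_right_inverse E 1"

lemma E_times_E_inv: "E * E_inv = 1"
  unfolding E_inv_def by (rule fps_right_inverse) (simp add: E_def e_def)

definition h :: "int \<Rightarrow> B" where
  "h j = (if j < 0 then 0 else fps_nth E_inv (nat j))"

definition Delta :: "nat list \<Rightarrow> B" where
  "Delta l = (let r = length l in
     det (mat r r (\<lambda>(i, j). h (int (l ! j) - int j + int i))))"

definition B_act :: "B \<Rightarrow> fock \<Rightarrow> fock" where
  "B_act = (THE act. Modules.module act \<and>
     (\<forall>i u. act (h (int i)) u = fps_nth (sigma_plus_fock u) i))"

text \<open>
  Maps from \<open>B\<close> to \<open>B[z\<^sup>-\<^sup>1]\<close>; the coefficient at \<open>n\<close> is again that of \<open>z\<^sup>-\<^sup>n\<close>.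
\<close>

definition B_transport :: "(fock \<Rightarrow> fock fps) \<Rightarrow> B \<Rightarrow> B poly" where
  "B_transport T = (THE S. Modules.additive S \<and>
     (\<forall>l n. is_partition l \<longrightarrow>
        B_act (poly.coeff (S (Delta l)) n) (vac 0) = fps_nth (T (fock_basis 0 l)) n))"

definition sigma_minus_B :: "B \<Rightarrow> B poly" where
  "sigma_minus_B = B_transport sigma_minus_fock"

definition sigma_minus_bar_B :: "B \<Rightarrow> B poly" where
  "sigma_minus_bar_B = B_transport sigma_minus_bar_fock"


section \<open>Formal series in two variables\<close>

text \<open>
  A formal series \<open>f\<close> in \<open>z\<close>, \<open>z\<^sup>-\<^sup>1\<close>, \<open>w\<close>, \<open>w\<^sup>-\<^sup>1\<close> is its coefficient function: \<open>f i j\<close> is the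
  coefficient of \<open>z\<^sup>i w\<^sup>j\<close>. The product is meaningful where each of its coefficients is a sum
  with finitely many non-zero terms, which is the case for all products formed below.
\<close>

type_synonym zw_series = "int \<Rightarrow> int \<Rightarrow> B"

definition zw_mult :: "zw_series \<Rightarrow> zw_series \<Rightarrow> zw_series" (infixl \<open>\<star>\<close> 70) where
  "f \<star> g = (\<lambda>i j. Sum_any (\<lambda>(k, l). f k l * g (i - k) (j - l)))"

definition zw_monom :: "int \<Rightarrow> int \<Rightarrow> zw_series" where
  "zw_monom p q = (\<lambda>i j. if i = p \<and> j = q then 1 else 0)"

definition in_z :: "B fps \<Rightarrow> zw_series" where
  "in_z f = (\<lambda>i j. if 0 \<le> i \<and> j = 0 then fps_nth f (nat i) else 0)"

definition in_w :: "B fps \<Rightarrow> zw_series" where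
  "in_w f = (\<lambda>i j. if i = 0 \<and> 0 \<le> j then fps_nth f (nat j) else 0)"

text \<open>The expansion of \<open>z / (z - w)\<close> in powers of \<open>w / z\<close>.\<close>

definition iota_zw :: zw_series where
  "iota_zw = (\<lambda>i j. if 0 \<le> j \<and> i = - j then 1 else 0)"

definition sigma_bar_sigma :: "B \<Rightarrow> zw_series" where
  "sigma_bar_sigma f = (\<lambda>i j. if i \<le> 0 \<and> j \<le> 0
     then poly.coeff (sigma_minus_bar_B (poly.coeff (sigma_minus_B f) (nat (- j)))) (nat (- i))
     else 0)"

definition Gamma :: "B \<Rightarrow> zw_series" where
  "Gamma f = (in_w E \<star> in_z E_inv) \<star> sigma_bar_sigma f"


section \<open>The action of the matrix units\<close>

definition B_unit :: "int \<Rightarrow> int \<Rightarrow> M \<Rightarrow> M" where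
  "B_unit i j x = Poly_Mapping.single i (Poly_Mapping.lookup x j)"

definition delta :: "('a::ab_group_add \<Rightarrow> 'a) \<Rightarrow> 'a exterior \<Rightarrow> 'a exterior" where
  "delta A = (THE D. Modules.additive D \<and> (\<forall>u v. D (u * v) = D u * v + u * D v) \<and>
     (\<forall>x. D (exterior_incl x) = exterior_incl (A x)))"

text \<open>On the charge \<open>m\<close> component this is \<open>\<delta>\<^sub>m\<close> of the matrix unit.\<close>

definition delta_fock :: "int \<Rightarrow> int \<Rightarrow> fock \<Rightarrow> fock" where
  "delta_fock i j = (THE D. Modules.additive D \<and>
     (\<forall>m l r. is_partition l \<longrightarrow> length l \<le> r \<longrightarrow> m - int r < j \<longrightarrow>
        D (fock_basis m l) = wedge (delta (B_unit i j) (b_wedge r m l)) (vac (m - int r))))"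

text \<open>The coefficient of \<open>\<delta>(z, w)\<close> belonging to the matrix unit \<open>(i, j)\<close> sits at \<open>z\<^sup>i w\<^sup>-\<^sup>j\<close>.\<close>

definition B_zw :: "int \<Rightarrow> B \<Rightarrow> zw_series" where
  "B_zw m = (THE T. (\<forall>p q. Modules.additive (\<lambda>f. T f p q)) \<and>
     (\<forall>l i j. is_partition l \<longrightarrow>
        B_act (T (Delta l) i (- j)) (vac m) = delta_fock i j (fock_basis m l)))"

end

(*
  Both halves of the matrix unit b_i (x) beta_j become explicit operators on B under F_m = B.
  Write b(z) = sum b_k z^k and iota(w) = sum iota_j w^(-j), where iota_j is the contraction with
  beta_j. On the Fock space one has

    b(z) sigma_+(w) = (1 - w/z) sigma_+(w) b(z),
    sigma_+(t) iota(w) = (1 - t/w) iota(w) sigma_+(t),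

  and sigma-bar_-(z), sigma_-(w) satisfy the same commutation rules with sigma_+ as b(z) and
  iota(w). Since B is generated by the h_n and h_n acts as sigma_n, comparing values on the vacuum
  gives

    b(z) (f [b]_(m-1)) = z^m E(z)^(-1) (sigma-bar_-(z) f) [b]_m,
    iota(w) (f [b]_m) = w^(-m) E(w) (sigma_-(w) f) [b]_(m-1).

  The action of b_i (x) beta_j is b_i iota_j; moving b(z) past E(w) produces the factor
  z/(z - w), expanded in w/z.

  The boson-fermion correspondence itself comes from the map Phi_m from F to B sending
  b_(c_1) ... b_(c_r) [b]_(m-r) to det(h_(c_j - m + i)): it turns sigma_n into multiplication by
  h_n, so it is a left inverse of f |-> f [b]_m. The formula for b(z) shows that f |-> f [b]_m is
  onto F_m, and applying Phi_m to [b]_(m+lambda) identifies its preimage as Delta_lambda.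
*)
theory Submission
  imports Defs
begin

section \<open>Universal properties of free rings and exterior algebras\<close>

text \<open>Most maps involved are definite descriptions on quotients, so each needs existence and
  uniqueness. Existence comes from prescribing values that respect the relations, uniqueness from
  induction over generators. For the Fock space only spanning by the semi-infinite monomials is
  shown directly; freeness over \<open>B\<close> comes out of \<open>Phi\<close>.

  Series identities are handled coefficient by coefficient. Two obstacles shape the statements. The
  rule for sigma-bar_- gives a closed two-term recursion, but the one for sigma_- has its factor on
  the other side, so solving it would need a geometric series; an extra induction on the index of
  \<open>h n\<close> unrolls it instead. Secondly, the sums giving b(z) and iota(w) on a fixed
  \<open>f\<close> must be cut off: they are asserted for all large \<open>N\<close>, with a
  threshold independent of the coefficient index, because multiplying by \<open>h n\<close> moves
  that index by one.

  The recursions for sigma_- and sigma-bar_- do not mention the charge, which is why maps on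
  \<open>B\<close> defined through charge 0 govern every F_m.\<close>

definition lin_ext :: "('a \<Rightarrow> 'r) \<Rightarrow> ('a \<Rightarrow>\<^sub>0 int) \<Rightarrow> 'r::ring_1" where
  "lin_ext f p = (\<Sum>k\<in>Poly_Mapping.keys p. of_int (Poly_Mapping.lookup p k) * f k)"

lemma lin_ext_superset:
  assumes "finite A" "Poly_Mapping.keys p \<subseteq> A"
  shows "lin_ext f p = (\<Sum>k\<in>A. of_int (Poly_Mapping.lookup p k) * f k)"
  unfolding lin_ext_def using assms
  by (intro sum.mono_neutral_left) (auto simp: in_keys_iff)

lemma lin_ext_add: "lin_ext f (p + q) = lin_ext f p + lin_ext f q"
proof -
  let ?A = "Poly_Mapping.keys p \<union> Poly_Mapping.keys q"
  have "lin_ext f (p + q) = (\<Sum>k\<in>?A. of_int (Poly_Mapping.lookup (p + q) k) * f k)"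
    by (rule lin_ext_superset) (auto simp: Poly_Mapping.keys_add)
  then show ?thesis
    by (simp add: lin_ext_superset[of ?A p] lin_ext_superset[of ?A q] lookup_add
        distrib_right sum.distrib)
qed

lemma additive_lin_ext: "Modules.additive (lin_ext f)"
  by (simp add: additive_def lin_ext_add)

lemma lin_ext_zero [simp]: "lin_ext f 0 = 0"
  by (simp add: lin_ext_def)

lemma lin_ext_single [simp]: "lin_ext f (Poly_Mapping.single k c) = of_int c * f k"
  by (simp add: lin_ext_def)

lemma lin_ext_diff: "lin_ext f (p - q) = lin_ext f p - lin_ext f q"
  by (rule additive.diff[OF additive_lin_ext])

lemma frag_induct [case_names zero single diff]:
  assumes "P 0" "\<And>k. P (frag_of k)" "\<And>p q. P p \<Longrightarrow> P q \<Longrightarrow> P (p - q)"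
  shows "P (p :: 'a \<Rightarrow>\<^sub>0 int)"
  by (rule frag_induction[of p UNIV]) (use assms in auto)

text \<open>Kept general in the monoid because it serves twice: for words under concatenation
  (\<open>ext_lift\<close>) and for exponent vectors under addition (\<open>B_end\<close>).\<close>

lemma lin_ext_mult:
  fixes f :: "'a::monoid_add \<Rightarrow> 'r::ring_1"
  assumes "\<And>k l. f (k + l) = f k * f l"
  shows "lin_ext f (p * q) = lin_ext f p * lin_ext f q"
proof (induction p rule: frag_induct)
  case (single k)
  show ?case
    by (induction q rule: frag_induct)
      (simp_all add: mult_single assms lin_ext_diff algebra_simps)
qed (simp_all add: lin_ext_diff algebra_simps)

text \<open>A representative is used instead of a lifted definition, since independence of its
  choice holds only for additive \<open>f\<close> with square-zero values.\<close>

definition ext_lift :: "('a::ab_group_add \<Rightarrow> 'r::ring_1) \<Rightarrow> 'a exterior \<Rightarrow> 'r" where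
  "ext_lift f u = lin_ext (\<lambda>w. prod_list (map f w)) (rep_exterior u)"

lemma lin_ext_prod_list_mult:
  "lin_ext (\<lambda>w. prod_list (map f w)) (p * q)
    = lin_ext (\<lambda>w. prod_list (map f w)) p * lin_ext (\<lambda>w. prod_list (map f w)) q"
  by (rule lin_ext_mult) (simp add: plus_list_def)

lemma lin_ext_exterior_ideal:
  assumes "Modules.additive f" "\<And>x. f x * f x = 0" "p \<in> exterior_ideal"
  shows "lin_ext (\<lambda>w. prod_list (map f w)) p = 0"
  using assms(3)
proof (induction rule: exterior_ideal.induct)
  case (linear x y)
  then show ?case
    by (simp add: lin_ext_diff additive.add[OF assms(1)])
next
  case (mult_left p a)
  then show ?case by (simp only: lin_ext_prod_list_mult) simp
next
  case (mult_right p a)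
  then show ?case by (simp only: lin_ext_prod_list_mult) simp
qed (simp_all add: lin_ext_add assms(2))

lemma rep_abs_exterior: "rep_exterior (abs_exterior p) - p \<in> exterior_ideal"
  using Quotient3_rep_abs[OF Quotient3_exterior, of p]
    Quotient3_rel_rep[OF Quotient3_exterior] exterior_ideal.zero
  by (metis (no_types, lifting) Quotient3_abs_rep Quotient3_exterior Quotient3_rel
      cancel_comm_monoid_add_class.diff_cancel)

context
  fixes f :: "'a::ab_group_add \<Rightarrow> 'r::ring_1"
  assumes f: "Modules.additive f" "\<And>x. f x * f x = 0"
begin

lemma ext_lift_abs: "ext_lift f (abs_exterior p) = lin_ext (\<lambda>w. prod_list (map f w)) p"
  using lin_ext_exterior_ideal[OF f rep_abs_exterior[of p]]
  by (simp add: ext_lift_def lin_ext_diff)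

lemma ext_lift_incl: "ext_lift f (exterior_incl x) = f x"
  by (simp add: exterior_incl.abs_eq ext_lift_abs)

lemma ext_lift_add: "ext_lift f (u + v) = ext_lift f u + ext_lift f v"
  by (induction u rule: exterior.abs_induct, induction v rule: exterior.abs_induct)
    (simp add: plus_exterior.abs_eq ext_lift_abs lin_ext_add)

lemma ext_lift_mult: "ext_lift f (u * v) = ext_lift f u * ext_lift f v"
  by (induction u rule: exterior.abs_induct, induction v rule: exterior.abs_induct)
    (simp add: times_exterior.abs_eq ext_lift_abs lin_ext_prod_list_mult)

lemma ext_lift_one: "ext_lift f 1 = 1"
  by (simp add: one_exterior.abs_eq ext_lift_abs zero_list_def flip: single_one)

end

section \<open>Generators and relations of the exterior algebra\<close>

lemma additive_exterior_incl: "Modules.additive exterior_incl"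
proof
  show "exterior_incl (x + y) = exterior_incl x + exterior_incl y" for x y :: 'a
    by transfer (simp add: exterior_ideal.linear diff_diff_eq[symmetric])
qed

lemma exterior_incl_square [simp]: "exterior_incl x * exterior_incl x = 0"
  by transfer (simp add: mult_single plus_list_def exterior_ideal.square)

lemma exterior_incl_anticomm:
  "exterior_incl x * exterior_incl y = - (exterior_incl y * exterior_incl x)"
proof -
  have "exterior_incl (x + y) * exterior_incl (x + y) = 0" by simp
  then have "exterior_incl x * exterior_incl y + exterior_incl y * exterior_incl x = 0"
    unfolding additive.add[OF additive_exterior_incl] by (simp add: algebra_simps)
  then show ?thesis by (simp add: add_eq_0_iff)
qed

text \<open>Closure under differences also supplies 0, as 1 - 1, and negatives; words arise by
  prepending one letter at a time.\<close>

lemma exterior_induct [case_names one diff mult]: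
  assumes "P 1" "\<And>u v. P u \<Longrightarrow> P v \<Longrightarrow> P (u - v)"
    and "\<And>x u. P u \<Longrightarrow> P (exterior_incl x * u)"
  shows "P u"
proof (induction u rule: exterior.abs_induct)
  fix p
  show "P (abs_exterior p)"
  proof (induction p rule: frag_induct)
    case zero
    show ?case using assms(2)[OF assms(1) assms(1)] by (simp add: zero_exterior.abs_eq)
  next
    case (single w)
    show ?case
    proof (induction w)
      case Nil
      show ?case using assms(1) by (simp add: one_exterior.abs_eq zero_list_def flip: single_one)
    next
      case (Cons x w)
      have "abs_exterior (frag_of (x # w)) = exterior_incl x * abs_exterior (frag_of w)"
        by (simp add: exterior_incl.abs_eq times_exterior.abs_eq mult_single plus_list_def)
      with assms(3)[OF Cons] show ?case by simp
    qed
  next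
    case (diff p q)
    then show ?case using assms(2) by (simp add: minus_exterior.abs_eq[symmetric])
  qed
qed

lemma M_exterior_induct [case_names one diff mult]:
  assumes "P 1" "\<And>u v. P u \<Longrightarrow> P v \<Longrightarrow> P (u - v)" "\<And>k u. P u \<Longrightarrow> P (b k * u)"
  shows "P u"
proof (induction u rule: exterior_induct)
  case (mult x u)
  show ?case
  proof (induction x rule: frag_induct)
    case zero
    show ?case using assms(2)[OF mult mult] by (simp add: additive.zero[OF additive_exterior_incl])
  next
    case (single k)
    show ?case using assms(3)[OF mult] by (simp add: b_def)
  next
    case (diff p q)
    then show ?case
      using assms(2) by (simp add: additive.diff[OF additive_exterior_incl] algebra_simps)
  qed
qed (use assms in auto)

lemma b_square [simp]: "b k * b k = 0"
  by (simp add: b_def)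

lemma b_anticomm: "b k * b l = - (b l * b k)"
  unfolding b_def by (rule exterior_incl_anticomm)

lemma b_square_left [simp]: "b k * (b k * u) = 0"
  by (simp flip: mult.assoc)

lemma b_anticomm_left: "b k * (b l * u) = - (b l * (b k * u))"
  by (simp add: b_anticomm[of k l] flip: mult.assoc)

section \<open>Contractions of the exterior algebra\<close>

text \<open>
  The contraction is a derivation twisted by the parity automorphism, so it is not itself
  determined by a universal property of rings. It becomes the lower left entry of the ring
  homomorphism sending \<open>u\<close> to the triangular matrix with rows \<open>u, 0\<close> and \<open>contr j u, parity u\<close>.
\<close>

datatype 'a tri = Tri (tri_ul: 'a) (tri_ll: 'a) (tri_lr: 'a)

instantiation tri :: (ring_1) ring_1
begin

definition "0 = Tri 0 0 0"
definition "1 = Tri 1 0 1"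
definition "x + y = Tri (tri_ul x + tri_ul y) (tri_ll x + tri_ll y) (tri_lr x + tri_lr y)"
definition "x - y = Tri (tri_ul x - tri_ul y) (tri_ll x - tri_ll y) (tri_lr x - tri_lr y)"
definition "- x = Tri (- tri_ul x) (- tri_ll x) (- tri_lr x)"
definition "x * y = Tri (tri_ul x * tri_ul y) (tri_ll x * tri_ul y + tri_lr x * tri_ll y)
  (tri_lr x * tri_lr y)"

lemmas tri_defs = zero_tri_def one_tri_def plus_tri_def minus_tri_def uminus_tri_def times_tri_def

instance
  by standard (simp_all add: tri_defs algebra_simps)

end

definition contr_rep :: "int \<Rightarrow> M \<Rightarrow> M exterior tri" where
  "contr_rep j x = Tri (exterior_incl x) (of_int (Poly_Mapping.lookup x j)) (- exterior_incl x)"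

definition contr :: "int \<Rightarrow> M exterior \<Rightarrow> M exterior" where
  "contr j u = tri_ll (ext_lift (contr_rep j) u)"

definition parity :: "M exterior \<Rightarrow> M exterior" where
  "parity = ext_lift (\<lambda>x. - exterior_incl x)"

lemma additive_contr_rep: "Modules.additive (contr_rep j)"
  by standard
    (simp add: contr_rep_def plus_tri_def additive.add[OF additive_exterior_incl] lookup_add)

lemma contr_rep_square: "contr_rep j x * contr_rep j x = 0"
  by (simp add: contr_rep_def times_tri_def zero_tri_def mult_of_int_commute)

lemmas contr_rep = additive_contr_rep contr_rep_square

lemma parity_rep: "Modules.additive (\<lambda>x. - exterior_incl x)"
    "- exterior_incl x * - exterior_incl x = 0"
  by (simp_all add: additive_def additive.add[OF additive_exterior_incl])

lemma parity_one [simp]: "parity 1 = 1"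
  unfolding parity_def by (rule ext_lift_one[OF parity_rep])

lemma parity_mult: "parity (u * v) = parity u * parity v"
  unfolding parity_def by (rule ext_lift_mult[OF parity_rep])

lemma additive_parity: "Modules.additive parity"
  unfolding parity_def by standard (rule ext_lift_add[OF parity_rep])

lemma parity_incl [simp]: "parity (exterior_incl x) = - exterior_incl x"
  unfolding parity_def by (rule ext_lift_incl[OF parity_rep])

lemma parity_b [simp]: "parity (b k) = - b k"
  by (simp add: b_def)

text \<open>A degree-one element picks up one sign for each letter of \<open>u\<close> that it
  crosses; \<open>parity\<close> records the product of these signs.\<close>

lemma mult_incl_parity: "exterior_incl x * parity u = u * exterior_incl x"
proof (induction u rule: exterior_induct)
  case (mult y u)
  have "exterior_incl x * parity (exterior_incl y * u)
      = - (exterior_incl x * exterior_incl y) * parity u"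
    by (simp add: parity_mult mult.assoc)
  also have "\<dots> = exterior_incl y * (exterior_incl x * parity u)"
    by (subst exterior_incl_anticomm) (simp add: mult.assoc)
  finally show ?case by (simp add: mult mult.assoc)
qed (simp_all add: additive.diff[OF additive_parity] algebra_simps)

lemma contr_lift_ul: "tri_ul (ext_lift (contr_rep j) u) = u"
  and contr_lift_lr: "tri_lr (ext_lift (contr_rep j) u) = parity u"
proof (induction u rule: exterior_induct)
  case (diff u v)
  have *: "ext_lift (contr_rep j) (u - v) = ext_lift (contr_rep j) u - ext_lift (contr_rep j) v"
    by (rule additive.diff, standard, rule ext_lift_add[OF contr_rep])
  { case 1 show ?case using diff by (simp add: * minus_tri_def) }
  { case 2 show ?case using diff by (simp add: * minus_tri_def additive.diff[OF additive_parity]) }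
next
  case (mult x u)
  { case 1 show ?case
      using mult
      by (simp add: ext_lift_mult[OF contr_rep] ext_lift_incl[OF contr_rep] times_tri_def)
        (simp add: contr_rep_def) }
  { case 2 show ?case
      using mult
      by (simp add: ext_lift_mult[OF contr_rep] ext_lift_incl[OF contr_rep] times_tri_def parity_mult)
        (simp add: contr_rep_def) }
qed (simp_all add: ext_lift_one[OF contr_rep] one_tri_def)

lemma additive_contr: "Modules.additive (contr j)"
  by standard (simp add: contr_def ext_lift_add[OF contr_rep] plus_tri_def)

lemma contr_mult: "contr j (u * v) = contr j u * v + parity u * contr j v"
  by (simp add: contr_def ext_lift_mult[OF contr_rep] times_tri_def contr_lift_ul contr_lift_lr)

lemma contr_one [simp]: "contr j 1 = 0"
  by (simp add: contr_def ext_lift_one[OF contr_rep] one_tri_def)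

lemma contr_incl [simp]: "contr j (exterior_incl x) = of_int (Poly_Mapping.lookup x j)"
  by (simp add: contr_def ext_lift_incl[OF contr_rep] contr_rep_def)

lemma contr_b: "contr j (b k) = (if j = k then 1 else 0)"
  by (simp add: b_def lookup_single)

lemma contr_eventually_zero: "\<exists>N. \<forall>j>N. contr j u = 0"
proof (induction u rule: M_exterior_induct)
  case (diff u v)
  then obtain N N' where "\<forall>j>N. contr j u = 0" "\<forall>j>N'. contr j v = 0" by blast
  then show ?case
    by (intro exI[of _ "max N N'"]) (simp add: additive.diff[OF additive_contr])
next
  case (mult k u)
  then obtain N where "\<forall>j>N. contr j u = 0" by blast
  then show ?case
    by (intro exI[of _ "max N k"]) (simp add: contr_mult contr_b)
qed simp

text \<open>For an index \<open>j\<close> beyond those occurring in \<open>u\<close>, contraction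
  with beta_j undoes multiplication by \<open>b j\<close>.\<close>

lemma b_annihilator:
  assumes "\<And>j. b j * u = 0"
  shows "u = 0"
proof -
  obtain j where "contr j u = 0"
    using contr_eventually_zero[of u] by (meson zless_add1_eq)
  moreover have "contr j (b j * u) = 0"
    by (simp add: assms additive.zero[OF additive_contr])
  ultimately show ?thesis
    by (simp add: contr_mult contr_b)
qed

text \<open>The two outermost terms cancel, hence the induction in steps of two; the middle term
  lies on the diagonal. No division by 2 is made, as the group may have torsion.\<close>

lemma antisym_sum_zero:
  fixes f :: "nat \<Rightarrow> nat \<Rightarrow> 'g::ab_group_add"
  assumes "\<And>i. f i i = 0" "\<And>i j. f i j + f j i = 0"
  shows "(\<Sum>i=0..n. f i (n - i)) = 0"
  using assms
proof (induction n arbitrary: f rule: induct_nat_012)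
  case 1
  then show ?case using 1(2)[of 0 1] by simp
next
  case (ge2 n)
  have "(\<Sum>i=0..Suc (Suc n). f i (Suc (Suc n) - i))
      = f 0 (Suc (Suc n)) + (\<Sum>i=0..Suc n. f (Suc i) (Suc n - i))"
    by (subst sum.atLeast0_atMost_Suc_shift) simp
  also have "(\<Sum>i=0..Suc n. f (Suc i) (Suc n - i))
      = (\<Sum>i=0..n. f (Suc i) (Suc (n - i))) + f (Suc (Suc n)) 0"
    by (subst sum.atLeast0_atMost_Suc) (simp add: Suc_diff_le)
  also have "(\<Sum>i=0..n. f (Suc i) (Suc (n - i))) = 0"
    using ge2.prems by (intro ge2.IH(1)) blast+
  finally show ?case using ge2.prems(2)[of 0 "Suc (Suc n)"] by (simp add: add.commute)
qed simp

section \<open>Hasse-Schmidt derivations\<close>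

definition shift :: "int \<Rightarrow> M \<Rightarrow> M" where
  "shift k = frag_extend (\<lambda>j. frag_of (j + k))"

lemma additive_shift: "Modules.additive (shift k)"
  by standard (simp add: shift_def frag_extend_add)

lemma shift_frag [simp]: "shift k (frag_of j) = frag_of (j + k)"
  by (simp add: shift_def)

lemma HS_derivation_additive: "HS_derivation D \<Longrightarrow> Modules.additive D"
  and HS_derivation_mult: "HS_derivation D \<Longrightarrow> D (u * v) = D u * D v"
  by (simp_all add: HS_derivation_def)

text \<open>The universal property is applied to the series with coefficients \<open>c i x\<close>.
  It squares to zero because in each coefficient the products of \<open>c i x\<close> and
  \<open>c (n - i) x\<close> cancel in pairs.\<close>

lemma HS_derivation_exists:
  assumes "\<And>i. Modules.additive (c i)"
  shows "\<exists>D. HS_derivation D \<and>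
    (\<forall>j. D (b j) = Abs_fps (\<lambda>i. exterior_incl (c i (frag_of j))))"
proof -
  define g where "g x = Abs_fps (\<lambda>i. exterior_incl (c i x))" for x
  have "Modules.additive g"
    by standard (simp add: g_def fps_eq_iff additive.add[OF assms]
        additive.add[OF additive_exterior_incl])
  moreover have "g x * g x = 0" for x
  proof (rule fps_ext)
    show "fps_nth (g x * g x) n = fps_nth 0 n" for n
      unfolding fps_mult_nth g_def fps_nth_Abs_fps fps_zero_nth
      by (rule antisym_sum_zero) (simp, subst exterior_incl_anticomm, simp)
  qed
  ultimately have "HS_derivation (ext_lift g)" "ext_lift g (b j) = g (frag_of j)" for j
    by (simp_all add: HS_derivation_def additive_def ext_lift_add ext_lift_mult ext_lift_incl b_def)
  then show ?thesis by (auto simp: g_def)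
qed

text \<open>
  Multiplicativity alone does not force \<open>D 1 = 1\<close>; here it holds because \<open>1 - D 1\<close> annihilates all
  \<open>D (b j)\<close>, whose leading coefficients have no common annihilator.
\<close>

lemma HS_derivation_one:
  assumes "HS_derivation D" "\<And>j. fps_nth (D (b j)) 0 = b j"
  shows "D 1 = 1"
proof -
  define q where "q = 1 - D 1"
  have *: "D (b j) * q = 0" for j
    using HS_derivation_mult[OF assms(1), of "b j" 1] by (simp add: q_def algebra_simps)
  have "fps_nth q n = 0" for n
  proof (induction n rule: less_induct)
    case (less n)
    have "b j * fps_nth q n = 0" for j
    proof -
      have "0 = fps_nth (D (b j) * q) n" by (simp add: *)
      also have "\<dots> = (\<Sum>i=0..n. fps_nth (D (b j)) i * fps_nth q (n - i))"
        by (rule fps_mult_nth)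
      also have "\<dots> = (\<Sum>i\<in>{0}. fps_nth (D (b j)) i * fps_nth q (n - i))"
        by (rule sum.mono_neutral_right) (auto simp: less)
      finally show ?thesis by (simp add: assms(2))
    qed
    then show ?case by (rule b_annihilator)
  qed
  then have "q = 0" by (simp add: fps_eq_iff)
  then show ?thesis by (simp add: q_def)
qed

lemma HS_derivation_unique:
  assumes "HS_derivation D" "HS_derivation D'"
    and "\<And>j. fps_nth (D (b j)) 0 = b j" "\<And>j. D (b j) = D' (b j)"
  shows "D = D'"
proof
  show "D u = D' u" for u
  proof (induction u rule: M_exterior_induct)
    case one
    show ?case using HS_derivation_one assms by metis
  next
    case (diff u v)
    then show ?case
      by (simp add: additive.diff[OF HS_derivation_additive] assms(1,2))
  next
    case (mult k u)
    then show ?case by (simp add: HS_derivation_mult assms)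
  qed
qed

lemma HS_derivation_the:
  assumes "\<And>i. Modules.additive (c i)" "c 0 = id"
    and "\<And>j. G j = Abs_fps (\<lambda>i. exterior_incl (c i (frag_of j)))"
  shows "HS_derivation (THE D. HS_derivation D \<and> (\<forall>j. D (b j) = G j)) \<and>
    (\<forall>j. (THE D. HS_derivation D \<and> (\<forall>j. D (b j) = G j)) (b j) = G j)"
proof (rule theI'[where P = "\<lambda>D. HS_derivation D \<and> (\<forall>j. D (b j) = G j)"])
  from HS_derivation_exists[of c] assms
  obtain D where "HS_derivation D \<and> (\<forall>j. D (b j) = G j)" by metis
  moreover have "fps_nth (G j) 0 = b j" for j
    by (simp add: assms b_def)
  ultimately show "\<exists>!D. HS_derivation D \<and> (\<forall>j. D (b j) = G j)"
    using HS_derivation_unique by metis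
qed

section \<open>The three Schubert derivations on the exterior algebra\<close>

lemma HS_sigma_plus: "HS_derivation sigma_plus"
  and sigma_plus_b: "sigma_plus (b j) = Abs_fps (\<lambda>i. b (j + int i))"
proof -
  have "shift 0 = id"
    by (simp add: fun_eq_iff shift_def flip: frag_expansion)
  with HS_derivation_the[of "\<lambda>i. shift (int i)" "\<lambda>j. Abs_fps (\<lambda>i. b (j + int i))"]
  show "HS_derivation sigma_plus" "sigma_plus (b j) = Abs_fps (\<lambda>i. b (j + int i))" for j
    by (simp_all add: sigma_plus_def additive_shift b_def)
qed

lemma HS_sigma_minus: "HS_derivation sigma_minus"
  and sigma_minus_b: "sigma_minus (b j) = Abs_fps (\<lambda>i. b (j - int i))"
proof -
  have "shift 0 = id"
    by (simp add: fun_eq_iff shift_def flip: frag_expansion)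
  with HS_derivation_the[of "\<lambda>i. shift (- int i)" "\<lambda>j. Abs_fps (\<lambda>i. b (j - int i))"]
  show "HS_derivation sigma_minus" "sigma_minus (b j) = Abs_fps (\<lambda>i. b (j - int i))" for j
    by (simp_all add: sigma_minus_def additive_shift b_def)
qed

lemma HS_sigma_minus_bar: "HS_derivation sigma_minus_bar"
  and sigma_minus_bar_b:
    "sigma_minus_bar (b j) = fps_const (b j) - fps_const (b (j - 1)) * fps_X"
proof -
  define c :: "nat \<Rightarrow> M \<Rightarrow> M" where
    "c i = (if i = 0 then id else if i = 1 then \<lambda>x. - shift (- 1) x else (\<lambda>x. 0))" for i
  have "Modules.additive (c i)" for i
    by standard (simp add: c_def additive.add[OF additive_shift])
  moreover have "fps_const (b j) - fps_const (b (j - 1)) * fps_X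
      = Abs_fps (\<lambda>i. exterior_incl (c i (frag_of j)))" for j
    by (rule fps_ext) (auto simp: c_def b_def fps_X_def additive.minus[OF additive_exterior_incl]
        additive.zero[OF additive_exterior_incl])
  moreover have "c 0 = id" by (simp add: c_def)
  ultimately show "HS_derivation sigma_minus_bar"
    "sigma_minus_bar (b j) = fps_const (b j) - fps_const (b (j - 1)) * fps_X" for j
    using HS_derivation_the[of c "\<lambda>j. fps_const (b j) - fps_const (b (j - 1)) * fps_X"]
    by (simp_all add: sigma_minus_bar_def)
qed

text \<open>Contraction is a derivation only up to \<open>parity\<close>, but moving
  \<open>b i\<close> across \<open>u\<close> costs the same sign, so the product of the two is an
  honest derivation. This splits the action of a matrix unit into creation and annihilation.\<close>

lemma delta_B_unit: "delta (B_unit i j) u = b i * contr j u"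
proof -
  define D where "D u = b i * contr j u" for u
  have D: "Modules.additive D \<and> (\<forall>u v. D (u * v) = D u * v + u * D v) \<and>
     (\<forall>x. D (exterior_incl x) = exterior_incl (B_unit i j x))"
  proof (intro conjI allI)
    show "Modules.additive D"
      by standard (simp add: D_def additive.add[OF additive_contr] algebra_simps)
    show "D (u * v) = D u * v + u * D v" for u v
    proof -
      have "b i * (parity u * contr j v) = u * (b i * contr j v)"
        using mult_incl_parity[of "frag_of i" u] by (simp add: b_def flip: mult.assoc)
      then show ?thesis by (simp add: D_def contr_mult algebra_simps)
    qed
    show "D (exterior_incl x) = exterior_incl (B_unit i j x)" for x
    proof (induction x rule: frag_induct)
      case (diff p q)
      have "Modules.additive (B_unit i j)"
        by standard (simp add: B_unit_def lookup_add single_add)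
      with diff show ?case
        by (simp add: D_def additive.diff[OF additive_exterior_incl] additive.diff
            additive.diff[OF additive_contr] lookup_minus algebra_simps del: contr_incl)
    qed (auto simp: D_def B_unit_def lookup_single b_def when_def
        additive.zero[OF additive_contr] additive.zero[OF additive_exterior_incl])
  qed
  have "delta (B_unit i j) = D"
    unfolding delta_def
  proof (rule the_equality, rule D)
    fix D'
    assume D': "Modules.additive D' \<and> (\<forall>u v. D' (u * v) = D' u * v + u * D' v) \<and>
      (\<forall>x. D' (exterior_incl x) = exterior_incl (B_unit i j x))"
    show "D' = D"
    proof
      show "D' u = D u" for u
      proof (induction u rule: exterior_induct)
        case one
        \<comment> \<open>The Leibniz rule at 1 reads D 1 = D 1 + D 1, so both maps kill 1.\<close>
        have "D' (1 * 1) = D' 1 * 1 + 1 * D' 1" "D (1 * 1) = D 1 * 1 + 1 * D 1"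
          using D D' by blast+
        then show ?case by simp
      next
        case (diff u v)
        then show ?case using D D' by (simp add: additive.diff)
      qed (use D D' in simp)
    qed
  qed
  then show ?thesis by (simp add: D_def)
qed

section \<open>Additive maps on the Fock space\<close>

lemma poly_mapping_sum_single:
  "(\<Sum>k\<in>Poly_Mapping.keys x. Poly_Mapping.single k (Poly_Mapping.lookup x k)) = x"
proof (rule poly_mapping_eqI)
  fix k
  have "Poly_Mapping.lookup (\<Sum>k\<in>Poly_Mapping.keys x. Poly_Mapping.single k (Poly_Mapping.lookup x k)) k
      = (\<Sum>l\<in>Poly_Mapping.keys x. if l = k then Poly_Mapping.lookup x l else 0)"
    by (simp add: lookup_sum lookup_single when_def)
  also have "\<dots> = Poly_Mapping.lookup x k"
    by (simp add: in_keys_iff)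
  finally show "Poly_Mapping.lookup (\<Sum>k\<in>Poly_Mapping.keys x.
      Poly_Mapping.single k (Poly_Mapping.lookup x k)) k = Poly_Mapping.lookup x k" .
qed

lemma wedge_add_right: "wedge u (x + y) = wedge u x + wedge u y"
proof (transfer fixing: u)
  fix x y :: "int \<Rightarrow>\<^sub>0 M exterior"
  have "Poly_Mapping.map ((*) u) (x + y) = Poly_Mapping.map ((*) u) x + Poly_Mapping.map ((*) u) y"
    by (rule poly_mapping_eqI) (simp add: lookup_map_times lookup_add algebra_simps)
  then show "Poly_Mapping.map ((*) u) (x + y)
      - (Poly_Mapping.map ((*) u) x + Poly_Mapping.map ((*) u) y) \<in> fock_rel"
    by (simp add: fock_rel.zero)
qed

lemma wedge_add_left: "wedge (u + v) x = wedge u x + wedge v x"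
proof (transfer fixing: u v)
  fix x :: "int \<Rightarrow>\<^sub>0 M exterior"
  have "Poly_Mapping.map ((*) (u + v)) x = Poly_Mapping.map ((*) u) x + Poly_Mapping.map ((*) v) x"
    by (rule poly_mapping_eqI) (simp add: lookup_map_times lookup_add algebra_simps)
  then show "Poly_Mapping.map ((*) (u + v)) x
      - (Poly_Mapping.map ((*) u) x + Poly_Mapping.map ((*) v) x) \<in> fock_rel"
    by (simp add: fock_rel.zero)
qed

lemma additive_wedge: "Modules.additive (wedge u)"
  by standard (rule wedge_add_right)

lemma additive_wedge_left: "Modules.additive (\<lambda>u. wedge u x)"
  by standard (rule wedge_add_left)

lemmas wedge_simps [simp] = additive.zero[OF additive_wedge] additive.zero[OF additive_wedge_left]
  additive.minus[OF additive_wedge] additive.minus[OF additive_wedge_left]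
lemmas wedge_diff = additive.diff[OF additive_wedge] additive.diff[OF additive_wedge_left]
lemmas wedge_sum_right = additive.sum[OF additive_wedge]
lemmas wedge_sum_left = additive.sum[OF additive_wedge_left]

lemma map_times_one: "Poly_Mapping.map ((*) 1) x = (x :: int \<Rightarrow>\<^sub>0 M exterior)"
  by (rule poly_mapping_eqI) (simp add: lookup_map_times)

lemma wedge_one [simp]: "wedge 1 x = x"
  by (induction x rule: fock.abs_induct) (simp add: wedge.abs_eq map_times_one)

lemma map_times_single:
  "Poly_Mapping.map ((*) u) (Poly_Mapping.single m v) = Poly_Mapping.single m (u * v :: M exterior)"
  by (rule poly_mapping_eqI) (simp add: lookup_map_times lookup_single when_def)

lemma wedge_vac: "wedge u (vac m) = abs_fock (Poly_Mapping.single m u)"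
  by (simp add: vac.abs_eq wedge.abs_eq map_times_single)

lemma wedge_b_vac_same: "wedge (b m) (vac m) = 0"
  unfolding wedge_vac zero_fock.abs_eq
  by (simp add: fock.abs_eq_iff fock_rel.kill)

lemma abs_fock_sum: "finite A \<Longrightarrow> abs_fock (sum f A) = (\<Sum>k\<in>A. abs_fock (f k))"
  by (induction A rule: finite_induct)
    (simp_all add: zero_fock.abs_eq flip: plus_fock.abs_eq)

lemma fock_induct [case_names vac diff wedge]:
  assumes vac: "\<And>m. P (vac m)" and diff: "\<And>x y. P x \<Longrightarrow> P y \<Longrightarrow> P (x - y)"
    and wedge: "\<And>k x. P x \<Longrightarrow> P (wedge (b k) x)"
  shows "P x"
proof (induction x rule: fock.abs_induct)
  fix x :: "int \<Rightarrow>\<^sub>0 M exterior"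
  have zero: "P 0" using diff[OF vac vac, of 0 0] by simp
  have add: "P (x + y)" if "P x" "P y" for x y
    using diff[OF that(1) diff[OF zero that(2)]] by simp
  have "P (wedge u (vac m))" for u m
    by (induction u rule: M_exterior_induct)
      (simp_all add: vac diff wedge wedge_diff flip: wedge_wedge)
  then have "P (abs_fock (Poly_Mapping.single m u))" for u m
    by (simp add: wedge_vac)
  then have "P (\<Sum>k\<in>Poly_Mapping.keys x. abs_fock (Poly_Mapping.single k (Poly_Mapping.lookup x k)))"
    using finite_keys[of x]
    by (induction rule: finite_subset_induct[OF finite_keys subset_refl]) (simp_all add: zero add)
  also have "\<dots> = abs_fock x"
    by (simp add: poly_mapping_sum_single flip: abs_fock_sum)
  finally show "P (abs_fock x)" .
qed

definition fock_lift :: "(int \<Rightarrow> M exterior \<Rightarrow> 'g::ab_group_add) \<Rightarrow> fock \<Rightarrow> 'g" where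
  "fock_lift G x = (\<Sum>k\<in>Poly_Mapping.keys (rep_fock x). G k (Poly_Mapping.lookup (rep_fock x) k))"

text \<open>\<open>G m u\<close> is the prescribed value at \<open>u \<and> [b]\<^sub>m\<close>.\<close>

locale fock_map =
  fixes G :: "int \<Rightarrow> M exterior \<Rightarrow> 'g::ab_group_add"
  assumes G_additive: "Modules.additive (G m)"
    and G_absorb: "G (m - 1) (u * b m) = G m u"
    and G_kill: "G m (u * b m) = 0"
begin

definition G_sum :: "(int \<Rightarrow>\<^sub>0 M exterior) \<Rightarrow> 'g" where
  "G_sum x = (\<Sum>k\<in>Poly_Mapping.keys x. G k (Poly_Mapping.lookup x k))"

lemma G_sum_superset:
  assumes "finite A" "Poly_Mapping.keys x \<subseteq> A"
  shows "G_sum x = (\<Sum>k\<in>A. G k (Poly_Mapping.lookup x k))"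
  unfolding G_sum_def using assms
  by (intro sum.mono_neutral_left) (auto simp: in_keys_iff additive.zero[OF G_additive])

lemma additive_G_sum: "Modules.additive G_sum"
proof
  fix x y :: "int \<Rightarrow>\<^sub>0 M exterior"
  let ?A = "Poly_Mapping.keys x \<union> Poly_Mapping.keys y"
  have "G_sum (x + y) = (\<Sum>k\<in>?A. G k (Poly_Mapping.lookup (x + y) k))"
    by (rule G_sum_superset) (auto simp: Poly_Mapping.keys_add)
  then show "G_sum (x + y) = G_sum x + G_sum y"
    by (simp add: G_sum_superset[of ?A x] G_sum_superset[of ?A y] lookup_add
        additive.add[OF G_additive] sum.distrib)
qed

lemma G_sum_single: "G_sum (Poly_Mapping.single m u) = G m u"
  by (simp add: G_sum_def additive.zero[OF G_additive])

text \<open>The extra left factor \<open>u\<close> strengthens the claim so that the induction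
  passes through \<open>act\<close>.\<close>

lemma G_sum_rel:
  assumes "x \<in> fock_rel"
  shows "G_sum (Poly_Mapping.map ((*) u) x) = 0"
  using assms
proof (induction arbitrary: u rule: fock_rel.induct)
  case zero
  have "Poly_Mapping.map ((*) u) 0 = (0 :: int \<Rightarrow>\<^sub>0 M exterior)"
    by (rule poly_mapping_eqI) (simp add: lookup_map_times)
  then show ?case by (simp add: additive.zero[OF additive_G_sum])
next
  case (absorb m)
  have "Poly_Mapping.map ((*) u) (Poly_Mapping.single (m - 1) (b m) - Poly_Mapping.single m 1)
      = Poly_Mapping.single (m - 1) (u * b m) - Poly_Mapping.single m u"
    by (rule poly_mapping_eqI) (simp add: lookup_map_times lookup_minus lookup_single when_def)
  then show ?case
    by (simp add: additive.diff[OF additive_G_sum] G_sum_single G_absorb)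
next
  case (kill m)
  then show ?case by (simp add: map_times_single G_sum_single G_kill)
next
  case (add x y)
  have "Poly_Mapping.map ((*) u) (x + y) = Poly_Mapping.map ((*) u) x + Poly_Mapping.map ((*) u) y"
    by (rule poly_mapping_eqI) (simp add: lookup_map_times lookup_add algebra_simps)
  with add.IH show ?case by (simp add: additive.add[OF additive_G_sum])
next
  case (act x v)
  have "Poly_Mapping.map ((*) u) (Poly_Mapping.map ((*) v) x) = Poly_Mapping.map ((*) (u * v)) x"
    by (rule poly_mapping_eqI) (simp add: lookup_map_times mult.assoc)
  with act.IH show ?case by simp
qed

lemma fock_lift_abs: "fock_lift G (abs_fock x) = G_sum x"
proof -
  have "rep_fock (abs_fock x) - x \<in> fock_rel"
    using fock.abs_eq_iff Quotient3_abs_rep[OF Quotient3_fock] by metis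
  from G_sum_rel[OF this, of 1] have "G_sum (rep_fock (abs_fock x) - x) = 0"
    by (simp add: map_times_one)
  then show ?thesis
    by (simp add: additive.diff[OF additive_G_sum]) (simp add: fock_lift_def G_sum_def)
qed

lemma additive_fock_lift: "Modules.additive (fock_lift G)"
proof
  show "fock_lift G (x + y) = fock_lift G x + fock_lift G y" for x y
    by (induction x rule: fock.abs_induct, induction y rule: fock.abs_induct)
      (simp add: plus_fock.abs_eq fock_lift_abs additive.add[OF additive_G_sum])
qed

lemma fock_lift_wedge_vac: "fock_lift G (wedge u (vac m)) = G m u"
  by (simp add: wedge_vac fock_lift_abs G_sum_single)

end

section \<open>Semi-infinite monomials span the Fock space\<close>

definition b_word :: "int list \<Rightarrow> M exterior" where
  "b_word cs = prod_list (map b cs)"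

lemma b_word_simps [simp]: "b_word [] = 1" "b_word (c # cs) = b c * b_word cs"
    "b_word (cs @ ds) = b_word cs * b_word ds"
  by (simp_all add: b_word_def)

text \<open>Insertion sort: a repeated letter gives 0, every transposition a sign.\<close>

lemma b_times_decreasing_word:
  assumes "sorted_wrt (>) cs"
  shows "b k * b_word cs = 0 \<or> (\<exists>ds. sorted_wrt (>) ds \<and> set ds = insert k (set cs) \<and>
    (b k * b_word cs = b_word ds \<or> b k * b_word cs = - b_word ds))"
  using assms
proof (induction cs)
  case Nil
  show ?case by (rule disjI2, rule exI[of _ "[k]"]) simp
next
  case (Cons c cs)
  consider "k = c" | "c < k" | "k < c" by linarith
  then show ?case
  proof cases
    case 2
    with Cons.prems show ?thesis by (intro disjI2 exI[of _ "k # c # cs"]) auto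
  next
    case 3
    have *: "b k * b_word (c # cs) = - (b c * (b k * b_word cs))"
      by (simp add: b_anticomm_left[of k c])
    from Cons consider "b k * b_word cs = 0" | ds where "sorted_wrt (>) ds"
      "set ds = insert k (set cs)" "b k * b_word cs = b_word ds \<or> b k * b_word cs = - b_word ds"
      by auto
    then show ?thesis
    proof cases
      case (2 ds)
      with 3 Cons.prems show ?thesis
        unfolding * by (intro disjI2 exI[of _ "c # ds"]) auto
    next
      case 1
      then show ?thesis unfolding * by simp
    qed
  qed simp
qed

text \<open>Subtracting the staircase \<open>n + length ds, ..., n + 1\<close> from a strictly
  decreasing word leaves a weakly decreasing one. Its trailing zeros are dropped, whence the
  inequality between the lengths.\<close>

lemma decreasing_word_partition:
  assumes "sorted_wrt (>) ds" "\<forall>c\<in>set ds. n < c"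
  shows "\<exists>l. is_partition l \<and> length l \<le> length ds \<and>
    (\<forall>i<length ds. ds ! i = n + int (length ds) - int i + int (nth_default 0 l i))"
  using assms
proof (induction ds)
  case Nil
  show ?case by (intro exI[of _ "[]"]) (simp add: is_partition_def)
next
  case (Cons c ds)
  then obtain l where l: "is_partition l" "length l \<le> length ds"
    "\<And>i. i < length ds \<Longrightarrow> ds ! i = n + int (length ds) - int i + int (nth_default 0 l i)"
    by auto
  define m where "m = n + int (length ds)"
  have c: "c > m + int (nth_default 0 l 0)"
  proof (cases ds)
    case Nil
    with l(2) Cons.prems show ?thesis by (simp add: m_def nth_default_def)
  next
    case (Cons d ds')
    with l(3)[of 0] Cons.prems show ?thesis by (simp add: m_def)
  qed
  have l0: "l = []" if "nth_default 0 l 0 = 0"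
    using that l(1) by (cases l) (auto simp: is_partition_def)
  show ?case
  proof (cases "c = m + 1")
    case True
    \<comment> \<open>With no gap above \<open>m\<close> the new part is 0, which forces all later
      parts to be 0 as well.\<close>
    with c have "l = []" by (intro l0) simp
    with True l(3) show ?thesis
      by (intro exI[of _ "[]"]) (auto simp: is_partition_def m_def nth_Cons split: nat.split)
  next
    case False
    define a where "a = nat (c - m - 1)"
    have a: "int a = c - m - 1" "a > 0" "a \<ge> nth_default 0 l 0"
      using False c by (auto simp: a_def)
    have "is_partition (a # l)"
      using l(1) a by (cases l) (auto simp: is_partition_def)
    with l a show ?thesis
      by (intro exI[of _ "a # l"]) (auto simp: m_def nth_Cons split: nat.split)
  qed
qed

lemma b_wedge_eq_b_word:
  "b_wedge r m l = b_word (map (\<lambda>i. m - int i + int (nth_default 0 l i)) [0..<r])"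
  by (simp add: b_wedge_def b_word_def comp_def)

lemma fock_basis_of_decreasing:
  assumes "sorted_wrt (>) ds" "\<forall>c\<in>set ds. n < c"
  shows "\<exists>m l. is_partition l \<and> wedge (b_word ds) (vac n) = fock_basis m l"
proof -
  from decreasing_word_partition[OF assms] obtain l where l: "is_partition l" "length l \<le> length ds"
    "\<And>i. i < length ds \<Longrightarrow> ds ! i = n + int (length ds) - int i + int (nth_default 0 l i)"
    by auto
  have "map (\<lambda>i. n + int (length ds) - int i + int (nth_default 0 l i)) [0..<length ds] = ds"
    by (rule nth_equalityI) (simp_all add: l(3))
  then have "fock_basis (n + int (length ds)) l = wedge (b_word ds) (vac n)"
    using fock_basis_eq[OF l(2), of "n + int (length ds)"] by (simp add: b_wedge_eq_b_word)
  with l(1) show ?thesis by metis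
qed

lemma partition_nth_default_mono:
  "is_partition l \<Longrightarrow> i < j \<Longrightarrow> nth_default 0 l j \<le> nth_default 0 l i"
  by (auto simp: is_partition_def nth_default_def sorted_wrt_iff_nth_less)

lemma fock_basis_word:
  assumes "is_partition l" "length l \<le> r"
  obtains cs where "sorted_wrt (>) cs" "\<forall>c\<in>set cs. m - int r < c"
    "b_wedge r m l = b_word cs" "fock_basis m l = wedge (b_word cs) (vac (m - int r))"
proof
  let ?cs = "map (\<lambda>i. m - int i + int (nth_default 0 l i)) [0..<r]"
  show "sorted_wrt (>) ?cs"
    unfolding sorted_wrt_iff_nth_less
  proof (intro allI impI)
    fix i j assume "i < j" "j < length ?cs"
    with partition_nth_default_mono[OF assms(1), of i j] show "?cs ! i > ?cs ! j" by simp
  qed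
  show "\<forall>c\<in>set ?cs. m - int r < c" by auto
  show "fock_basis m l = wedge (b_word ?cs) (vac (m - int r))"
    using fock_basis_eq[OF assms(2)] by (simp add: b_wedge_eq_b_word)
qed (rule b_wedge_eq_b_word)

inductive_set fock_span :: "fock set" where
  basis: "is_partition l \<Longrightarrow> fock_basis m l \<in> fock_span"
| diff: "x \<in> fock_span \<Longrightarrow> y \<in> fock_span \<Longrightarrow> x - y \<in> fock_span"

lemma is_partition_Nil [simp]: "is_partition []"
  by (simp add: is_partition_def)

lemma fock_basis_Nil [simp]: "fock_basis m [] = vac m"
  by (simp add: fock_basis_def b_wedge_def)

lemma zero_fock_span: "0 \<in> fock_span"
  using fock_span.diff[OF fock_span.basis[of "[]" 0] fock_span.basis[of "[]" 0]] by simp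

lemma fock_span_uminus: "x \<in> fock_span \<Longrightarrow> - x \<in> fock_span"
  using fock_span.diff[OF zero_fock_span, of x] by simp

text \<open>The span contains every vacuum and is stable under left multiplication by each
  \<open>b k\<close>, since the product with a decreasing word can be sorted again.\<close>

lemma fock_span_UNIV: "x \<in> fock_span"
proof (induction x rule: fock_induct)
  case (vac m)
  show ?case using fock_span.basis[of "[]" m] by simp
next
  case (wedge k x)
  from wedge.IH show ?case
  proof (induction rule: fock_span.induct)
    case (basis l m)
    \<comment> \<open>The vacuum is lowered below \<open>k\<close>, so that after sorting every
      letter still exceeds the vacuum index.\<close>
    define r where "r = max (length l) (nat (m - k) + 1)"
    obtain cs where cs: "sorted_wrt (>) cs" "\<forall>c\<in>set cs. m - int r < c"
      "fock_basis m l = wedge (b_word cs) (vac (m - int r))"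
      by (rule fock_basis_word[OF basis, of r m]) (auto simp: r_def)
    have *: "wedge (b k) (fock_basis m l) = wedge (b k * b_word cs) (vac (m - int r))"
      by (simp add: cs(3) wedge_wedge)
    have k: "m - int r < k" by (auto simp: r_def)
    from b_times_decreasing_word[OF cs(1), of k] show ?case
    proof (elim disjE exE conjE)
      fix ds assume "sorted_wrt (>) ds" "set ds = insert k (set cs)"
      with fock_basis_of_decreasing[of ds "m - int r"] cs(2) k
      have ds: "wedge (b_word ds) (vac (m - int r)) \<in> fock_span"
        by (auto intro: fock_span.basis)
      { assume "b k * b_word cs = b_word ds"
        with ds show ?thesis by (simp add: *) }
      { assume "b k * b_word cs = - b_word ds"
        with fock_span_uminus[OF ds] show ?thesis by (simp add: *) }
    qed (simp add: * zero_fock_span)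
  qed (simp add: wedge_diff fock_span.diff)
qed (rule fock_span.diff)

lemma fock_basis_induct [case_names basis diff]:
  assumes "\<And>m l. is_partition l \<Longrightarrow> P (fock_basis m l)" "\<And>x y. P x \<Longrightarrow> P y \<Longrightarrow> P (x - y)"
  shows "P x"
  using fock_span_UNIV[of x] by (induction rule: fock_span.induct) (use assms in auto)

text \<open>This is the uniqueness half for the definite descriptions on the Fock space.\<close>

lemma additive_fock_eqI:
  assumes "Modules.additive S" "Modules.additive T"
    and "\<And>m l. is_partition l \<Longrightarrow> S (fock_basis m l) = T (fock_basis m l)"
  shows "S = T"
proof
  show "S x = T x" for x
    by (induction x rule: fock_basis_induct) (simp_all add: assms additive.diff)
qed

section \<open>Extension of derivations to the Fock space\<close>

lemma fps_wedge_nth: "fps_nth (fps_wedge U X) n = (\<Sum>i=0..n. wedge (fps_nth U i) (fps_nth X (n - i)))"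
  by (simp add: fps_wedge_def)

lemma fps_wedge_add_left: "fps_wedge (U + V) X = fps_wedge U X + fps_wedge V X"
  by (rule fps_ext) (simp add: fps_wedge_nth wedge_add_left sum.distrib)

lemma fps_wedge_add_right: "fps_wedge U (X + Y) = fps_wedge U X + fps_wedge U Y"
  by (rule fps_ext) (simp add: fps_wedge_nth wedge_add_right sum.distrib)

lemma additive_fps_wedge: "Modules.additive (fps_wedge U)"
  by standard (rule fps_wedge_add_right)

lemma fps_wedge_zero_left [simp]: "fps_wedge 0 X = 0"
  by (rule fps_ext) (simp add: fps_wedge_nth)

lemma fps_wedge_mult: "fps_wedge (U * V) X = fps_wedge U (fps_wedge V X)"
proof (rule fps_ext)
  fix n
  have "(\<Sum>j=0..n. \<Sum>i=0..j. wedge (fps_nth U i) (wedge (fps_nth V (j - i)) (fps_nth X (n - j))))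
      = (\<Sum>j=0..n. \<Sum>i=0..n - j. wedge (fps_nth U j) (wedge (fps_nth V i) (fps_nth X (n - j - i))))"
    by (rule fps_mult_assoc_lemma)
  then show "fps_nth (fps_wedge (U * V) X) n = fps_nth (fps_wedge U (fps_wedge V X)) n"
    by (simp add: fps_wedge_nth fps_mult_nth wedge_sum_left wedge_sum_right flip: wedge_wedge)
qed

text \<open>\<open>absorb\<close> and \<open>kill\<close> say that the prescribed values respect the
  two kinds of defining relations. The resulting map satisfies the product rule for every
  \<open>u\<close> and \<open>x\<close>, not only on the basis.\<close>

lemma fock_extension_props:
  assumes D: "HS_derivation D" and one: "D 1 = 1"
    and absorb: "\<And>m. fps_wedge (D (b m)) (v (m - 1)) = v m"
    and kill: "\<And>m. fps_wedge (D (b m)) (v m) = 0"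
  shows "Modules.additive (fock_extension D v)"
    and "fock_extension D v (vac m) = v m"
    and "fock_extension D v (wedge u x) = fps_wedge (D u) (fock_extension D v x)"
proof -
  interpret fock_map "\<lambda>m u. fps_wedge (D u) (v m)"
    by standard (simp_all add: additive.add[OF HS_derivation_additive[OF D]] fps_wedge_add_left
        HS_derivation_mult[OF D] fps_wedge_mult absorb kill additive.zero[OF additive_fps_wedge])
  let ?T = "fock_lift (\<lambda>m u. fps_wedge (D u) (v m))"
  have "fock_extension D v = ?T"
    unfolding fock_extension_def
  proof (rule the_equality)
    show "Modules.additive ?T \<and> (\<forall>m l r. is_partition l \<longrightarrow> length l \<le> r \<longrightarrow>
        ?T (fock_basis m l) = fps_wedge (D (b_wedge r m l)) (v (m - int r)))"
      by (simp add: additive_fock_lift fock_basis_eq fock_lift_wedge_vac)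
    fix T assume T: "Modules.additive T \<and> (\<forall>m l r. is_partition l \<longrightarrow> length l \<le> r \<longrightarrow>
        T (fock_basis m l) = fps_wedge (D (b_wedge r m l)) (v (m - int r)))"
    then have "T (fock_basis m l) = ?T (fock_basis m l)" if "is_partition l" for m l
      using that by (simp add: fock_basis_def fock_lift_wedge_vac)
    with T show "T = ?T"
      by (intro additive_fock_eqI additive_fock_lift) auto
  qed
  note T = this
  show "Modules.additive (fock_extension D v)"
    unfolding T by (rule additive_fock_lift)
  have one': "fps_wedge 1 X = X" for X
  proof (rule fps_ext)
    fix n
    have "fps_nth (fps_wedge 1 X) n
        = (\<Sum>i\<in>{0}. wedge (fps_nth 1 i) (fps_nth X (n - i)))"
      unfolding fps_wedge_nth by (rule sum.mono_neutral_right) auto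
    then show "fps_nth (fps_wedge 1 X) n = fps_nth X n" by simp
  qed
  show T_vac: "fock_extension D v (vac m) = v m" for m
    using fock_lift_wedge_vac[of 1 m] by (simp add: T one one')
  show "fock_extension D v (wedge u x) = fps_wedge (D u) (fock_extension D v x)"
  proof (induction x arbitrary: u rule: fock_induct)
    case (vac m)
    show ?case unfolding T fock_lift_wedge_vac using T_vac[of m] unfolding T by simp
  next
    case (diff x y)
    then show ?case unfolding T
      by (simp add: wedge_diff additive.diff[OF additive_fock_lift] additive.diff[OF additive_fps_wedge])
  next
    case (wedge k x)
    show ?case
      unfolding wedge_wedge wedge.IH by (simp add: HS_derivation_mult[OF D] fps_wedge_mult)
  qed
qed

definition int_nth :: "'a::zero fps \<Rightarrow> int \<Rightarrow> 'a" where
  "int_nth X n = (if n < 0 then 0 else fps_nth X (nat n))"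

lemma int_nth_of_nat [simp]: "int_nth X (int n) = fps_nth X n"
  by (simp add: int_nth_def)

lemma int_nth_zero [simp]: "int_nth X 0 = fps_nth X 0"
  by (simp add: int_nth_def)

lemma int_nth_Suc [simp]: "int_nth X (1 + int n) = fps_nth X (Suc n)"
  using int_nth_of_nat[of X "Suc n"] by simp

lemma int_nth_neg: "n < 0 \<Longrightarrow> int_nth X n = 0"
  by (simp add: int_nth_def)

lemma fps_wedge_nth_le_one:
  assumes "\<And>i. 1 < i \<Longrightarrow> fps_nth U i = 0"
  shows "int_nth (fps_wedge U X) n = wedge (fps_nth U 0) (int_nth X n) + wedge (fps_nth U 1) (int_nth X (n - 1))"
proof (cases n rule: int_cases)
  case (nonneg k)
  show ?thesis
  proof (cases k)
    case (Suc k')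
    have "fps_nth (fps_wedge U X) k = (\<Sum>i\<in>{0,1}. wedge (fps_nth U i) (fps_nth X (k - i)))"
      unfolding fps_wedge_nth by (rule sum.mono_neutral_right) (auto simp: Suc assms)
    with nonneg Suc show ?thesis by simp
  qed (simp add: nonneg fps_wedge_nth int_nth_neg)
next
  case (neg k)
  then show ?thesis by (simp add: int_nth_def)
qed

text \<open>The hypothesis says U = U_0 + z V. For sigma_+ of \<open>b k\<close> the tail V is
  sigma_+ of \<open>b (k + 1)\<close>, which turns an infinite series into a one-step recursion;
  sigma_- is alike with \<open>b (k - 1)\<close>.\<close>

lemma fps_wedge_nth_Suc_shift:
  assumes "\<And>i. fps_nth V i = fps_nth U (Suc i)"
  shows "int_nth (fps_wedge U X) n = wedge (fps_nth U 0) (int_nth X n) + int_nth (fps_wedge V X) (n - 1)"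
proof (cases n rule: int_cases)
  case (nonneg k)
  show ?thesis
  proof (cases k)
    case (Suc k')
    with nonneg show ?thesis
      by (simp add: fps_wedge_nth sum.atLeast0_atMost_Suc_shift assms del: sum.cl_ivl_Suc)
  qed (simp add: nonneg fps_wedge_nth int_nth_neg)
next
  case (neg k)
  then show ?thesis by (simp add: int_nth_def)
qed

lemma wedge_b_vac_le:
  assumes "k \<le> m"
  shows "wedge (b k) (vac m) = 0"
  using assms
proof (induction m rule: int_ge_induct)
  case base
  show ?case by (rule wedge_b_vac_same)
next
  case (step m)
  have "wedge (b k) (vac (m + 1)) = wedge (b k) (wedge (b (m + 1)) (vac m))"
    using wedge_b_vac[of "m + 1"] by simp
  also have "\<dots> = - wedge (b (m + 1)) (wedge (b k) (vac m))"
    unfolding wedge_wedge by (subst b_anticomm) simp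
  finally show ?case by (simp add: step.IH)
qed

lemma fps_nth_fps_wedge_const:
  "fps_nth (fps_wedge U (fps_const x)) n = wedge (fps_nth U n) x"
proof -
  have "fps_nth (fps_wedge U (fps_const x)) n
      = (\<Sum>i\<in>{n}. wedge (fps_nth U i) (fps_nth (fps_const x) (n - i)))"
    unfolding fps_wedge_nth by (rule sum.mono_neutral_right) auto
  then show ?thesis by simp
qed

section \<open>The Schubert derivations on the Fock space\<close>

lemma HS_one:
  "sigma_plus 1 = 1" "sigma_minus 1 = 1" "sigma_minus_bar 1 = 1"
  by (rule HS_derivation_one, rule HS_sigma_plus HS_sigma_minus HS_sigma_minus_bar,
      simp add: sigma_plus_b sigma_minus_b sigma_minus_bar_b)+

lemma
  shows additive_sigma_plus_fock: "Modules.additive sigma_plus_fock"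
    and sigma_plus_fock_vac:
      "sigma_plus_fock (vac m) = fps_wedge (sigma_plus (b m)) (fps_const (vac (m - 1)))"
    and sigma_plus_fock_wedge:
      "sigma_plus_fock (wedge u x) = fps_wedge (sigma_plus u) (sigma_plus_fock x)"
proof -
  define v where "v m = fps_wedge (sigma_plus (b m)) (fps_const (vac (m - 1)))" for m
  have kill: "fps_wedge (sigma_plus (b m)) (v m) = 0" for m
    by (simp add: v_def HS_derivation_additive[OF HS_sigma_plus] additive.zero
        flip: fps_wedge_mult HS_derivation_mult[OF HS_sigma_plus])
  have absorb: "fps_wedge (sigma_plus (b m)) (v (m - 1)) = v m" for m
  proof (rule fps_ext)
    fix n
    have *: "fps_nth (v (m - 1)) i = wedge (b (m - 1 + int i)) (vac (m - 2))" for i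
      by (simp add: v_def fps_nth_fps_wedge_const sigma_plus_b)
    have "fps_nth (fps_wedge (sigma_plus (b m)) (v (m - 1))) n
        = (\<Sum>i=0..n. wedge (b (m + int i) * b (m - 1 + int (n - i))) (vac (m - 2)))"
      unfolding fps_wedge_nth * sigma_plus_b wedge_wedge by simp
    also have "\<dots> = wedge (b (m + int n) * b (m - 1)) (vac (m - 2))
        + (\<Sum>i<n. wedge (b (m + int i) * b (m - 1 + int (n - i))) (vac (m - 2)))"
      by (simp add: atLeast0AtMost lessThan_Suc_atMost[symmetric])
    \<comment> \<open>Once the term \<open>i = n\<close> is split off, put n = k + 1: the remaining
      index pairs are m + i and m + (k - i), which anticommute under i <-> k - i.\<close>
    also have "(\<Sum>i<n. wedge (b (m + int i) * b (m - 1 + int (n - i))) (vac (m - 2))) = 0"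
    proof (cases n)
      case (Suc k)
      have "(\<Sum>i=0..k. wedge (b (m + int i) * b (m + int (k - i))) (vac (m - 2))) = 0"
        by (rule antisym_sum_zero) (simp, subst b_anticomm, simp)
      then show ?thesis
        by (simp add: Suc atLeast0AtMost lessThan_Suc_atMost of_nat_diff algebra_simps)
    qed simp
    also have "wedge (b (m + int n) * b (m - 1)) (vac (m - 2)) = fps_nth (v m) n"
      using wedge_b_vac[of "m - 1"]
      by (simp add: v_def fps_nth_fps_wedge_const sigma_plus_b flip: wedge_wedge)
    finally show "fps_nth (fps_wedge (sigma_plus (b m)) (v (m - 1))) n = fps_nth (v m) n" by simp
  qed
  have eq: "sigma_plus_fock = fock_extension sigma_plus v"
    by (simp add: sigma_plus_fock_def v_def[abs_def])
  note props = fock_extension_props[OF HS_sigma_plus HS_one(1), of v, OF absorb kill, folded eq]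
  show "Modules.additive sigma_plus_fock"
    "sigma_plus_fock (vac m) = fps_wedge (sigma_plus (b m)) (fps_const (vac (m - 1)))"
    "sigma_plus_fock (wedge u x) = fps_wedge (sigma_plus u) (sigma_plus_fock x)"
    using props by (simp_all add: v_def)
qed

text \<open>Lowered indices already occur in the vacuum, so only the constant coefficient of sigma_-
  survives there; this makes the constant series [b]_m compatible with the relations.\<close>

lemma
  shows additive_sigma_minus_fock: "Modules.additive sigma_minus_fock"
    and sigma_minus_fock_vac: "sigma_minus_fock (vac m) = fps_const (vac m)"
    and sigma_minus_fock_wedge:
      "sigma_minus_fock (wedge u x) = fps_wedge (sigma_minus u) (sigma_minus_fock x)"
proof -
  have absorb: "fps_wedge (sigma_minus (b m)) (fps_const (vac (m - 1))) = fps_const (vac m)" for m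
    by (rule fps_ext) (auto simp: fps_nth_fps_wedge_const sigma_minus_b wedge_b_vac wedge_b_vac_le)
  have kill: "fps_wedge (sigma_minus (b m)) (fps_const (vac m)) = 0" for m
    by (rule fps_ext) (simp add: fps_nth_fps_wedge_const sigma_minus_b wedge_b_vac_le)
  note props = fock_extension_props[OF HS_sigma_minus HS_one(2), of "\<lambda>m. fps_const (vac m)",
      OF absorb kill, folded sigma_minus_fock_def]
  show "Modules.additive sigma_minus_fock" "sigma_minus_fock (vac m) = fps_const (vac m)"
    "sigma_minus_fock (wedge u x) = fps_wedge (sigma_minus u) (sigma_minus_fock x)"
    using props by auto
qed

lemma
  shows additive_sigma_minus_bar_fock: "Modules.additive sigma_minus_bar_fock"
    and sigma_minus_bar_fock_vac: "sigma_minus_bar_fock (vac m) = fps_const (vac m)"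
    and sigma_minus_bar_fock_wedge:
      "sigma_minus_bar_fock (wedge u x) = fps_wedge (sigma_minus_bar u) (sigma_minus_bar_fock x)"
proof -
  have absorb: "fps_wedge (sigma_minus_bar (b m)) (fps_const (vac (m - 1))) = fps_const (vac m)" for m
    by (rule fps_ext)
      (auto simp: fps_nth_fps_wedge_const sigma_minus_bar_b wedge_b_vac wedge_b_vac_le fps_X_def wedge_diff)
  have kill: "fps_wedge (sigma_minus_bar (b m)) (fps_const (vac m)) = 0" for m
    by (rule fps_ext) (auto simp: fps_nth_fps_wedge_const sigma_minus_bar_b wedge_b_vac_le fps_X_def wedge_diff)
  note props = fock_extension_props[OF HS_sigma_minus_bar HS_one(3), of "\<lambda>m. fps_const (vac m)",
      OF absorb kill, folded sigma_minus_bar_fock_def]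
  show "Modules.additive sigma_minus_bar_fock" "sigma_minus_bar_fock (vac m) = fps_const (vac m)"
    "sigma_minus_bar_fock (wedge u x) = fps_wedge (sigma_minus_bar u) (sigma_minus_bar_fock x)"
    using props by auto
qed

section \<open>Coefficient operators on the Fock space\<close>

text \<open>
  The coefficients of \<open>z\<^sup>n\<close>, respectively \<open>z\<^sup>-\<^sup>n\<close>, indexed by integers so that the recursions below
  have no boundary cases.
\<close>

definition sp :: "int \<Rightarrow> fock \<Rightarrow> fock" where "sp n x = int_nth (sigma_plus_fock x) n"
definition sm :: "int \<Rightarrow> fock \<Rightarrow> fock" where "sm n x = int_nth (sigma_minus_fock x) n"
definition sb :: "int \<Rightarrow> fock \<Rightarrow> fock" where "sb n x = int_nth (sigma_minus_bar_fock x) n"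

lemma int_nth_add: "int_nth (X + Y) n = int_nth X n + int_nth Y n" for X :: "'a::monoid_add fps"
  by (simp add: int_nth_def)

lemma additive_sp: "Modules.additive (sp n)"
  by standard (simp add: sp_def additive.add[OF additive_sigma_plus_fock] int_nth_add)

lemma additive_sm: "Modules.additive (sm n)"
  by standard (simp add: sm_def additive.add[OF additive_sigma_minus_fock] int_nth_add)

lemma additive_sb: "Modules.additive (sb n)"
  by standard (simp add: sb_def additive.add[OF additive_sigma_minus_bar_fock] int_nth_add)

lemma sp_neg: "n < 0 \<Longrightarrow> sp n x = 0" and sm_neg: "n < 0 \<Longrightarrow> sm n x = 0"
  and sb_neg: "n < 0 \<Longrightarrow> sb n x = 0"
  by (simp_all add: sp_def sm_def sb_def int_nth_neg)

lemma sp_vac: "sp n (vac m) = wedge (b (m + n)) (vac (m - 1))"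
  by (auto simp: sp_def int_nth_def sigma_plus_fock_vac fps_nth_fps_wedge_const sigma_plus_b wedge_b_vac_le)

lemma sm_vac: "sm n (vac m) = (if n = 0 then vac m else 0)"
  and sb_vac: "sb n (vac m) = (if n = 0 then vac m else 0)"
  by (auto simp: sm_def sb_def int_nth_def sigma_minus_fock_vac sigma_minus_bar_fock_vac)

lemma sp_b: "sp n (wedge (b k) x) = wedge (b k) (sp n x) + sp (n - 1) (wedge (b (k + 1)) x)"
  unfolding sp_def sigma_plus_fock_wedge
  by (subst fps_wedge_nth_Suc_shift[where V = "sigma_plus (b (k + 1))"])
    (simp_all add: sigma_plus_b algebra_simps)

lemma sm_b: "sm n (wedge (b k) x) = wedge (b k) (sm n x) + sm (n - 1) (wedge (b (k - 1)) x)"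
  unfolding sm_def sigma_minus_fock_wedge
  by (subst fps_wedge_nth_Suc_shift[where V = "sigma_minus (b (k - 1))"])
    (simp_all add: sigma_minus_b algebra_simps)

lemma sb_b: "sb n (wedge (b k) x) = wedge (b k) (sb n x) - wedge (b (k - 1)) (sb (n - 1) x)"
  unfolding sb_def sigma_minus_bar_fock_wedge
  by (subst fps_wedge_nth_le_one)
    (auto simp: sigma_minus_bar_b fps_X_def wedge_diff)

text \<open>This is the coefficient of z^k w^n in b(z) sigma_+(w) = (1 - w/z) sigma_+(w)
  b(z).\<close>

lemma wedge_b_sp: "wedge (b k) (sp n x) = sp n (wedge (b k) x) - sp (n - 1) (wedge (b (k + 1)) x)"
  by (simp only: eq_diff_eq sp_b[symmetric])

lemma wedge_b_sm: "wedge (b k) (sm n x) = sm n (wedge (b k) x) - sm (n - 1) (wedge (b (k - 1)) x)"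
  by (simp only: eq_diff_eq sm_b[symmetric])

lemmas op_add = additive.add[OF additive_sp] additive.add[OF additive_sm] additive.add[OF additive_sb]
lemmas op_diff = additive.diff[OF additive_sp] additive.diff[OF additive_sm] additive.diff[OF additive_sb]
lemmas op_zero [simp] = additive.zero[OF additive_sp] additive.zero[OF additive_sm] additive.zero[OF additive_sb]

text \<open>\<open>D n p\<close> stands for the defect of a commutation rule. The inner induction
  runs on the two degrees with \<open>k\<close> free, since the recursions shift \<open>k\<close>
  while they lower a degree.\<close>

lemma fock_double_induct:
  fixes D :: "int \<Rightarrow> int \<Rightarrow> fock \<Rightarrow> fock"
  assumes additive: "\<And>n p. Modules.additive (D n p)"
    and neg: "\<And>n p x. n < 0 \<or> p < 0 \<Longrightarrow> D n p x = 0"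
    and vac: "\<And>n p m. D n p (vac m) = 0"
    and step: "\<And>n p k x. (\<And>n p. D n p x = 0) \<Longrightarrow> (\<And>k. D (n - 1) p (wedge (b k) x) = 0) \<Longrightarrow>
      (\<And>k. D n (p - 1) (wedge (b k) x) = 0) \<Longrightarrow> (\<And>k. D (n - 1) (p - 1) (wedge (b k) x) = 0) \<Longrightarrow>
      D n p (wedge (b k) x) = 0"
  shows "D n p x = 0"
proof (induction x arbitrary: n p rule: fock_induct)
  case (wedge k x)
  show ?case
  \<comment> \<open>The shift by one lets the measure drop even from degree 0 to -1, where
    \<open>neg\<close> takes over.\<close>
  proof (induction "nat (n + 1) + nat (p + 1)" arbitrary: n p k rule: less_induct)
    case less
    show ?case
    proof (cases "n < 0 \<or> p < 0")
      case False
      show ?thesis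
        by (rule step) (rule wedge | (rule less, use False in arith))+
    qed (simp add: neg)
  qed
qed (simp_all add: vac additive.diff[OF additive])

text \<open>Commutativity is what lets the commutative ring \<open>B\<close> act with
  \<open>h n\<close> as \<open>sp n\<close>.\<close>

lemma sp_commute: "sp p (sp n x) = sp n (sp p x)"
proof -
  define D where "D n p x = sp n (sp p x) - sp p (sp n x)" for n p x
  \<comment> \<open>A \<open>b (k + 1)\<close> caught between the two operators is moved inside by
    \<open>wedge_b_sp\<close>, so that every remaining term has the shape of a smaller case.\<close>
  have expand: "sp n (sp p (wedge (b k) x)) = wedge (b k) (sp n (sp p x))
      + sp (n - 1) (sp p (wedge (b (k + 1)) x)) - sp (n - 1) (sp (p - 1) (wedge (b (k + 2)) x))
      + sp n (sp (p - 1) (wedge (b (k + 1)) x))" for n p k x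
    by (simp add: sp_b[of p k] op_add sp_b[of n k] wedge_b_sp[of "k + 1" p] op_diff add.commute[of k 2])
  have "D n p x = 0" for n p
  proof (rule fock_double_induct[of D])
    show "Modules.additive (D n p)" for n p
      by standard (simp add: D_def op_add)
    show "D n p x = 0" if "n < 0 \<or> p < 0" for n p x
      using that by (auto simp: D_def sp_neg)
    show "D n p (vac m) = 0" for n p m
    proof -
      define S where "S n p = sp p (wedge (b (m + n)) (vac (m - 1)))" for n p
      have S: "S n p = wedge (b (m + n)) (wedge (b (m + p - 1)) (vac (m - 2))) + S (n + 1) (p - 1)" for n p
        by (simp add: S_def sp_b[of p] sp_vac algebra_simps)
      \<comment> \<open>Going from (n, p) to (n + 1, p - 1) and from (p - 1, n + 1) to (p, n)
        contributes the same two letters in opposite orders, so the gap p - n shrinks by two at no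
        cost.\<close>
      have le: "S n p = S p n" if "n \<le> p" for n p
        using that
      proof (induction "nat (p - n)" arbitrary: n p rule: less_induct)
        case less
        show ?case
        proof (cases "n = p")
          case False
          show ?thesis
          proof (cases "p = n + 1")
            case True
            then show ?thesis using S[of n p] by (simp add: wedge_wedge)
          next
            case False
            with \<open>n \<noteq> p\<close> less have "S (n + 1) (p - 1) = S (p - 1) (n + 1)" by simp
            moreover have "wedge (b (m + n)) (wedge (b (m + p - 1)) (vac (m - 2)))
                = - wedge (b (m + p - 1)) (wedge (b (m + n)) (vac (m - 2)))"
              unfolding wedge_wedge by (subst b_anticomm) simp
            ultimately show ?thesis
              using S[of n p] S[of "p - 1" "n + 1"] by (simp add: algebra_simps)
          qed
        qed simp
      qed
      have "S n p = S p n"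
        using le[of n p] le[of p n] by (cases "n \<le> p") simp_all
      then show ?thesis by (simp add: D_def sp_vac S_def)
    qed
    show "D n p (wedge (b k) x) = 0" if "\<And>n p. D n p x = 0" "\<And>k. D (n - 1) p (wedge (b k) x) = 0"
      "\<And>k. D n (p - 1) (wedge (b k) x) = 0" "\<And>k. D (n - 1) (p - 1) (wedge (b k) x) = 0" for n p k x
    proof -
      have "D n p (wedge (b k) x) = wedge (b k) (D n p x) + D (n - 1) p (wedge (b (k + 1)) x)
          - D (n - 1) (p - 1) (wedge (b (k + 2)) x) + D n (p - 1) (wedge (b (k + 1)) x)"
        unfolding D_def expand[of n p k x] expand[of p n k x] by (simp add: wedge_diff algebra_simps)
      then show ?thesis by (simp add: that)
    qed
  qed
  then show ?thesis by (simp add: D_def)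
qed

text \<open>The factor 1 - w/z is the same as in \<open>wedge_b_sp\<close>; this match is what
  identifies b(z) with sigma-bar_- up to a series in the \<open>h n\<close>.\<close>

lemma sb_sp: "sb p (sp n x) = sp n (sb p x) - sp (n - 1) (sb (p - 1) x)"
proof -
  define D where "D n p x = sb p (sp n x) - sp n (sb p x) + sp (n - 1) (sb (p - 1) x)" for n p x
  have expand1: "sp n (sb p (wedge (b k) x)) = wedge (b k) (sp n (sb p x))
      - wedge (b (k - 1)) (sp n (sb (p - 1) x)) + sp (n - 1) (sb p (wedge (b (k + 1)) x))" for n p k x
    by (simp add: sb_b op_diff sp_b[of n k] sp_b[of n "k - 1"])
  have expand2: "sb p (sp n (wedge (b k) x)) = wedge (b k) (sb p (sp n x))
      - wedge (b (k - 1)) (sb (p - 1) (sp n x)) + sb p (sp (n - 1) (wedge (b (k + 1)) x))" for n p k x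
    by (simp add: sp_b[of n k] op_add sb_b)
  have "D n p x = 0"
  proof (rule fock_double_induct[of D])
    show "Modules.additive (D n p)" for n p
      by standard (simp add: D_def op_add)
    show "D n p x = 0" if "n < 0 \<or> p < 0" for n p x
      using that by (auto simp: D_def sp_neg sb_neg)
    show "D n p (vac m) = 0" for n p m
      by (auto simp: D_def sp_vac sb_vac sb_b algebra_simps)
    show "D n p (wedge (b k) x) = 0"
      if "\<And>n p. D n p x = 0" "\<And>k. D (n - 1) p (wedge (b k) x) = 0" for n p k x
    proof -
      have "D n p (wedge (b k) x) = wedge (b k) (D n p x) - wedge (b (k - 1)) (D n (p - 1) x)
          + D (n - 1) p (wedge (b (k + 1)) x)"
        unfolding D_def expand1[of n p k x] expand1[of "n - 1" "p - 1" k x]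
          expand2[of p n k x] expand2[of "p - 1" "n - 1" k x] by (simp add: wedge_diff wedge_add_right algebra_simps)
      then show ?thesis by (simp add: that)
    qed
  qed
  then show ?thesis by (simp add: D_def algebra_simps eq_diff_eq)
qed

text \<open>The factor 1 - w/z sits with sigma_- sigma_+, so one term on the right keeps
  \<open>sp\<close> inside \<open>sm\<close>. Uses of this rule therefore descend in
  \<open>n\<close>.\<close>

lemma sm_sp: "sm p (sp n x) = sp n (sm p x) + sm (p - 1) (sp (n - 1) x)"
proof -
  define D where "D n p x = sp n (sm p x) - sm p (sp n x) + sm (p - 1) (sp (n - 1) x)" for n p x
  have expand1: "sp n (sm p (wedge (b k) x)) = wedge (b k) (sp n (sm p x))
      + sp (n - 1) (sm p (wedge (b (k + 1)) x)) - sp (n - 1) (sm (p - 1) (wedge (b k) x))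
      + sp n (sm (p - 1) (wedge (b (k - 1)) x))" for n p k x
    by (simp add: sm_b[of p k] op_add sp_b[of n k] wedge_b_sm[of "k + 1" p] op_diff)
  have expand2: "sm p (sp n (wedge (b k) x)) = wedge (b k) (sm p (sp n x))
      + sm p (sp (n - 1) (wedge (b (k + 1)) x)) - sm (p - 1) (sp (n - 1) (wedge (b k) x))
      + sm (p - 1) (sp n (wedge (b (k - 1)) x))" for n p k x
    by (simp add: sp_b[of n k] op_add sm_b[of p k] wedge_b_sp[of "k - 1" n] op_diff)
  have "D n p x = 0"
  proof (rule fock_double_induct[of D])
    show "Modules.additive (D n p)" for n p
      by standard (simp add: D_def op_add)
    show "D n p x = 0" if "n < 0 \<or> p < 0" for n p x
      using that by (auto simp: D_def sp_neg sm_neg)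
    show "D n p (vac m) = 0" for n p m
      by (auto simp: D_def sp_vac sm_vac sm_b[of p "m + n"] algebra_simps)
    show "D n p (wedge (b k) x) = 0" if "\<And>n p. D n p x = 0" "\<And>k. D (n - 1) p (wedge (b k) x) = 0"
      "\<And>k. D n (p - 1) (wedge (b k) x) = 0" "\<And>k. D (n - 1) (p - 1) (wedge (b k) x) = 0" for n p k x
    proof -
      have "D n p (wedge (b k) x) = wedge (b k) (D n p x) + D (n - 1) p (wedge (b (k + 1)) x)
          - D (n - 1) (p - 1) (wedge (b k) x) + D n (p - 1) (wedge (b (k - 1)) x)"
        unfolding D_def expand1[of n p k x] expand1[of "n - 1" "p - 1" k x]
          expand2[of p n k x] expand2[of "p - 1" "n - 1" k x] by (simp add: wedge_diff wedge_add_right algebra_simps)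
      then show ?thesis by (simp add: that)
    qed
  qed
  then show ?thesis by (simp add: D_def algebra_simps)
qed

section \<open>Contractions of the Fock space\<close>

text \<open>
  For \<open>j \<le> m\<close>, contracting \<open>[b]\<^sub>m = b\<^sub>m \<and> \<dots> \<and> b\<^sub>j \<and> [b]\<^bsub>j-1\<^esub>\<close> with \<open>\<beta>\<^sub>j\<close> gives
  \<open>(-1)\<^bsup>m-j\<^esup> b\<^sub>m \<and> \<dots> \<and> b\<^bsub>j+1\<^esub> \<and> [b]\<^bsub>j-1\<^esub>\<close>.
\<close>

primrec contr_vac_nat :: "int \<Rightarrow> nat \<Rightarrow> fock" where
  "contr_vac_nat j 0 = vac (j - 1)"
| "contr_vac_nat j (Suc k) = - wedge (b (j + 1 + int k)) (contr_vac_nat j k)"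

definition contr_vac :: "int \<Rightarrow> int \<Rightarrow> fock" where
  "contr_vac j m = (if j \<le> m then contr_vac_nat j (nat (m - j)) else 0)"

text \<open>This is the graded Leibniz rule for [b]_m = b_m \<and> [b]_(m-1).\<close>

lemma contr_vac_rec:
  "contr_vac j m = (if j = m then vac (m - 1) else 0) - wedge (b m) (contr_vac j (m - 1))"
proof -
  consider "m < j" | "j = m" | "j < m" by linarith
  then show ?thesis
  proof cases
    case 3
    then have "nat (m - j) = Suc (nat (m - 1 - j))" "b (j + 1 + int (nat (m - 1 - j))) = b m"
      by simp_all
    with 3 show ?thesis by (simp add: contr_vac_def)
  qed (simp_all add: contr_vac_def)
qed

definition contr_fock :: "int \<Rightarrow> fock \<Rightarrow> fock" where
  "contr_fock j = fock_lift (\<lambda>m u. wedge (contr j u) (vac m) + wedge (parity u) (contr_vac j m))"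

lemma wedge_b_contr_vac: "wedge (b m) (contr_vac j m) = (if j = m then vac m else 0)"
  by (subst contr_vac_rec) (simp add: wedge_diff wedge_wedge wedge_b_vac)

lemma fock_map_contr:
  "fock_map (\<lambda>m u. wedge (contr j u) (vac m) + wedge (parity u) (contr_vac j m))"
proof
  fix m u v
  show "wedge (contr j (u + v)) (vac m) + wedge (parity (u + v)) (contr_vac j m)
      = wedge (contr j u) (vac m) + wedge (parity u) (contr_vac j m)
      + (wedge (contr j v) (vac m) + wedge (parity v) (contr_vac j m))"
    by (simp add: additive.add[OF additive_contr] additive.add[OF additive_parity] wedge_add_left)
  show "wedge (contr j (u * b m)) (vac (m - 1)) + wedge (parity (u * b m)) (contr_vac j (m - 1))
      = wedge (contr j u) (vac m) + wedge (parity u) (contr_vac j m)"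
    by (subst (2) contr_vac_rec)
      (simp add: contr_mult parity_mult contr_b wedge_add_left wedge_diff wedge_b_vac flip: wedge_wedge)
  show "wedge (contr j (u * b m)) (vac m) + wedge (parity (u * b m)) (contr_vac j m) = 0"
    by (simp add: contr_mult parity_mult contr_b wedge_add_left wedge_diff wedge_b_vac_same
        wedge_b_contr_vac flip: wedge_wedge)
qed

lemmas additive_contr_fock = fock_map.additive_fock_lift[OF fock_map_contr, folded contr_fock_def]
lemmas contr_fock_wedge_vac = fock_map.fock_lift_wedge_vac[OF fock_map_contr, folded contr_fock_def]

lemma contr_fock_wedge:
  "contr_fock j (wedge u x) = wedge (contr j u) x + wedge (parity u) (contr_fock j x)"
proof (induction x arbitrary: u rule: fock_induct)
  case (vac m)
  show ?case using contr_fock_wedge_vac[of j 1 m] by (simp add: contr_fock_wedge_vac)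
next
  case (diff x y)
  then show ?case by (simp add: wedge_diff additive.diff[OF additive_contr_fock])
next
  case (wedge k x)
  show ?case
    unfolding wedge_wedge wedge.IH
    by (simp add: contr_mult parity_mult contr_b wedge_add_left wedge_add_right wedge_diff wedge_wedge)
qed

lemma contr_fock_b: "contr_fock j (wedge (b k) x) = (if j = k then x else 0) - wedge (b k) (contr_fock j x)"
  by (simp add: contr_fock_wedge contr_b)

lemma contr_fock_vac_less: "m < j \<Longrightarrow> contr_fock j (vac m) = 0"
  using contr_fock_wedge_vac[of j 1 m] by (simp add: contr_vac_def)

lemmas contr_fock_zero [simp] = additive.zero[OF additive_contr_fock]
lemmas contr_fock_add = additive.add[OF additive_contr_fock]

lemma sp_contr_fock: "sp n (contr_fock j x) = contr_fock j (sp n x) - contr_fock (j - 1) (sp (n - 1) x)"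
proof -
  define D where "D n j x = sp n (contr_fock j x) - contr_fock j (sp n x)
    + contr_fock (j - 1) (sp (n - 1) x)" for n j x
  have rec: "D n j (wedge (b k) x) = D (n - 1) j (wedge (b (k + 1)) x) - wedge (b k) (D n j x)" for n j k x
  proof -
    have *: "sp n (contr_fock j (wedge (b k) x)) = (if j = k then sp n x else 0)
        - wedge (b k) (sp n (contr_fock j x)) - (if j = k + 1 then sp (n - 1) x else 0)
        + sp (n - 1) (contr_fock j (wedge (b (k + 1)) x))"
      by (simp add: contr_fock_b op_diff sp_b[of n k])
    show ?thesis
      unfolding D_def * sp_b[of n k] sp_b[of "n - 1" k]
      by (simp add: contr_fock_add contr_fock_b wedge_diff wedge_add_right algebra_simps)
  qed
  have wedge: "D n j (wedge (b k) x) = 0" if IH: "\<And>n. D n j x = 0" for n j k x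
  proof (induction "nat (n + 1)" arbitrary: n k)
    case 0
    then show ?case by (simp add: D_def sp_neg)
  next
    case (Suc r)
    show ?case using Suc(1)[of "n - 1"] Suc(2) by (simp add: rec[of n] IH)
  qed
  have vac: "D n j (vac m) = 0" for n j m
  proof (cases "m < j")
    case True
    then show ?thesis by (simp add: D_def sp_vac contr_fock_b contr_fock_vac_less)
  next
    case False
    \<comment> \<open>A vacuum with m \<ge> j is built from [b]_(j-1), which
      \<open>contr_fock j\<close> kills, by wedging on b_j, ..., b_m in turn.\<close>
    then have "j - 1 \<le> m" by simp
    then show ?thesis
    proof (induction m arbitrary: n rule: int_ge_induct)
      case base
      show ?case by (simp add: D_def sp_vac contr_fock_b contr_fock_vac_less)
    next
      case (step m)
      from wedge[OF step.IH, of n "m + 1"] show ?case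
        using wedge_b_vac[of "m + 1"] by simp
    qed
  qed
  have "D n j x = 0"
  proof (induction x arbitrary: n rule: fock_induct)
    case (diff x y)
    then show ?case
      by (simp add: D_def op_diff additive.diff[OF additive_contr_fock] algebra_simps)
  qed (simp_all add: vac wedge)
  then show ?thesis by (simp add: D_def algebra_simps)
qed

text \<open>Contraction with beta_j kills a vacuum of index below \<open>j\<close>; the side
  condition \<open>m - int r < j\<close> thus leaves only the contraction of the finite
  part.\<close>

lemma delta_fock_eq: "delta_fock i j x = wedge (b i) (contr_fock j x)"
proof -
  have add: "Modules.additive (\<lambda>x. wedge (b i) (contr_fock j x))"
    by standard (simp add: contr_fock_add wedge_add_right)
  have "delta_fock i j = (\<lambda>x. wedge (b i) (contr_fock j x))"
    unfolding delta_fock_def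
  proof (rule the_equality)
    show "Modules.additive (\<lambda>x. wedge (b i) (contr_fock j x)) \<and>
      (\<forall>m l r. is_partition l \<longrightarrow> length l \<le> r \<longrightarrow> m - int r < j \<longrightarrow>
        wedge (b i) (contr_fock j (fock_basis m l))
          = wedge (delta (B_unit i j) (b_wedge r m l)) (vac (m - int r)))"
      by (simp add: add fock_basis_eq contr_fock_wedge contr_fock_vac_less delta_B_unit wedge_wedge)
    fix D assume D: "Modules.additive D \<and>
      (\<forall>m l r. is_partition l \<longrightarrow> length l \<le> r \<longrightarrow> m - int r < j \<longrightarrow>
        D (fock_basis m l) = wedge (delta (B_unit i j) (b_wedge r m l)) (vac (m - int r)))"
    show "D = (\<lambda>x. wedge (b i) (contr_fock j x))"
    proof (rule additive_fock_eqI)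
      fix m l assume l: "is_partition l"
      define r where "r = max (length l) (nat (m - j) + 1)"
      have r: "length l \<le> r" "m - int r < j" by (auto simp: r_def)
      with D l have "D (fock_basis m l) = wedge (delta (B_unit i j) (b_wedge r m l)) (vac (m - int r))"
        by blast
      with r show "D (fock_basis m l) = wedge (b i) (contr_fock j (fock_basis m l))"
        by (simp add: fock_basis_eq contr_fock_wedge contr_fock_vac_less delta_B_unit wedge_wedge)
    qed (use D add in auto)
  qed
  then show ?thesis by simp
qed

section \<open>The determinantal map from the Fock space to the ring\<close>

lemma det_last_row:
  fixes A :: "'a::comm_ring_1 mat"
  assumes A: "A \<in> carrier_mat (Suc r) (Suc r)" and "\<And>c. c < r \<Longrightarrow> A $$ (r, c) = 0"
  shows "det A = A $$ (r, r) * det (mat r r (\<lambda>(i, j). A $$ (i, j)))"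
proof -
  have "det A = (\<Sum>c<Suc r. A $$ (r, c) * cofactor A r c)"
    by (rule laplace_expansion_row[OF A]) simp
  also have "\<dots> = A $$ (r, r) * cofactor A r r"
    using assms(2) by simp
  also have "cofactor A r r = det (mat r r (\<lambda>(i, j). A $$ (i, j)))"
  proof -
    have "mat_delete A r r = mat r r (\<lambda>(i, j). A $$ (i, j))"
      using A by (auto simp: mat_delete_def intro!: eq_matI)
    then show ?thesis by (simp add: cofactor_def)
  qed
  finally show ?thesis .
qed

lemma det_mat_leibniz:
  "det (mat r r f) = (\<Sum>p | p permutes {0..<r}. of_int (sign p) * (\<Prod>i=0..<r. f (i, p i)))"
  by (subst det_def'[of _ r]) (auto intro!: sum.cong prod.cong)

section \<open>A determinant on words and its descent to the Fock space\<close>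

definition h_lin :: "int \<Rightarrow> M \<Rightarrow> B" where
  "h_lin i = lin_ext (\<lambda>c. h (c + i))"

lemma h_lin_add: "h_lin i (x + y) = h_lin i x + h_lin i y"
  by (simp add: h_lin_def lin_ext_add)

lemma h_lin_frag [simp]: "h_lin i (frag_of c) = h (c + i)"
  by (simp add: h_lin_def)

definition word_det :: "int \<Rightarrow> M list \<Rightarrow> B" where
  "word_det m w = det (mat (length w) (length w) (\<lambda>(a, c). h_lin (int c - m) (w ! a)))"

lemma word_det_add:
  "word_det m (u @ (x + y) # v) = word_det m (u @ x # v) + word_det m (u @ y # v)"
proof -
  let ?r = "length u + Suc (length v)"
  let ?t = "\<lambda>z p a. h_lin (int (p a) - m) ((u @ z # v) ! a)"
  \<comment> \<open>Only row \<open>length u\<close> sees the letter \<open>z\<close>; in all other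
    factors \<open>x\<close> can stand in for it.\<close>
  have split: "(\<Prod>a=0..<?r. ?t z p a) = h_lin (int (p (length u)) - m) z *
      (\<Prod>a\<in>{0..<?r} - {length u}. ?t x p a)" for z and p :: "nat \<Rightarrow> nat"
  proof -
    have "(\<Prod>a=0..<?r. ?t z p a) = ?t z p (length u) * (\<Prod>a\<in>{0..<?r} - {length u}. ?t z p a)"
      by (rule prod.remove) auto
    also have "(\<Prod>a\<in>{0..<?r} - {length u}. ?t z p a) = (\<Prod>a\<in>{0..<?r} - {length u}. ?t x p a)"
      by (rule prod.cong) (auto simp: nth_append nth_Cons split: nat.split)
    finally show ?thesis by simp
  qed
  show ?thesis
    unfolding word_det_def det_mat_leibniz length_append list.size(4) add_Suc_right add_0_right
      split_conv One_nat_def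
    by (simp only: split[unfolded add_Suc_right]) (simp add: h_lin_add algebra_simps sum.distrib)
qed

lemma word_det_square: "word_det m (u @ x # x # v) = 0"
  unfolding word_det_def
  by (rule det_identical_rows[of _ "length (u @ x # x # v)" "length u" "Suc (length u)"])
    (auto simp: nth_append intro!: eq_vecI)

text \<open>A word of length r before [b]_k has charge k + r. Discarding the other lengths makes
  \<open>Phi m\<close> vanish outside F_m.\<close>

definition Phi_pre :: "int \<Rightarrow> int \<Rightarrow> (M list \<Rightarrow>\<^sub>0 int) \<Rightarrow> B" where
  "Phi_pre m k = lin_ext (\<lambda>w. if int (length w) = m - k then word_det m w else 0)"

lemma Phi_pre_simps [simp]:
  "Phi_pre m k (p + q) = Phi_pre m k p + Phi_pre m k q"
  "Phi_pre m k (p - q) = Phi_pre m k p - Phi_pre m k q"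
  by (simp_all add: Phi_pre_def lin_ext_add lin_ext_diff)

lemma Phi_pre_frag: "Phi_pre m k (frag_of w) = (if int (length w) = m - k then word_det m w else 0)"
  by (simp add: Phi_pre_def)

lemma Phi_pre_zero [simp]: "Phi_pre m k 0 = 0"
  by (simp add: Phi_pre_def)

lemma Phi_pre_sandwich_zero:
  assumes "\<And>u v. Phi_pre m k (frag_of u * p * frag_of v) = 0"
  shows "Phi_pre m k (a * p * c) = 0"
proof (induction a rule: frag_induct)
  case (single u)
  show ?case
    by (induction c rule: frag_induct) (simp_all add: assms right_diff_distrib)
qed (simp_all add: left_diff_distrib)

lemma Phi_pre_ideal:
  assumes "p \<in> exterior_ideal"
  shows "Phi_pre m k (a * p * c) = 0"
  using assms
proof (induction arbitrary: a c rule: exterior_ideal.induct)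
  case (linear x y)
  show ?case
    by (rule Phi_pre_sandwich_zero)
      (simp add: algebra_simps mult_single plus_list_def Phi_pre_frag word_det_add)
next
  case (square x)
  show ?case
    by (rule Phi_pre_sandwich_zero)
      (simp add: mult_single plus_list_def Phi_pre_frag word_det_square)
next
  case (add p q)
  then show ?case by (simp add: algebra_simps)
next
  case (mult_left p q)
  then show ?case by (metis mult.assoc)
next
  case (mult_right p q)
  then show ?case by (metis mult.assoc)
qed simp

definition Phi_ext :: "int \<Rightarrow> int \<Rightarrow> M exterior \<Rightarrow> B" where
  "Phi_ext m k u = Phi_pre m k (rep_exterior u)"

lemma Phi_ext_abs: "Phi_ext m k (abs_exterior p) = Phi_pre m k p"
  using Phi_pre_ideal[OF rep_abs_exterior[of p], of m k 1 1]
  by (simp add: Phi_ext_def)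

lemma additive_Phi_ext: "Modules.additive (Phi_ext m k)"
proof
  show "Phi_ext m k (u + v) = Phi_ext m k u + Phi_ext m k v" for u v
    by (induction u rule: exterior.abs_induct, induction v rule: exterior.abs_induct)
      (simp add: plus_exterior.abs_eq Phi_ext_abs)
qed

lemma b_abs: "b k = abs_exterior (frag_of [frag_of k])"
  by (simp add: b_def exterior_incl.abs_eq)

lemma h_zero [simp]: "h 0 = 1"
  using arg_cong[OF E_times_E_inv, of "\<lambda>X. fps_nth X 0"] by (simp add: h_def E_def e_def)

lemma h_neg [simp]: "n < 0 \<Longrightarrow> h n = 0"
  by (simp add: h_def)

text \<open>Column c of the new last row is h at c - r with r = \<open>length w\<close>, so the row
  is 0, ..., 0, 1.\<close>

lemma word_det_snoc_absorb:
  assumes "int (length w) = m - k"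
  shows "word_det m (w @ [frag_of k]) = word_det m w"
proof -
  have "word_det m (w @ [frag_of k])
      = h_lin (int (length w) - m) (frag_of k)
        * det (mat (length w) (length w) (\<lambda>(a, c). h_lin (int c - m) ((w @ [frag_of k]) ! a)))"
    unfolding word_det_def
    by (subst det_last_row[of _ "length w"])
      (use assms in \<open>auto simp: nth_append
        intro!: arg_cong2[of _ _ _ _ "(*)"] arg_cong[of _ _ det] eq_matI\<close>)
  also have "mat (length w) (length w) (\<lambda>(a, c). h_lin (int c - m) ((w @ [frag_of k]) ! a))
      = mat (length w) (length w) (\<lambda>(a, c). h_lin (int c - m) (w ! a))"
    by (rule eq_matI) (auto simp: nth_append)
  finally show ?thesis using assms by (simp add: word_det_def)
qed

text \<open>Here the vacuum index is one lower relative to the length, so the whole last row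
  consists of h at negative indices.\<close>

lemma word_det_snoc_kill:
  assumes "int (Suc (length w)) = m - k"
  shows "word_det m (w @ [frag_of k]) = 0"
  unfolding word_det_def
  by (subst det_last_row[of _ "length w"]) (use assms in \<open>auto simp: nth_append\<close>)

lemma fock_map_Phi: "fock_map (Phi_ext m)"
proof
  fix k u v
  show "Phi_ext m k (u + v) = Phi_ext m k u + Phi_ext m k v"
    by (rule additive.add[OF additive_Phi_ext])
  show "Phi_ext m (k - 1) (u * b k) = Phi_ext m k u"
  proof (induction u rule: exterior.abs_induct)
    fix p show "Phi_ext m (k - 1) (abs_exterior p * b k) = Phi_ext m k (abs_exterior p)"
      unfolding b_abs times_exterior.abs_eq Phi_ext_abs
    proof (induction p rule: frag_induct)
      case (single w)
      show ?case
        by (auto simp: mult_single plus_list_def Phi_pre_frag word_det_snoc_absorb)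
    qed (simp_all add: algebra_simps)
  qed
  show "Phi_ext m k (u * b k) = 0"
  proof (induction u rule: exterior.abs_induct)
    fix p show "Phi_ext m k (abs_exterior p * b k) = 0"
      unfolding b_abs times_exterior.abs_eq Phi_ext_abs
    proof (induction p rule: frag_induct)
      case (single w)
      show ?case
        by (auto simp: mult_single plus_list_def Phi_pre_frag word_det_snoc_kill)
    qed (simp_all add: algebra_simps)
  qed
qed

definition Phi :: "int \<Rightarrow> fock \<Rightarrow> B" where
  "Phi m = fock_lift (Phi_ext m)"

lemmas additive_Phi = fock_map.additive_fock_lift[OF fock_map_Phi, folded Phi_def]
lemmas Phi_wedge_vac = fock_map.fock_lift_wedge_vac[OF fock_map_Phi, folded Phi_def]

definition h_det :: "int \<Rightarrow> int list \<Rightarrow> B" where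
  "h_det m cs = det (mat (length cs) (length cs) (\<lambda>(a, c). h (cs ! a + int c - m)))"

lemma Phi_b_word:
  "Phi m (wedge (b_word cs) (vac k)) = (if int (length cs) = m - k then h_det m cs else 0)"
proof -
  have "b_word cs = abs_exterior (frag_of (map frag_of cs))"
  proof (induction cs)
    case Nil
    show ?case by (simp add: one_exterior.abs_eq zero_list_def flip: single_one)
  next
    case (Cons c cs)
    then show ?case
      by (simp add: b_abs times_exterior.abs_eq mult_single plus_list_def)
  qed
  moreover have "word_det m (map frag_of cs) = h_det m cs"
    unfolding word_det_def h_det_def by (auto intro!: arg_cong[of _ _ det] eq_matI simp: algebra_simps)
  ultimately show ?thesis
    by (simp add: Phi_wedge_vac Phi_ext_abs Phi_pre_frag)
qed

lemma Phi_fock_basis: "Phi m (fock_basis m' l) = (if m' = m then Delta l else 0)"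
proof -
  have "Phi m (fock_basis m' l) = (if m' = m
      then h_det m' (map (\<lambda>i. m' - int i + int (nth_default 0 l i)) [0..<length l]) else 0)"
    by (auto simp: fock_basis_def b_wedge_eq_b_word Phi_b_word)
  also have "h_det m' (map (\<lambda>i. m' - int i + int (nth_default 0 l i)) [0..<length l]) = Delta l"
    unfolding h_det_def Delta_def Let_def
    \<comment> \<open>Letters index the rows in \<open>h_det\<close>, whereas parts index the
      columns in \<open>Delta\<close>.\<close>
    by (subst det_transpose[symmetric])
      (auto intro!: arg_cong[of _ _ det] eq_matI simp: nth_default_nth algebra_simps)
  finally show ?thesis .
qed

lemma Phi_vac: "Phi m (vac m') = (if m' = m then 1 else 0)"
  using Phi_fock_basis[of m m' "[]"] by (simp add: Delta_def Let_def)

section \<open>Raising indices becomes multiplication by \<open>h n\<close>\<close>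

text \<open>
  The coefficient of \<open>z\<^sup>n\<close> in \<open>\<sigma>\<^sub>+(z)\<close> of a monomial is the sum of all monomials obtained by raising
  its indices by a total of \<open>n\<close>.
\<close>

fun raise_word :: "nat \<Rightarrow> int list \<Rightarrow> int list list" where
  "raise_word n [] = (if n = 0 then [[]] else [])"
| "raise_word n (c # cs) = concat (map (\<lambda>i. map ((#) (c + int i)) (raise_word (n - i) cs)) [0..<Suc n])"

text \<open>It serves two rings: the exterior algebra, where order matters and \<open>f\<close>
  ignores the slot, and \<open>B\<close>, where slot \<open>a\<close> carries the column
  \<open>p a\<close> of a Leibniz term.\<close>

primrec slot_prod :: "'c list \<Rightarrow> (nat \<Rightarrow> 'c \<Rightarrow> 'r) \<Rightarrow> 'r::monoid_mult" where
  "slot_prod [] f = 1"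
| "slot_prod (c # cs) f = f 0 c * slot_prod cs (\<lambda>a. f (Suc a))"

lemma slot_prod_eq_prod:
  "slot_prod cs f = (\<Prod>a=0..<length cs. f a (cs ! a))" for f :: "nat \<Rightarrow> 'c \<Rightarrow> 'r::comm_monoid_mult"
  by (induction cs arbitrary: f) (simp_all add: prod.atLeast0_lessThan_Suc_shift del: prod.op_ivl_Suc)

lemma slot_prod_const: "slot_prod cs (\<lambda>a. f) = prod_list (map f cs)"
  by (induction cs) simp_all

lemma length_raise_word: "ds \<in> set (raise_word n cs) \<Longrightarrow> length ds = length cs"
  by (induction cs arbitrary: n ds) (auto split: if_splits)

lemma sum_list_concat_map: "sum_list (concat xss) = sum_list (map sum_list xss)"
  by (induction xss) simp_all

lemma slot_prod_fps_nth:
  fixes f :: "nat \<Rightarrow> int \<Rightarrow> 'r::ring_1"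
  shows "fps_nth (slot_prod cs (\<lambda>a c. Abs_fps (\<lambda>i. f a (c + int i)))) n
    = (\<Sum>ds\<leftarrow>raise_word n cs. slot_prod ds f)"
proof (induction cs arbitrary: n f)
  case (Cons c cs)
  have "fps_nth (slot_prod (c # cs) (\<lambda>a c. Abs_fps (\<lambda>i. f a (c + int i)))) n
      = (\<Sum>i=0..n. f 0 (c + int i) * (\<Sum>ds\<leftarrow>raise_word (n - i) cs. slot_prod ds (\<lambda>a. f (Suc a))))"
    by (simp add: fps_mult_nth Cons.IH[of "\<lambda>a. f (Suc a)"])
  also have "\<dots> = (\<Sum>i=0..<Suc n. \<Sum>ds\<leftarrow>raise_word (n - i) cs. slot_prod ((c + int i) # ds) f)"
    by (simp add: sum_list_const_mult atLeastLessThanSuc_atLeastAtMost)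
  also have "\<dots> = (\<Sum>ds\<leftarrow>raise_word n (c # cs). slot_prod ds f)"
    by (simp add: interv_sum_list_conv_sum_set_nat map_concat sum_list_concat_map comp_def
        del: upt_Suc sum.op_ivl_Suc)
  finally show ?case .
qed simp

text \<open>The vacuum index joins the word because sigma_+ of [b]_k is sigma_+(b_k) \<and>
  [b]_(k-1).\<close>

lemma sp_b_word_vac:
  "sp (int n) (wedge (b_word cs) (vac k)) = (\<Sum>ds\<leftarrow>raise_word n (cs @ [k]). wedge (b_word ds) (vac (k - 1)))"
proof -
  have "sigma_plus (b_word cs) = prod_list (map (\<lambda>c. Abs_fps (\<lambda>i. b (c + int i))) cs)" for cs
    by (induction cs) (simp_all add: HS_one HS_derivation_mult[OF HS_sigma_plus] sigma_plus_b)
  then have *: "sigma_plus (b_word cs) = slot_prod cs (\<lambda>a c. Abs_fps (\<lambda>i. b (c + int i)))" for cs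
    by (simp add: slot_prod_const)
  have "sp (int n) (wedge (b_word cs) (vac k)) = wedge (fps_nth (sigma_plus (b_word (cs @ [k]))) n) (vac (k - 1))"
    unfolding sp_def int_nth_of_nat sigma_plus_fock_wedge sigma_plus_fock_vac
    by (simp add: HS_derivation_mult[OF HS_sigma_plus] flip: fps_wedge_mult fps_nth_fps_wedge_const)
  also have "fps_nth (sigma_plus (b_word (cs @ [k]))) n = (\<Sum>ds\<leftarrow>raise_word n (cs @ [k]). b_word ds)"
    unfolding * slot_prod_fps_nth[of "cs @ [k]" "\<lambda>_. b" n] by (simp add: slot_prod_const b_word_def)
  also have "wedge (\<Sum>ds\<leftarrow>dss. b_word ds) x = (\<Sum>ds\<leftarrow>dss. wedge (b_word ds) x)" for dss x
    by (induction dss) (simp_all add: wedge_add_left)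
  finally show ?thesis .
qed

lemma of_int_fps_mult_nth: "fps_nth (of_int c * X) n = of_int c * fps_nth X n"
  by (simp flip: fps_of_int)

text \<open>
  The sum is a coefficient of a determinant of the series \<open>R x = \<Sum>\<^sub>i h\<^bsub>x+i\<^esub> z\<^sup>i\<close>, with one more row
  coming from the vacuum. Since \<open>R x - z R (x+1) = h\<^sub>x\<close>, column operations turn that row into
  \<open>(0, \<dots>, 0, E\<^sup>-\<^sup>1)\<close> and all other rows, up to the last column, into constants.
\<close>

lemma h_det_raise:
  assumes "int (length cs) = m - k"
  shows "(\<Sum>ds\<leftarrow>raise_word n (cs @ [k]). h_det m ds) = h (int n) * h_det m cs"
proof -
  define r where "r = length cs"
  define R where "R x = Abs_fps (\<lambda>i. h (x + int i))" for x
  define A where "A = mat (Suc r) (Suc r) (\<lambda>(a, c). R ((cs @ [k]) ! a + int c - m))"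
  define L :: "B fps mat" where
    "L = mat (Suc r) (Suc r) (\<lambda>(d, c). if d = c then 1 else if d = Suc c then - fps_X else 0)"
  have R_rec: "R x - fps_X * R (x + 1) = fps_const (h x)" for x
    by (rule fps_ext) (auto simp: R_def)
  have A: "A \<in> carrier_mat (Suc r) (Suc r)" and L: "L \<in> carrier_mat (Suc r) (Suc r)"
    by (simp_all add: A_def L_def)
  have AL: "(A * L) $$ (a, c) = (if c < r then fps_const (h ((cs @ [k]) ! a + int c - m))
      else R ((cs @ [k]) ! a + int r - m))" if "a < Suc r" "c < Suc r" for a c
  proof -
    have "(A * L) $$ (a, c) = (\<Sum>d=0..<Suc r. A $$ (a, d) * L $$ (d, c))"
      using that A L by (simp add: scalar_prod_def del: sum.op_ivl_Suc)
    also have "\<dots> = (\<Sum>d\<in>{c, Suc c} \<inter> {0..<Suc r}. A $$ (a, d) * L $$ (d, c))"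
      using that by (intro sum.mono_neutral_right) (auto simp: L_def)
    also have "\<dots> = (if c < r then fps_const (h ((cs @ [k]) ! a + int c - m))
      else R ((cs @ [k]) ! a + int r - m))"
    proof (cases "c < r")
      case True
      then have "{c, Suc c} \<inter> {0..<Suc r} = {c, Suc c}" by auto
      with True that R_rec[of "(cs @ [k]) ! a + int c - m"] show ?thesis
        by (simp add: A_def L_def algebra_simps)
    next
      case False
      with that have "{c, Suc c} \<inter> {0..<Suc r} = {r}" "c = r" by auto
      with that show ?thesis by (simp add: A_def L_def)
    qed
    finally show ?thesis .
  qed
  interpret fps_hom: comm_ring_hom "fps_const :: B \<Rightarrow> B fps"
    by standard (simp_all flip: fps_const_add fps_const_mult)
  have "det L = 1"
  proof -
    have "det L = prod_list (diag_mat L)"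
      by (rule det_lower_triangular[OF _ L]) (simp add: L_def)
    also have "diag_mat L = map (\<lambda>i. 1) [0..<Suc r]"
      unfolding diag_mat_def by (auto simp: L_def)
    also have "prod_list (map (\<lambda>i. 1 :: B fps) xs) = 1" for xs :: "nat list"
      by (induction xs) simp_all
    finally show ?thesis .
  qed
  then have "det A = det (A * L)"
    using det_mult[OF A L] by simp
  also have "\<dots> = (A * L) $$ (r, r) * det (mat r r (\<lambda>(i, j). (A * L) $$ (i, j)))"
  proof (rule det_last_row)
    \<comment> \<open>The last letter is k = m - r, so this entry is h at c - r < 0.\<close>
    show "(A * L) $$ (r, c) = 0" if "c < r" for c
      using that assms by (simp add: AL nth_append r_def)
  qed (use A L in simp)
  also have "(A * L) $$ (r, r) = R 0"
    using assms by (simp add: AL nth_append r_def)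
  also have "mat r r (\<lambda>(i, j). (A * L) $$ (i, j)) = map_mat fps_const (mat r r (\<lambda>(a, c). h (cs ! a + int c - m)))"
    by (rule eq_matI) (auto simp: AL nth_append r_def)
  also have "det \<dots> = fps_const (h_det m cs)"
    by (simp add: h_det_def r_def)
  finally have det_A: "det A = R 0 * fps_const (h_det m cs)" .
  let ?P = "{p. p permutes {0..<Suc r}}"
  have fin: "finite ?P" by (rule finite_permutations) simp
  \<comment> \<open>For a fixed permutation the slots are raised independently, so the sum over
    raised words is a coefficient of a product of series.\<close>
  have "(\<Sum>ds\<leftarrow>raise_word n (cs @ [k]). h_det m ds)
      = (\<Sum>ds\<leftarrow>raise_word n (cs @ [k]).
          \<Sum>p\<in>?P. of_int (sign p) * slot_prod ds (\<lambda>a d. h (d + int (p a) - m)))"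
  proof (rule arg_cong[of _ _ sum_list], rule map_cong[OF refl])
    fix ds assume "ds \<in> set (raise_word n (cs @ [k]))"
    then have "length ds = Suc r" by (simp add: length_raise_word r_def)
    then show "h_det m ds = (\<Sum>p\<in>?P. of_int (sign p) * slot_prod ds (\<lambda>a d. h (d + int (p a) - m)))"
      by (simp add: h_det_def det_mat_leibniz slot_prod_eq_prod)
  qed
  also have "\<dots> = (\<Sum>p\<in>?P. of_int (sign p) *
      (\<Sum>ds\<leftarrow>raise_word n (cs @ [k]). slot_prod ds (\<lambda>a d. h (d + int (p a) - m))))"
  proof -
    have "(\<Sum>ds\<leftarrow>dss. \<Sum>p\<in>?P. of_int (sign p) * g p ds) = (\<Sum>p\<in>?P. of_int (sign p) * (\<Sum>ds\<leftarrow>dss. g p ds))"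
      for dss and g :: "(nat \<Rightarrow> nat) \<Rightarrow> int list \<Rightarrow> B"
      by (induction dss) (simp_all add: sum.distrib algebra_simps)
    then show ?thesis .
  qed
  also have "\<dots> = (\<Sum>p\<in>?P. fps_nth (of_int (sign p) * slot_prod (cs @ [k]) (\<lambda>a c. R (c + int (p a) - m))) n)"
  proof (rule sum.cong[OF refl])
    fix p assume "p \<in> ?P"
    have "R (c + int (p a) - m) = Abs_fps (\<lambda>i. h (c + int i + int (p a) - m))" for c a
      by (simp add: R_def algebra_simps)
    then show "of_int (sign p) * (\<Sum>ds\<leftarrow>raise_word n (cs @ [k]). slot_prod ds (\<lambda>a d. h (d + int (p a) - m)))
      = fps_nth (of_int (sign p) * slot_prod (cs @ [k]) (\<lambda>a c. R (c + int (p a) - m))) n"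
      using slot_prod_fps_nth[of "cs @ [k]" "\<lambda>a d. h (d + int (p a) - m)" n]
      by (simp add: of_int_fps_mult_nth)
  qed
  also have "\<dots> = fps_nth (det A) n"
    unfolding A_def det_mat_leibniz
    by (simp add: fps_sum_nth slot_prod_eq_prod r_def del: prod.op_ivl_Suc)
  also have "\<dots> = h (int n) * h_det m cs"
    by (simp add: det_A R_def)
  finally show ?thesis .
qed

lemma Phi_sp: "Phi m (sp (int n) x) = h (int n) * Phi m x"
proof (induction x rule: fock_basis_induct)
  case (basis m' l)
  obtain cs k where x: "fock_basis m' l = wedge (b_word cs) (vac k)"
    by (rule fock_basis_word[OF basis order_refl])
  have "Phi m (\<Sum>ds\<leftarrow>dss. wedge (b_word ds) (vac k'))
      = (\<Sum>ds\<leftarrow>dss. Phi m (wedge (b_word ds) (vac k')))" for dss k'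
    by (induction dss) (simp_all add: additive.add[OF additive_Phi] additive.zero[OF additive_Phi])
  then have *: "Phi m (sp (int n) (fock_basis m' l))
      = (\<Sum>ds\<leftarrow>raise_word n (cs @ [k]). Phi m (wedge (b_word ds) (vac (k - 1))))"
    unfolding x sp_b_word_vac by simp
  also have "\<dots> = (\<Sum>ds\<leftarrow>raise_word n (cs @ [k]). if int (length cs) = m - k then h_det m ds else 0)"
    by (intro arg_cong[of _ _ sum_list] map_cong refl) (auto simp: Phi_b_word dest: length_raise_word)
  also have "\<dots> = h (int n) * Phi m (fock_basis m' l)"
    by (simp add: x Phi_b_word h_det_raise)
  finally show ?case .
qed (simp add: op_diff additive.diff[OF additive_Phi] algebra_simps)

section \<open>The module structure of the Fock space\<close>

lemma E_nth_zero [simp]: "fps_nth E 0 = 1"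
  by (simp add: E_def e_def)

lemma h_of_nat: "h (int n) = fps_nth E_inv n"
  by (simp add: h_def)

lemma update_eq_add_single:
  "k \<notin> Poly_Mapping.keys f \<Longrightarrow> Poly_Mapping.update k v f = f + Poly_Mapping.single k (v::nat)"
  by (rule poly_mapping_eqI) (auto simp: lookup_update lookup_add lookup_single when_def in_keys_iff)

text \<open>The multipliers \<open>C\<close> preserving \<open>P\<close> form a subring containing
  all h_n. As E has constant term 1, the relation \<open>E * E_inv = 1\<close> expresses each e_n
  through the h_i and earlier e_i, so the subring is all of \<open>B\<close>.\<close>

lemma B_induct [case_names one diff h_mult]:
  assumes one: "P 1" and diff: "\<And>f g. P f \<Longrightarrow> P g \<Longrightarrow> P (f - g)"
    and h_mult: "\<And>n f. P f \<Longrightarrow> P (h (int n) * f)"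
  shows "P f"
proof -
  define C where "C = {g. \<forall>f. P f \<longrightarrow> P (g * f)}"
  have C_diff: "g - g' \<in> C" if "g \<in> C" "g' \<in> C" for g g'
    using that by (auto simp: C_def left_diff_distrib intro: diff)
  have C_mult: "g * g' \<in> C" if "g \<in> C" "g' \<in> C" for g g'
    using that by (auto simp: C_def mult.assoc)
  have C_one: "1 \<in> C" by (simp add: C_def)
  have C_zero: "0 \<in> C" using C_diff[OF C_one C_one] by simp
  have C_uminus: "- g \<in> C" if "g \<in> C" for g using C_diff[OF C_zero that] by simp
  have C_add: "g + g' \<in> C" if "g \<in> C" "g' \<in> C" for g g'
    using C_diff[OF that(1) C_uminus[OF that(2)]] by simp
  have C_sum: "sum u A \<in> C" if "\<And>a. a \<in> A \<Longrightarrow> u a \<in> C" for u :: "nat \<Rightarrow> B" and A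
    using that by (induction A rule: infinite_finite_induct) (auto simp: C_zero C_add)
  have C_h: "fps_nth E_inv n \<in> C" for n
    using h_mult by (simp add: C_def flip: h_of_nat)
  have C_E: "fps_nth E n \<in> C" for n
  proof (induction n rule: less_induct)
    case (less n)
    show ?case
    proof (cases "n = 0")
      case False
      have "(\<Sum>i=0..n. fps_nth E i * fps_nth E_inv (n - i)) = 0"
        using arg_cong[OF E_times_E_inv, of "\<lambda>X. fps_nth X n"] False by (simp add: fps_mult_nth)
      then have "fps_nth E n * 1 + (\<Sum>i<n. fps_nth E i * fps_nth E_inv (n - i)) = 0"
        using h_zero by (simp add: atLeast0AtMost lessThan_Suc_atMost[symmetric] add.commute h_def)
      then have "fps_nth E n = - (\<Sum>i<n. fps_nth E i * fps_nth E_inv (n - i))"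
        by (simp add: eq_neg_iff_add_eq_0)
      then show ?thesis
        by (auto intro!: C_uminus C_sum C_mult C_h less)
    qed (simp add: C_one)
  qed
  have C_e: "e n \<in> C" for n
    using C_E[of n] C_uminus[OF C_E[of n]] by (cases "even n") (simp_all add: E_def)
  have C_var: "Poly_Mapping.single (Poly_Mapping.single k j) 1 \<in> C" for k j
  proof (induction j)
    case (Suc j)
    have "Poly_Mapping.single (Poly_Mapping.single k (Suc j)) 1
        = e (Suc k) * Poly_Mapping.single (Poly_Mapping.single k j) 1"
      by (simp add: e_def mult_single flip: single_add)
    with C_mult[OF C_e Suc] show ?case by metis
  qed (simp add: C_one)
  have C_mon: "Poly_Mapping.single ex 1 \<in> C" for ex :: "nat \<Rightarrow>\<^sub>0 nat"
  proof (induction ex rule: update_induct)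
    case const
    show ?case by (simp add: C_one)
  next
    case (update ex k j)
    have "Poly_Mapping.single (Poly_Mapping.update k j ex) (1::int)
        = Poly_Mapping.single ex 1 * Poly_Mapping.single (Poly_Mapping.single k j) 1"
      using update(1) by (simp add: update_eq_add_single mult_single)
    with C_mult[OF update(3) C_var] show ?case by metis
  qed
  have "f \<in> C"
    by (induction f rule: frag_induct) (simp_all add: C_zero C_mon C_diff)
  with one show ?thesis by (force simp: C_def)
qed

section \<open>The endomorphism ring of the Fock space and the action of \<open>B\<close>\<close>

typedef fock_end = "{f :: fock \<Rightarrow> fock. Modules.additive f}"
  by (rule exI[of _ "\<lambda>x. 0"]) (simp add: additive_def)

setup_lifting type_definition_fock_end

lemma vac_nonzero: "vac m \<noteq> 0"
  using Phi_vac[of m m] additive.zero[OF additive_Phi, of m] by auto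

instantiation fock_end :: ring_1
begin

lift_definition zero_fock_end :: fock_end is "\<lambda>x. 0" by (simp add: additive_def)
lift_definition one_fock_end :: fock_end is "\<lambda>x. x" by (simp add: additive_def)
lift_definition plus_fock_end :: "fock_end \<Rightarrow> fock_end \<Rightarrow> fock_end" is "\<lambda>f g x. f x + g x"
  by (simp add: additive_def)
lift_definition minus_fock_end :: "fock_end \<Rightarrow> fock_end \<Rightarrow> fock_end" is "\<lambda>f g x. f x - g x"
  by (simp add: additive_def)
lift_definition uminus_fock_end :: "fock_end \<Rightarrow> fock_end" is "\<lambda>f x. - f x"
  by (simp add: additive_def)
lift_definition times_fock_end :: "fock_end \<Rightarrow> fock_end \<Rightarrow> fock_end" is "\<lambda>f g x. f (g x)"
  by (simp add: additive_def)

instance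
proof
  show "(0::fock_end) \<noteq> 1"
    by transfer (use vac_nonzero in metis)
qed (transfer; simp add: fun_eq_iff additive_def algebra_simps)+

end

lift_definition sp_end :: "nat \<Rightarrow> fock_end" is "\<lambda>n. sp (int n)"
  by (rule additive_sp)

lemma sp_end_commute: "sp_end i * sp_end j = sp_end j * sp_end i"
  by transfer (simp add: sp_commute)

lemma sp_zero [simp]: "sp 0 x = x"
proof (induction x rule: fock_induct)
  case (vac m)
  show ?case by (simp add: sp_vac wedge_b_vac)
next
  case (wedge k x)
  then show ?case by (simp add: sp_b[of 0] sp_neg)
qed (simp add: op_diff)

definition e_end :: "fock_end fps" where
  "e_end = fps_right_inverse (Abs_fps sp_end) 1"

lemma sp_end_zero: "sp_end 0 = 1"
  by transfer (simp add: fun_eq_iff)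

lemma sp_e_end: "Abs_fps sp_end * e_end = 1"
  unfolding e_end_def by (rule fps_right_inverse) (simp add: sp_end_zero)

text \<open>Coefficients of the inverse series are built recursively from those of
  \<open>sp_end\<close>, so whatever commutes with the latter commutes with the former. Two
  applications give \<open>e_end_commute\<close>.\<close>

lemma commute_e_end:
  assumes "\<And>i. c * sp_end i = sp_end i * c"
  shows "c * fps_nth e_end n = fps_nth e_end n * c"
proof (induction n rule: less_induct)
  case (less n)
  have "(\<Sum>i=0..n. sp_end i * fps_nth e_end (n - i)) = (if n = 0 then 1 else 0)"
    using arg_cong[OF sp_e_end, of "\<lambda>X. fps_nth X n"] by (simp add: fps_mult_nth)
  then have eq: "fps_nth e_end n = (if n = 0 then 1 else 0) - (\<Sum>i=Suc 0..n. sp_end i * fps_nth e_end (n - i))"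
    by (simp add: sum.atLeast_Suc_atMost sp_end_zero algebra_simps)
  have "c * (sp_end i * fps_nth e_end (n - i)) = sp_end i * fps_nth e_end (n - i) * c"
    if "i \<in> {Suc 0..n}" for i
  proof -
    have IH: "c * fps_nth e_end (n - i) = fps_nth e_end (n - i) * c"
      using that by (intro less) auto
    have "c * (sp_end i * fps_nth e_end (n - i)) = sp_end i * (c * fps_nth e_end (n - i))"
      by (simp add: assms flip: mult.assoc)
    then show ?thesis by (simp add: IH mult.assoc)
  qed
  then have "c * (\<Sum>i=Suc 0..n. sp_end i * fps_nth e_end (n - i))
      = (\<Sum>i=Suc 0..n. sp_end i * fps_nth e_end (n - i)) * c"
    by (simp add: sum_distrib_left sum_distrib_right)
  then show ?case by (subst (1 2) eq) (simp add: algebra_simps)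
qed

lemma e_end_commute: "fps_nth e_end i * fps_nth e_end j = fps_nth e_end j * fps_nth e_end i"
  by (intro commute_e_end commute_e_end[symmetric] sp_end_commute)

text \<open>The product is an ordered list because the target ring is not commutative.
  \<open>Poly_Mapping.degree\<close> bounds the variable indices here; it is not the total
  degree.\<close>

definition monomial_prod :: "(nat \<Rightarrow> 'r) \<Rightarrow> (nat \<Rightarrow>\<^sub>0 nat) \<Rightarrow> 'r::monoid_mult" where
  "monomial_prod x ex = prod_list (map (\<lambda>k. x k ^ Poly_Mapping.lookup ex k) [0..<Poly_Mapping.degree ex])"

lemma monomial_prod_bound:
  assumes "Poly_Mapping.degree ex \<le> N"
  shows "monomial_prod x ex = prod_list (map (\<lambda>k. x k ^ Poly_Mapping.lookup ex k) [0..<N])"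
  using assms
  by (induction N rule: dec_induct) (simp_all add: monomial_prod_def beyond_degree_lookup_zero)

lemma monomial_prod_add:
  assumes comm: "\<And>i j. x i * x j = x j * x i"
  shows "monomial_prod x (f + g) = monomial_prod x f * monomial_prod x g"
proof -
  let ?P = "\<lambda>f N. prod_list (map (\<lambda>k. x k ^ Poly_Mapping.lookup f k) [0..<N])"
  have c: "x i ^ a * ?P g N = ?P g N * x i ^ a" for i a N
  proof (induction N)
    case (Suc N)
    have "x i ^ a * x N ^ c = x N ^ c * x i ^ a" for c
      by (intro power_commuting_commutes power_commuting_commutes[symmetric] comm)
    note x = this
    have "x i ^ a * ?P g (Suc N) = (x i ^ a * ?P g N) * x N ^ Poly_Mapping.lookup g N"
      by (simp add: mult.assoc)
    also have "\<dots> = ?P g (Suc N) * x i ^ a"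
      unfolding Suc by (simp add: mult.assoc x)
    finally show ?case .
  qed simp
  have P: "?P (f + g) N = ?P f N * ?P g N" for N
  proof (induction N)
    case (Suc N)
    have "?P (f + g) (Suc N) = ?P (f + g) N * x N ^ Poly_Mapping.lookup (f + g) N"
      by simp
    also have "\<dots> = ?P f N * (?P g N * x N ^ Poly_Mapping.lookup f N) * x N ^ Poly_Mapping.lookup g N"
      unfolding Suc by (simp add: lookup_add power_add mult.assoc)
    also have "\<dots> = ?P f (Suc N) * ?P g (Suc N)"
      by (simp add: mult.assoc flip: c)
    finally show ?case .
  qed simp
  define N where "N = Max {Poly_Mapping.degree (f + g), Poly_Mapping.degree f, Poly_Mapping.degree g}"
  have "Poly_Mapping.degree (f + g) \<le> N" "Poly_Mapping.degree f \<le> N" "Poly_Mapping.degree g \<le> N"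
    by (simp_all add: N_def)
  then show ?thesis using P[of N] by (simp add: monomial_prod_bound)
qed

text \<open>
  As \<open>E\<close> is the inverse of \<open>\<Sum> h\<^sub>n z\<^sup>n\<close>, the generators \<open>e\<^sub>k\<close> have to act through the coefficients of
  the inverse of \<open>\<sigma>\<^sub>+(z)\<close>.
\<close>

definition B_end :: "B \<Rightarrow> fock_end" where
  "B_end = lin_ext (monomial_prod (\<lambda>k. (- 1) ^ Suc k * fps_nth e_end (Suc k)))"

lemma additive_B_end: "Modules.additive B_end"
  unfolding B_end_def by (rule additive_lin_ext)

lemma B_end_mult: "B_end (f * g) = B_end f * B_end g"
  unfolding B_end_def
proof (rule lin_ext_mult, rule monomial_prod_add)
  have "(- 1) ^ n * c = c * (- 1) ^ n" for n and c :: fock_end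
    by (cases "even n") simp_all
  then show "(- 1) ^ Suc i * fps_nth e_end (Suc i) * ((- 1) ^ Suc j * fps_nth e_end (Suc j))
      = (- 1) ^ Suc j * fps_nth e_end (Suc j) * ((- 1) ^ Suc i * fps_nth e_end (Suc i))" for i j
    by (cases "even i"; cases "even j") (simp_all add: e_end_commute)
qed

lemma B_end_one: "B_end 1 = 1"
  by (simp add: B_end_def monomial_prod_def flip: single_one)

lemma B_end_E: "B_end (fps_nth E n) = fps_nth e_end n"
proof (cases n)
  case 0
  have "fps_nth e_end 0 = 1"
    using arg_cong[OF sp_e_end, of "\<lambda>X. fps_nth X 0"] by (simp add: sp_end_zero)
  with 0 show ?thesis by (simp add: B_end_one)
next
  case (Suc k)
  have "prod_list (map (\<lambda>i. x i ^ (1 when k = i)) [0..<j]) = 1" if "j \<le> k" for x :: "nat \<Rightarrow> fock_end" and j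
    using that by (induction j) simp_all
  then have "B_end (e (Suc k)) = (- 1) ^ Suc k * fps_nth e_end (Suc k)"
    by (simp add: B_end_def e_def monomial_prod_def lookup_single)
  then show ?thesis
    by (cases "even k") (simp_all add: Suc E_def additive.minus[OF additive_B_end])
qed

text \<open>The series \<open>sp_end\<close> is a left inverse and \<open>H\<close> a right inverse
  of \<open>e_end\<close>, so they agree.\<close>

lemma B_end_h: "B_end (h (int n)) = sp_end n"
proof -
  define H where "H = Abs_fps (\<lambda>n. B_end (fps_nth E_inv n))"
  have "e_end * H = 1"
  proof (rule fps_ext)
    fix n
    have "fps_nth (e_end * H) n = B_end (fps_nth (E * E_inv) n)"
      by (simp add: fps_mult_nth H_def additive.sum[OF additive_B_end] B_end_mult B_end_E)
    then show "fps_nth (e_end * H) n = fps_nth 1 n"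
      by (simp add: E_times_E_inv B_end_one additive.zero[OF additive_B_end])
  qed
  then have "Abs_fps sp_end = H"
    using sp_e_end by (metis mult.assoc mult.left_neutral mult.right_neutral)
  then show ?thesis by (simp add: H_def h_of_nat fps_eq_iff)
qed

text \<open>Uniqueness holds because the h_n generate \<open>B\<close>, so their action determines
  the whole module structure.\<close>

lemma B_act_eq: "B_act f = Rep_fock_end (B_end f)"
proof -
  define act where "act f = Rep_fock_end (B_end f)" for f
  have add: "Rep_fock_end (x + y) u = Rep_fock_end x u + Rep_fock_end y u" for x y u
    by (simp add: plus_fock_end.rep_eq)
  have mult: "Rep_fock_end (x * y) u = Rep_fock_end x (Rep_fock_end y u)" for x y u
    by (simp add: times_fock_end.rep_eq)
  have "Modules.module act"
  proof
    show "act f (x + y) = act f x + act f y" for f x y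
      unfolding act_def using Rep_fock_end[of "B_end f"] by (simp add: additive.add)
    show "act (f + g) x = act f x + act g x" for f g x
      by (simp add: act_def add additive.add[OF additive_B_end])
    show "act f (act g x) = act (f * g) x" for f g x
      by (simp add: act_def mult B_end_mult)
    show "act 1 x = x" for x
      by (simp add: act_def B_end_one one_fock_end.rep_eq)
  qed
  moreover have "act (h (int i)) u = fps_nth (sigma_plus_fock u) i" for i u
    by (simp add: act_def B_end_h sp_end.rep_eq sp_def)
  ultimately have act: "Modules.module act \<and> (\<forall>i u. act (h (int i)) u = fps_nth (sigma_plus_fock u) i)"
    by blast
  have "B_act = act"
    unfolding B_act_def
  proof (rule the_equality, rule act)
    fix act'
    assume act': "Modules.module act' \<and> (\<forall>i u. act' (h (int i)) u = fps_nth (sigma_plus_fock u) i)"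
    have "act' f u = act f u" for f u
    proof (induction f arbitrary: u rule: B_induct)
      case one
      show ?case using act act' by (simp add: module.scale_one)
    next
      case (diff f g)
      then show ?case using act act' by (simp add: module.scale_left_diff_distrib)
    next
      case (h_mult n f)
      then show ?case using act act' by (metis module.scale_scale)
    qed
    then show "act' = act" by blast
  qed
  then show ?thesis unfolding act_def by (rule fun_cong)
qed

lemma additive_B_act: "Modules.additive (B_act f)"
  using Rep_fock_end[of "B_end f"] by (simp add: B_act_eq)

lemma B_act_add_left: "B_act (f + g) u = B_act f u + B_act g u"
  by (simp add: B_act_eq additive.add[OF additive_B_end] plus_fock_end.rep_eq)

lemma additive_B_act_left: "Modules.additive (\<lambda>f. B_act f u)"
  by standard (rule B_act_add_left)

lemma B_act_mult: "B_act (f * g) u = B_act f (B_act g u)"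
  by (simp add: B_act_eq B_end_mult times_fock_end.rep_eq)

lemma B_act_one [simp]: "B_act 1 u = u"
  by (simp add: B_act_eq B_end_one one_fock_end.rep_eq)

lemma B_act_h_nat: "B_act (h (int n)) u = sp (int n) u"
  by (simp add: B_act_eq B_end_h sp_end.rep_eq)

lemma B_act_h: "B_act (h n) u = sp n u"
  using B_act_h_nat[of "nat n" u]
  by (cases "n < 0") (simp_all add: sp_neg additive.zero[OF additive_B_act_left])

lemma Phi_B_act: "Phi m (B_act f u) = f * Phi m u"
  by (induction f arbitrary: u rule: B_induct)
    (simp_all add: additive.diff[OF additive_B_act_left] additive.diff[OF additive_Phi]
      B_act_mult B_act_h Phi_sp algebra_simps)

lemma B_act_vac_inject: "B_act f (vac m) = B_act g (vac m) \<longleftrightarrow> f = g"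
  by (metis Phi_B_act Phi_vac mult.right_neutral)

section \<open>Vertex operators\<close>

definition Ez :: "int \<Rightarrow> B" where "Ez n = int_nth E n"

lemma Ez_neg [simp]: "n < 0 \<Longrightarrow> Ez n = 0"
  by (simp add: Ez_def int_nth_neg)

lemmas B_act_zero [simp] = additive.zero[OF additive_B_act] additive.zero[OF additive_B_act_left]
lemmas B_act_add = additive.add[OF additive_B_act] B_act_add_left
lemmas B_act_diff = additive.diff[OF additive_B_act] additive.diff[OF additive_B_act_left]

lemma E_convolution:
  "(\<Sum>i=0..n. sp (int n - int i) (B_act (Ez (int i)) y)) = (if n = 0 then y else 0)"
proof -
  have "(\<Sum>i=0..n. sp (int n - int i) (B_act (Ez (int i)) y))
      = B_act (\<Sum>i=0..n. fps_nth E i * fps_nth E_inv (n - i)) y"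
    unfolding additive.sum[OF additive_B_act_left]
  proof (rule sum.cong[OF refl])
    fix i assume "i \<in> {0..n}"
    then have "h (int n - int i) = fps_nth E_inv (n - i)"
      by (simp add: h_of_nat flip: of_nat_diff)
    then show "sp (int n - int i) (B_act (Ez (int i)) y)
        = B_act (fps_nth E i * fps_nth E_inv (n - i)) y"
      by (simp add: Ez_def mult.commute[of "fps_nth E i"] B_act_mult flip: B_act_h)
  qed
  also have "\<dots> = (if n = 0 then y else 0)"
    using arg_cong[OF E_times_E_inv, of "\<lambda>X. fps_nth X n"] by (simp add: fps_mult_nth)
  finally show ?thesis .
qed

text \<open>The system is triangular because \<open>sp 0\<close> is the identity. It reduces claims
  about E to convolutions with sigma_+, where the commutation rules telescope.\<close>

lemma B_act_E_unique:
  fixes X :: "nat \<Rightarrow> fock"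
  assumes X: "\<And>n. (\<Sum>i=0..n. sp (int n - int i) (X i)) = (if n = 0 then y else 0)"
  shows "X n = B_act (Ez (int n)) y"
proof (induction n rule: less_induct)
  case (less n)
  have split: "(\<Sum>i=0..n. sp (int n - int i) (Y i)) = Y n + (\<Sum>i<n. sp (int n - int i) (Y i))" for Y
    by (simp add: atLeast0AtMost lessThan_Suc_atMost[symmetric] add.commute)
  have "B_act (Ez (int n)) y + (\<Sum>i<n. sp (int n - int i) (X i)) = (if n = 0 then y else 0)"
    using E_convolution[of n y] unfolding split using less by simp
  with X[of n] show ?case unfolding split by (metis add_right_cancel)
qed

lemma contr_fock_vac: "contr_fock j (vac m) = B_act (Ez (m - j)) (vac (m - 1))"
proof (cases "j \<le> m")
  case True
  have "contr_fock (m - int n) (vac m) = B_act (Ez (int n)) (vac (m - 1))" for n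
  proof (rule B_act_E_unique)
    fix n
    \<comment> \<open>By \<open>sp_contr_fock\<close> the i-th summand is
      \<open>g i - g (Suc i)\<close>.\<close>
    define g where "g i = contr_fock (m - int i) (sp (int n - int i) (vac m))" for i
    have "(\<Sum>i=0..n. sp (int n - int i) (contr_fock (m - int i) (vac m))) = (\<Sum>i\<le>n. g i - g (Suc i))"
      by (simp add: sp_contr_fock g_def atLeast0AtMost algebra_simps)
    also have "\<dots> = g 0 - g (Suc n)" by (rule sum_telescope)
    also have "g (Suc n) = 0" by (simp add: g_def sp_neg)
    also have "g 0 = (if n = 0 then vac (m - 1) else 0)"
      by (simp add: g_def sp_vac contr_fock_b contr_fock_vac_less)
    finally show "(\<Sum>i=0..n. sp (int n - int i) (contr_fock (m - int i) (vac m)))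
        = (if n = 0 then vac (m - 1) else 0)" by simp
  qed
  from this[of "nat (m - j)"] True show ?thesis by simp
qed (simp add: contr_fock_vac_less)

text \<open>Multiplying b(z) sigma_+(w) = (1 - w/z) sigma_+(w) b(z) by E(w) on both sides gives E(w)
  b(z) = (1 - w/z) b(z) E(w).\<close>

lemma wedge_b_E:
  "wedge (b k) (B_act (Ez a) u)
    = B_act (Ez a) (wedge (b k) u) + wedge (b (k + 1)) (B_act (Ez (a - 1)) u)"
proof (cases "a < 0")
  case False
  have "wedge (b k) (B_act (Ez (int n)) u) - wedge (b (k + 1)) (B_act (Ez (int n - 1)) u)
      = B_act (Ez (int n)) (wedge (b k) u)" for n
  proof (rule B_act_E_unique)
    fix n
    \<comment> \<open>The shift by one gives the coefficient of index -1, which is 0, a place at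
      \<open>y 0\<close>.\<close>
    define y where "y i = B_act (Ez (int i - 1)) u" for i
    have Y: "y (Suc i) = B_act (Ez (int i)) u" "y 0 = 0" for i
      by (simp_all add: y_def)
    have conv: "(\<Sum>i=0..n. sp (int n - int i) (y (Suc i))) = (if n = 0 then u else 0)"
      using E_convolution[of n u] by (simp add: Y)
    define g where "g i = sp (int n - int i) (wedge (b (k + 1)) (y i))" for i
    have "(\<Sum>i=0..n. sp (int n - int i) (wedge (b k) (y (Suc i)) - wedge (b (k + 1)) (y i)))
        = (\<Sum>i\<le>n. wedge (b k) (sp (int n - int i) (y (Suc i))) + (g (Suc i) - g i))"
      by (simp add: op_diff sp_b[of "int n - int i" k for i] g_def atLeast0AtMost algebra_simps)
    also have "\<dots> = wedge (b k) (\<Sum>i=0..n. sp (int n - int i) (y (Suc i))) + (g (Suc n) - g 0)"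
      using sum_telescope[of "\<lambda>i. - g i" n]
      by (simp add: sum.distrib wedge_sum_right atLeast0AtMost)
    also have "\<dots> = (if n = 0 then wedge (b k) u else 0)"
      unfolding conv by (simp add: g_def sp_neg Y)
    finally have "(\<Sum>i=0..n. sp (int n - int i) (wedge (b k) (y (Suc i)) - wedge (b (k + 1)) (y i)))
        = (if n = 0 then wedge (b k) u else 0)" .
    then show "(\<Sum>i=0..n. sp (int n - int i)
        (wedge (b k) (B_act (Ez (int i)) u) - wedge (b (k + 1)) (B_act (Ez (int i - 1)) u)))
      = (if n = 0 then wedge (b k) u else 0)"
      unfolding Y(1) unfolding y_def .
  qed
  from this[of "nat a"] False show ?thesis by (simp add: algebra_simps)
qed simp

text \<open>This is where the factor \<open>z / (z - w)\<close> comes from.\<close>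

lemma wedge_b_E_sum:
  assumes "a < int T"
  shows "wedge (b k) (B_act (Ez a) u) = (\<Sum>t<T. B_act (Ez (a - int t)) (wedge (b (k + int t)) u))"
  using assms
proof (induction T arbitrary: a k)
  case (Suc T)
  have "wedge (b k) (B_act (Ez a) u) = B_act (Ez a) (wedge (b k) u) + wedge (b (k + 1)) (B_act (Ez (a - 1)) u)"
    by (rule wedge_b_E)
  also have "wedge (b (k + 1)) (B_act (Ez (a - 1)) u)
      = (\<Sum>t<T. B_act (Ez (a - 1 - int t)) (wedge (b (k + 1 + int t)) u))"
    using Suc.prems by (intro Suc.IH) simp
  finally show ?case
    by (simp add: sum.lessThan_Suc_shift algebra_simps del: sum.lessThan_Suc)
qed simp

text \<open>
  The coefficient of \<open>z\<^sup>k\<close> in \<open>b(z) \<and> f [b]\<^bsub>m-1\<^esub> = z\<^sup>m E(z)\<^sup>-\<^sup>1 (\<sigma>-bar\<^sub>-(z) f) [b]\<^sub>m\<close>.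
\<close>

lemma wedge_b_B_act:
  "\<exists>N0. \<forall>N\<ge>N0. \<forall>k. wedge (b k) (B_act f (vac (m - 1)))
    = (\<Sum>p<N. sp (k - m + int p) (sb (int p) (B_act f (vac m))))"
proof (induction f rule: B_induct)
  case one
  have "(\<Sum>p<N. sp (k - m + int p) (sb (int p) (vac m))) = wedge (b k) (vac (m - 1))" if "N \<ge> 1" for N k
  proof -
    have "(\<Sum>p<N. sp (k - m + int p) (sb (int p) (vac m)))
        = (\<Sum>p\<in>{0}. sp (k - m + int p) (sb (int p) (vac m)))"
      using that by (intro sum.mono_neutral_right) (auto simp: sb_vac)
    then show ?thesis by (simp add: sb_vac sp_vac)
  qed
  then show ?case by (intro exI[of _ 1]) simp
next
  case (diff f g)
  then obtain N M where N: "\<And>N' k. N' \<ge> N \<Longrightarrow> wedge (b k) (B_act f (vac (m - 1)))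
      = (\<Sum>p<N'. sp (k - m + int p) (sb (int p) (B_act f (vac m))))"
    and M: "\<And>N' k. N' \<ge> M \<Longrightarrow> wedge (b k) (B_act g (vac (m - 1)))
      = (\<Sum>p<N'. sp (k - m + int p) (sb (int p) (B_act g (vac m))))" by blast
  show ?case
  proof (intro exI[of _ "max N M"] allI impI)
    fix N' k assume "max N M \<le> N'"
    with N[of N' k] M[of N' k] show "wedge (b k) (B_act (f - g) (vac (m - 1)))
        = (\<Sum>p<N'. sp (k - m + int p) (sb (int p) (B_act (f - g) (vac m))))"
      by (simp add: B_act_diff wedge_diff op_diff sum_subtractf)
  qed
next
  case (h_mult n f)
  define u v where "u = B_act f (vac (m - 1))" and "v = B_act f (vac m)"
  obtain N0 where N0: "\<And>N k. N \<ge> N0 \<Longrightarrow> wedge (b k) u = (\<Sum>p<N. sp (k - m + int p) (sb (int p) v))"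
    using h_mult by (auto simp: u_def v_def)
  have "wedge (b k) (sp (int n) u) = (\<Sum>p<N. sp (k - m + int p) (sb (int p) (sp (int n) v)))"
    if N_ge: "N \<ge> Suc N0" for N k
  proof -
    obtain M where "N = Suc M" using Suc_le_D[OF N_ge] by blast
    then have M: "N = Suc M" "M \<ge> N0" using N_ge by simp_all
    have "(\<Sum>p<N. sp (k - m + int p) (sb (int p) (sp (int n) v)))
        = (\<Sum>p<N. sp (int n) (sp (k - m + int p) (sb (int p) v)))
        - (\<Sum>p<N. sp (int n - 1) (sp (k - m + int p) (sb (int p - 1) v)))"
      by (simp add: sb_sp op_diff sum_subtractf sp_commute[of "k - m + int p" for p])
    \<comment> \<open>The term p = 0 vanishes and the rest is the sum for \<open>k + 1\<close> with
      one term fewer. Hence the threshold rises by one and must not depend on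
      \<open>k\<close>.\<close>
    also have "(\<Sum>p<N. sp (int n - 1) (sp (k - m + int p) (sb (int p - 1) v)))
        = (\<Sum>p<M. sp (int n - 1) (sp (k + 1 - m + int p) (sb (int p) v)))"
      unfolding M(1) by (simp add: sum.lessThan_Suc_shift sb_neg algebra_simps del: sum.lessThan_Suc)
    also have "\<dots> = sp (int n - 1) (wedge (b (k + 1)) u)"
      using N0[OF M(2), of "k + 1"] by (simp add: additive.sum[OF additive_sp])
    also have "(\<Sum>p<N. sp (int n) (sp (k - m + int p) (sb (int p) v))) = sp (int n) (wedge (b k) u)"
      using N0[of N k] that by (simp add: additive.sum[OF additive_sp])
    finally show ?thesis by (simp add: wedge_b_sp)
  qed
  then show ?case
    by (intro exI[of _ "Suc N0"]) (simp add: B_act_mult B_act_h u_def v_def)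
qed

text \<open>
  The coefficient of \<open>w\<^sup>-\<^sup>j\<close> in \<open>\<iota>(w) f [b]\<^sub>m = w\<^sup>-\<^sup>m E(w) (\<sigma>\<^sub>-(w) f) [b]\<^bsub>m-1\<^esub>\<close>.
\<close>

lemma contr_fock_B_act:
  "\<exists>N0. \<forall>N\<ge>N0. \<forall>j. contr_fock j (B_act f (vac m))
    = (\<Sum>p<N. B_act (Ez (m - j + int p)) (sm (int p) (B_act f (vac (m - 1)))))"
proof (induction f rule: B_induct)
  case one
  have "(\<Sum>p<N. B_act (Ez (m - j + int p)) (sm (int p) (vac (m - 1)))) = contr_fock j (vac m)"
    if "N \<ge> 1" for N j
  proof -
    have "(\<Sum>p<N. B_act (Ez (m - j + int p)) (sm (int p) (vac (m - 1))))
        = (\<Sum>p\<in>{0}. B_act (Ez (m - j + int p)) (sm (int p) (vac (m - 1))))"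
      using that by (intro sum.mono_neutral_right) (auto simp: sm_vac)
    then show ?thesis by (simp add: sm_vac contr_fock_vac)
  qed
  then show ?case by (intro exI[of _ 1]) simp
next
  case (diff f g)
  then obtain N M where N: "\<And>N' j. N' \<ge> N \<Longrightarrow> contr_fock j (B_act f (vac m))
      = (\<Sum>p<N'. B_act (Ez (m - j + int p)) (sm (int p) (B_act f (vac (m - 1)))))"
    and M: "\<And>N' j. N' \<ge> M \<Longrightarrow> contr_fock j (B_act g (vac m))
      = (\<Sum>p<N'. B_act (Ez (m - j + int p)) (sm (int p) (B_act g (vac (m - 1)))))" by blast
  show ?case
  proof (intro exI[of _ "max N M"] allI impI)
    fix N' j assume "max N M \<le> N'"
    with N[of N' j] M[of N' j] show "contr_fock j (B_act (f - g) (vac m))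
        = (\<Sum>p<N'. B_act (Ez (m - j + int p)) (sm (int p) (B_act (f - g) (vac (m - 1)))))"
      by (simp add: B_act_diff additive.diff[OF additive_contr_fock] op_diff sum_subtractf)
  qed
next
  case (h_mult n f)
  define u v where "u = B_act f (vac m)" and "v = B_act f (vac (m - 1))"
  have "\<exists>N0. \<forall>N\<ge>N0. \<forall>j. contr_fock j (sp (int n) u)
      = (\<Sum>p<N. B_act (Ez (m - j + int p)) (sm (int p) (sp (int n) v)))"
  \<comment> \<open>\<open>sm_sp\<close> leaves \<open>sp n\<close> inside \<open>sm\<close>, so the
    claim for \<open>n\<close>, taken at \<open>j - 1\<close>, is needed besides the one for
    \<open>f\<close>.\<close>
  proof (induction n)
    case 0
    show ?case using h_mult by (simp add: u_def v_def)
  next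
    case (Suc n)
    from h_mult obtain N1 where N1: "\<And>N j. N \<ge> N1 \<Longrightarrow>
        contr_fock j u = (\<Sum>p<N. B_act (Ez (m - j + int p)) (sm (int p) v))"
      by (auto simp: u_def v_def)
    from Suc obtain N2 where N2: "\<And>N j. N \<ge> N2 \<Longrightarrow> contr_fock j (sp (int n) u)
        = (\<Sum>p<N. B_act (Ez (m - j + int p)) (sm (int p) (sp (int n) v)))"
      by auto
    have "contr_fock j (sp (int (Suc n)) u)
        = (\<Sum>p<N. B_act (Ez (m - j + int p)) (sm (int p) (sp (int (Suc n)) v)))"
      if N_ge: "N \<ge> Suc (max N1 N2)" for N j
    proof -
      obtain M where "N = Suc M" using Suc_le_D[OF N_ge] by blast
      then have M: "N = Suc M" "M \<ge> N2" using N_ge by simp_all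
      have comm: "B_act g (sp i x) = sp i (B_act g x)" for g i x
        by (metis B_act_h B_act_mult mult.commute)
      have "(\<Sum>p<N. B_act (Ez (m - j + int p)) (sm (int p) (sp (int (Suc n)) v)))
          = (\<Sum>p<N. sp (int (Suc n)) (B_act (Ez (m - j + int p)) (sm (int p) v)))
          + (\<Sum>p<N. B_act (Ez (m - j + int p)) (sm (int p - 1) (sp (int n) v)))"
        unfolding sm_sp[of _ "int (Suc n)"] by (simp add: B_act_add comm sum.distrib)
      also have "(\<Sum>p<N. B_act (Ez (m - j + int p)) (sm (int p - 1) (sp (int n) v)))
          = (\<Sum>p<M. B_act (Ez (m - (j - 1) + int p)) (sm (int p) (sp (int n) v)))"
        unfolding M(1) by (simp add: sum.lessThan_Suc_shift sm_neg algebra_simps del: sum.lessThan_Suc)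
      also have "\<dots> = contr_fock (j - 1) (sp (int n) u)"
        using N2[OF M(2), of "j - 1"] by simp
      also have "(\<Sum>p<N. sp (int (Suc n)) (B_act (Ez (m - j + int p)) (sm (int p) v)))
          = sp (int (Suc n)) (contr_fock j u)"
        using N1[of N j] that by (simp add: additive.sum[OF additive_sp])
      finally show ?thesis by (simp add: sp_contr_fock)
    qed
    then show ?case by blast
  qed
  then show ?case
    by (simp add: B_act_mult B_act_h u_def v_def)
qed

section \<open>The operators on the polynomial ring\<close>

text \<open>One \<open>g\<close> serves all charges, since neither the recursion nor the value on
  the vacuum involves \<open>m\<close>.\<close>

lemma sb_B_act_ex: "\<exists>g. \<forall>m. sb p (B_act f (vac m)) = B_act g (vac m)"
proof (induction f arbitrary: p rule: B_induct)
  case one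
  show ?case by (rule exI[of _ "if p = 0 then 1 else 0"]) (simp add: sb_vac)
next
  case (diff f f')
  from diff[of p] obtain g g' where "\<forall>m. sb p (B_act f (vac m)) = B_act g (vac m)"
    "\<forall>m. sb p (B_act f' (vac m)) = B_act g' (vac m)" by blast
  then show ?case by (intro exI[of _ "g - g'"]) (simp add: B_act_diff op_diff)
next
  case (h_mult n f)
  from h_mult[of p] h_mult[of "p - 1"] obtain g g' where "\<forall>m. sb p (B_act f (vac m)) = B_act g (vac m)"
    "\<forall>m. sb (p - 1) (B_act f (vac m)) = B_act g' (vac m)" by blast
  then show ?case
    by (intro exI[of _ "h (int n) * g - h (int n - 1) * g'"])
      (simp add: B_act_diff B_act_mult B_act_h sb_sp)
qed

lemma sm_B_act_ex: "\<exists>g. \<forall>m. sm p (B_act f (vac m)) = B_act g (vac m)"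
proof (induction f arbitrary: p rule: B_induct)
  case one
  show ?case by (rule exI[of _ "if p = 0 then 1 else 0"]) (simp add: sm_vac)
next
  case (diff f f')
  from diff[of p] obtain g g' where "\<forall>m. sm p (B_act f (vac m)) = B_act g (vac m)"
    "\<forall>m. sm p (B_act f' (vac m)) = B_act g' (vac m)" by blast
  then show ?case by (intro exI[of _ "g - g'"]) (simp add: B_act_diff op_diff)
next
  case (h_mult n f)
  have "\<exists>g. \<forall>m. sm p (sp (int n) (B_act f (vac m))) = B_act g (vac m)"
  proof (induction n arbitrary: p)
    case 0
    show ?case using h_mult by simp
  next
    case (Suc n)
    from h_mult[of p] Suc[of "p - 1"] obtain g g' where
      "\<forall>m. sm p (B_act f (vac m)) = B_act g (vac m)"
      "\<forall>m. sm (p - 1) (sp (int n) (B_act f (vac m))) = B_act g' (vac m)" by blast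
    then show ?case
      by (intro exI[of _ "h (int (Suc n)) * g + g'"])
        (simp add: sm_sp[of p "1 + int n"] B_act_add B_act_mult B_act_h)
  qed
  then show ?case by (simp add: B_act_mult B_act_h)
qed

definition Sb :: "int \<Rightarrow> B \<Rightarrow> B" where "Sb p f = Phi 0 (sb p (B_act f (vac 0)))"
definition Sm :: "int \<Rightarrow> B \<Rightarrow> B" where "Sm p f = Phi 0 (sm p (B_act f (vac 0)))"

lemma sb_B_act: "sb p (B_act f (vac m)) = B_act (Sb p f) (vac m)"
  using sb_B_act_ex[of p f] by (auto simp: Sb_def Phi_B_act Phi_vac)

lemma sm_B_act: "sm p (B_act f (vac m)) = B_act (Sm p f) (vac m)"
  using sm_B_act_ex[of p f] by (auto simp: Sm_def Phi_B_act Phi_vac)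

lemma Sb_neg: "p < 0 \<Longrightarrow> Sb p f = 0" and Sm_neg: "p < 0 \<Longrightarrow> Sm p f = 0"
  by (simp_all add: Sb_def Sm_def sb_neg sm_neg additive.zero[OF additive_Phi])

lemma Sb_zero [simp]: "Sb p 0 = 0"
  by (simp add: Sb_def additive.zero[OF additive_Phi])

lemma Sb_bounded: "\<exists>N. \<forall>p\<ge>N. Sb p f = 0"
proof -
  have "\<exists>N. \<forall>p\<ge>N. sb p (B_act f (vac 0)) = 0"
  proof (induction f rule: B_induct)
    case one
    show ?case by (rule exI[of _ 1]) (simp add: sb_vac)
  next
    case (diff f g)
    then obtain N N' where "\<forall>p\<ge>N. sb p (B_act f (vac 0)) = 0" "\<forall>p\<ge>N'. sb p (B_act g (vac 0)) = 0"
      by blast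
    then show ?case by (intro exI[of _ "max N N'"]) (simp add: B_act_diff op_diff)
  next
    case (h_mult n f)
    then obtain N where "\<forall>p\<ge>N. sb p (B_act f (vac 0)) = 0" by blast
    then show ?case
      by (intro exI[of _ "N + 1"]) (simp add: B_act_mult B_act_h sb_sp)
  qed
  then show ?thesis by (metis Sb_def additive.zero[OF additive_Phi])
qed

lemma Sm_bounded: "\<exists>N. \<forall>p\<ge>N. Sm p f = 0"
proof -
  have "\<exists>N. \<forall>p\<ge>N. sm p (B_act f (vac 0)) = 0"
  proof (induction f rule: B_induct)
    case one
    show ?case by (rule exI[of _ 1]) (simp add: sm_vac)
  next
    case (diff f g)
    then obtain N N' where "\<forall>p\<ge>N. sm p (B_act f (vac 0)) = 0" "\<forall>p\<ge>N'. sm p (B_act g (vac 0)) = 0"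
      by blast
    then show ?case by (intro exI[of _ "max N N'"]) (simp add: B_act_diff op_diff)
  next
    case (h_mult n f)
    then obtain N where N: "\<forall>p\<ge>N. sm p (B_act f (vac 0)) = 0" by blast
    \<comment> \<open>Each unrolling of \<open>sm_sp\<close> trades one unit of \<open>n\<close> for
      one of \<open>p\<close>, so the bound grows by \<open>n\<close>, unlike the single unit for
      \<open>sb\<close>.\<close>
    have "\<forall>p\<ge>N + int n. sm p (sp (int n) (B_act f (vac 0))) = 0"
    proof (induction n)
      case (Suc n)
      then show ?case using N by (simp add: sm_sp[of p "1 + int n" for p])
    qed (use N in simp)
    then show ?case by (auto simp: B_act_mult B_act_h)
  qed
  then show ?thesis by (metis Sm_def additive.zero[OF additive_Phi])
qed

lemma b_word_B_act: "\<exists>f. wedge (b_word cs) (vac k) = B_act f (vac (k + int (length cs)))"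
proof (induction cs)
  case Nil
  show ?case by (rule exI[of _ 1]) simp
next
  case (Cons c cs)
  define m where "m = k + int (length cs) + 1"
  from Cons obtain f where f: "wedge (b_word cs) (vac k) = B_act f (vac (m - 1))"
    by (auto simp: m_def)
  from wedge_b_B_act[of f m] obtain N where "wedge (b c) (B_act f (vac (m - 1)))
      = (\<Sum>p<N. sp (c - m + int p) (sb (int p) (B_act f (vac m))))" by blast
  also have "\<dots> = B_act (\<Sum>p<N. h (c - m + int p) * Sb (int p) f) (vac m)"
    by (simp add: additive.sum[OF additive_B_act_left] sb_B_act B_act_mult B_act_h)
  finally show ?case
    using f by (auto simp: m_def algebra_simps simp flip: wedge_wedge)
qed

lemma fock_basis_eq_Delta: "fock_basis m l = B_act (Delta l) (vac m)"
proof -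
  obtain f where f: "fock_basis m l = B_act f (vac m)"
    using b_word_B_act[of "map (\<lambda>i. m - int i + int (nth_default 0 l i)) [0..<length l]" "m - int (length l)"]
    by (auto simp: fock_basis_def b_wedge_eq_b_word)
  have "Delta l = Phi m (fock_basis m l)" by (simp add: Phi_fock_basis)
  also have "\<dots> = f" unfolding f by (simp add: Phi_B_act Phi_vac)
  finally show ?thesis using f by simp
qed

text \<open>\<open>Phi 0\<close> maps the spanning monomials to \<open>Delta l\<close> or 0 and
  takes \<open>f\<close> [b]_0 back to \<open>f\<close>, so the \<open>Delta l\<close> span
  \<open>B\<close>.\<close>

lemma Delta_induct [case_names Delta diff]:
  assumes "\<And>l. is_partition l \<Longrightarrow> P (Delta l)" "\<And>f g. P f \<Longrightarrow> P g \<Longrightarrow> P (f - g)"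
  shows "P f"
proof -
  have zero: "P 0" using assms(2)[OF assms(1) assms(1), of "[]" "[]"] by simp
  have "P (Phi 0 x)" for x
    by (induction x rule: fock_basis_induct)
      (simp_all add: Phi_fock_basis assms zero additive.diff[OF additive_Phi])
  from this[of "B_act f (vac 0)"] show ?thesis by (simp add: Phi_B_act Phi_vac)
qed

text \<open>\<open>bounded\<close> lets the candidate coefficients form a polynomial; faithfulness
  of the action on [b]_0 makes them additive and unique.\<close>

lemma coeff_B_transport:
  assumes T: "Modules.additive T" and Q: "\<And>n f. B_act (Q n f) (vac 0) = fps_nth (T (B_act f (vac 0))) n"
    and bounded: "\<And>f. \<exists>N. \<forall>n>N. Q n f = 0"
  shows "poly.coeff (B_transport T f) n = Q n f"
proof -
  define S where "S f = Abs_poly (\<lambda>n. Q n f)" for f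
  have coeff: "poly.coeff (S f) n = Q n f" for f n
  proof -
    obtain N where "\<And>n. n > N \<Longrightarrow> Q n f = 0" using bounded by blast
    then show ?thesis using coeff_Abs_poly[of N "\<lambda>n. Q n f"] by (simp add: S_def)
  qed
  have Q_add: "Q n (f + g) = Q n f + Q n g" for n f g
  proof -
    have "B_act (Q n (f + g)) (vac 0) = B_act (Q n f + Q n g) (vac 0)"
      by (simp add: B_act_add_left Q additive.add[OF T])
    then show ?thesis by (simp add: B_act_vac_inject)
  qed
  have S: "Modules.additive S"
    by standard (simp add: poly_eq_iff coeff Q_add)
  have "B_transport T = S"
    unfolding B_transport_def
  proof (rule the_equality)
    show "Modules.additive S \<and> (\<forall>l n. is_partition l \<longrightarrow>
        B_act (poly.coeff (S (Delta l)) n) (vac 0) = fps_nth (T (fock_basis 0 l)) n)"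
      by (simp add: S coeff Q fock_basis_eq_Delta)
    fix S' assume S': "Modules.additive S' \<and> (\<forall>l n. is_partition l \<longrightarrow>
        B_act (poly.coeff (S' (Delta l)) n) (vac 0) = fps_nth (T (fock_basis 0 l)) n)"
    have "S' f = S f" for f
    proof (induction f rule: Delta_induct)
      case (Delta l)
      with S' have "B_act (poly.coeff (S' (Delta l)) n) (vac 0) = B_act (Q n (Delta l)) (vac 0)" for n
        by (simp add: Q fock_basis_eq_Delta)
      then show ?case by (simp add: poly_eq_iff coeff B_act_vac_inject)
    qed (use S S' in \<open>simp add: additive.diff\<close>)
    then show "S' = S" by blast
  qed
  then show ?thesis by (simp add: coeff)
qed

lemma coeff_sigma_minus_bar_B: "poly.coeff (sigma_minus_bar_B f) n = Sb (int n) f"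
  unfolding sigma_minus_bar_B_def
proof (rule coeff_B_transport[OF additive_sigma_minus_bar_fock])
  show "B_act (Sb (int n) f) (vac 0) = fps_nth (sigma_minus_bar_fock (B_act f (vac 0))) n" for n f
    by (simp add: sb_def flip: sb_B_act)
  show "\<exists>N. \<forall>n>N. Sb (int n) f = 0" for f
    using Sb_bounded[of f] by (meson less_imp_le nat_le_iff order_trans)
qed

lemma coeff_sigma_minus_B: "poly.coeff (sigma_minus_B f) n = Sm (int n) f"
  unfolding sigma_minus_B_def
proof (rule coeff_B_transport[OF additive_sigma_minus_fock])
  show "B_act (Sm (int n) f) (vac 0) = fps_nth (sigma_minus_fock (B_act f (vac 0))) n" for n f
    by (simp add: sm_def flip: sm_B_act)
  show "\<exists>N. \<forall>n>N. Sm (int n) f = 0" for f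
    using Sm_bounded[of f] by (meson less_imp_le nat_le_iff order_trans)
qed

lemma sigma_bar_sigma_eq: "sigma_bar_sigma f i j = Sb (- i) (Sm (- j) f)"
  by (auto simp: sigma_bar_sigma_def coeff_sigma_minus_B coeff_sigma_minus_bar_B Sb_neg Sm_neg)

section \<open>The two-variable series\<close>

lemma Sum_any_single:
  assumes "\<And>x. x \<noteq> a \<Longrightarrow> g x = 0"
  shows "Sum_any g = g a"
proof -
  have "Sum_any g = sum g {a}"
    by (rule Sum_any.expand_superset) (use assms in auto)
  then show ?thesis by simp
qed

lemma in_w_E_in_z_E_inv: "(in_w E \<star> in_z E_inv) i j = h i * Ez j"
proof -
  have "(in_w E \<star> in_z E_inv) i j = in_w E 0 j * in_z E_inv i 0"
    unfolding zw_mult_def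
    by (subst Sum_any_single[of "(0, j)"]) (auto simp: in_w_def in_z_def split: if_splits)
  then show ?thesis
    by (auto simp: in_w_def in_z_def h_def Ez_def int_nth_def)
qed

lemma zw_monom_iota: "(zw_monom p q \<star> iota_zw) i j = iota_zw (i - p) (j - q)"
  unfolding zw_mult_def
  by (subst Sum_any_single[of "(p, q)"]) (auto simp: zw_monom_def split: if_splits)

text \<open>The substitution k = i + q, l = j + p confines the support to a finite box; the bound on
  \<open>q\<close> has to be uniform in \<open>p\<close>.\<close>

lemma Gamma_eq:
  assumes P: "\<And>p. p \<ge> int P \<Longrightarrow> Sm p f = 0" and Q: "\<And>p q. q \<ge> int Q \<Longrightarrow> Sb q (Sm p f) = 0"
  shows "Gamma f i j = (\<Sum>p<P. \<Sum>q<Q. h (i + int q) * Ez (j + int p) * Sb (int q) (Sm (int p) f))"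
proof -
  let ?g = "\<lambda>(k, l). h k * Ez l * Sb (k - i) (Sm (l - j) f)"
  let ?\<phi> = "\<lambda>(p, q). (i + int q, j + int p)"
  let ?A = "{..<P} \<times> {..<Q}"
  have "Gamma f i j = Sum_any ?g"
    by (simp add: Gamma_def zw_mult_def[of "in_w E \<star> in_z E_inv"] in_w_E_in_z_E_inv sigma_bar_sigma_eq)
  also have "\<dots> = sum ?g (?\<phi> ` ?A)"
  proof (rule Sum_any.expand_superset)
    show "{a. ?g a \<noteq> 0} \<subseteq> ?\<phi> ` ?A"
    proof
      fix a assume "a \<in> {a. ?g a \<noteq> 0}"
      then obtain k l where a: "a = (k, l)" "Sb (k - i) (Sm (l - j) f) \<noteq> 0"
        by (cases a) auto
      have "k - i \<ge> 0" "l - j \<ge> 0" "k - i < int Q" "l - j < int P"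
        using a(2) Sb_neg[of "k - i"] Sm_neg[of "l - j"] P[of "l - j"] Q[of "k - i" "l - j"]
        by (force simp: not_less[symmetric])+
      then have "a = ?\<phi> (nat (l - j), nat (k - i))" "(nat (l - j), nat (k - i)) \<in> ?A"
        by (auto simp: a(1))
      then show "a \<in> ?\<phi> ` ?A" by blast
    qed
  qed simp
  also have "\<dots> = sum (?g \<circ> ?\<phi>) ?A"
    by (rule sum.reindex) (auto simp: inj_on_def)
  also have "\<dots> = (\<Sum>p<P. \<Sum>q<Q. h (i + int q) * Ez (j + int p) * Sb (int q) (Sm (int p) f))"
    unfolding sum.cartesian_product by (rule sum.cong) auto
  finally show ?thesis .
qed

definition vertex_series :: "int \<Rightarrow> B \<Rightarrow> zw_series" where
  "vertex_series m f = (zw_monom m (- m) \<star> iota_zw) \<star> Gamma f"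

text \<open>The support of the prefactor is the ray of exponents (m - t, t - m) with t \<ge> 0, so a
  single sum over \<open>t\<close> remains.\<close>

lemma vertex_series_eq:
  assumes "\<And>t. t \<ge> T \<Longrightarrow> Gamma f (i - m + int t) (j + m - int t) = 0"
  shows "vertex_series m f i j = (\<Sum>t<T. Gamma f (i - m + int t) (j + m - int t))"
proof -
  let ?g = "\<lambda>(k, l). iota_zw (k - m) (l + m) * Gamma f (i - k) (j - l)"
  let ?\<phi> = "\<lambda>t::nat. (m - int t, int t - m)"
  have "vertex_series m f i j = Sum_any ?g"
    by (simp add: vertex_series_def zw_mult_def[of "zw_monom m (- m) \<star> iota_zw"] zw_monom_iota)
  also have "\<dots> = sum ?g (?\<phi> ` {..<T})"
  proof (rule Sum_any.expand_superset)
    show "{a. ?g a \<noteq> 0} \<subseteq> ?\<phi> ` {..<T}"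
    proof
      fix a assume "a \<in> {a. ?g a \<noteq> 0}"
      then obtain k l where a: "a = (k, l)" "iota_zw (k - m) (l + m) \<noteq> 0" "Gamma f (i - k) (j - l) \<noteq> 0"
        by (cases a) auto
      define t where "t = nat (l + m)"
      have t: "k = m - int t" "l = int t - m"
        using a(2) by (auto simp: iota_zw_def t_def split: if_splits)
      have "t < T"
        using a(3) assms[of t] unfolding t by (force simp: not_less[symmetric] algebra_simps)
      with t a(1) show "a \<in> ?\<phi> ` {..<T}" by auto
    qed
  qed simp
  also have "\<dots> = sum (?g \<circ> ?\<phi>) {..<T}"
    by (rule sum.reindex) (auto simp: inj_on_def)
  also have "\<dots> = (\<Sum>t<T. Gamma f (i - m + int t) (j + m - int t))"
    by (rule sum.cong) (auto simp: iota_zw_def algebra_simps)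
  finally show ?thesis .
qed

lemma vertex_series_act:
  "B_act (vertex_series m f i (- j)) (vac m) = delta_fock i j (B_act f (vac m))"
proof -
  obtain P0 where P0: "\<And>p. p \<ge> P0 \<Longrightarrow> Sm p f = 0" using Sm_bounded by blast
  obtain P1 where P1: "\<And>N. N \<ge> P1 \<Longrightarrow> contr_fock j (B_act f (vac m))
      = (\<Sum>p<N. B_act (Ez (m - j + int p)) (sm (int p) (B_act f (vac (m - 1)))))"
    using contr_fock_B_act[of f m] by blast
  define P where "P = max (nat P0) P1"
  have P: "Sm p f = 0" if "p \<ge> int P" for p
    using that by (intro P0) (simp add: P_def)
  have "\<exists>N0. \<forall>N\<ge>N0. (\<forall>q\<ge>int N. Sb q (Sm p f) = 0) \<and> (\<forall>k. wedge (b k) (B_act (Sm p f) (vac (m - 1)))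
      = (\<Sum>q<N. sp (k - m + int q) (sb (int q) (B_act (Sm p f) (vac m)))))" for p
  proof -
    obtain N1 where N1: "\<forall>q\<ge>N1. Sb q (Sm p f) = 0" using Sb_bounded by blast
    obtain N2 where "\<forall>N\<ge>N2. \<forall>k. wedge (b k) (B_act (Sm p f) (vac (m - 1)))
      = (\<Sum>q<N. sp (k - m + int q) (sb (int q) (B_act (Sm p f) (vac m))))"
      using wedge_b_B_act by blast
    with N1 show ?thesis by (intro exI[of _ "max (nat N1) N2"]) auto
  qed
  then obtain N0 where N0: "\<And>p N. N \<ge> N0 p \<Longrightarrow> (\<forall>q\<ge>int N. Sb q (Sm p f) = 0) \<and>
      (\<forall>k. wedge (b k) (B_act (Sm p f) (vac (m - 1)))
      = (\<Sum>q<N. sp (k - m + int q) (sb (int q) (B_act (Sm p f) (vac m)))))"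
    by metis
  \<comment> \<open>The cut-off depends on \<open>Sm p f\<close>, but this is nonzero only for 0
    \<le> p < P, so one maximum suffices.\<close>
  define Q where "Q = Max ((\<lambda>p. N0 (int p)) ` {..P})"
  have Q_ge: "Q \<ge> N0 (int p)" if "p \<le> P" for p
    using that by (simp add: Q_def)
  have Q: "Sb q (Sm p f) = 0" if "q \<ge> int Q" for p q
  proof (cases "0 \<le> p \<and> p < int P")
    case True
    have "Q \<ge> N0 (int (nat p))" using True by (intro Q_ge) (simp add: nat_le_iff)
    with N0[of p Q] True that show ?thesis by simp
  next
    case False
    then have "Sm p f = 0" using P[of p] Sm_neg[of p f] by force
    then show ?thesis by simp
  qed
  have vertex: "wedge (b k) (B_act (Sm (int p) f) (vac (m - 1)))
      = (\<Sum>q<Q. B_act (h (k - m + int q) * Sb (int q) (Sm (int p) f)) (vac m))" if "p < P" for k p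
    using N0[OF Q_ge[of p]] that by (simp add: sb_B_act B_act_mult B_act_h)
  \<comment> \<open>This exceeds m - j + p for every p < P. It validates
    \<open>wedge_b_E_sum\<close> and also kills the E-coefficient in all terms with t \<ge>
    T.\<close>
  define T where "T = nat (m - j) + P + 1"
  have Gamma: "Gamma f i j = (\<Sum>p<P. \<Sum>q<Q. h (i + int q) * Ez (j + int p) * Sb (int q) (Sm (int p) f))" for i j
    by (rule Gamma_eq) (use P Q in auto)
  have "delta_fock i j (B_act f (vac m))
      = wedge (b i) (\<Sum>p<P. B_act (Ez (m - j + int p)) (B_act (Sm (int p) f) (vac (m - 1))))"
    using P1[of P] by (simp add: delta_fock_eq P_def sm_B_act)
  also have "\<dots> = (\<Sum>p<P. wedge (b i) (B_act (Ez (m - j + int p)) (B_act (Sm (int p) f) (vac (m - 1)))))"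
    by (rule wedge_sum_right)
  \<comment> \<open>First \<open>b i\<close> is carried across the E-coefficient produced by the
    contraction, then b(z) is replaced by its form on \<open>B\<close>.\<close>
  also have "\<dots> = (\<Sum>p<P. \<Sum>t<T. \<Sum>q<Q. B_act (Ez (m - j + int p - int t)
      * (h (i + int t - m + int q) * Sb (int q) (Sm (int p) f))) (vac m))"
  proof (rule sum.cong[OF refl])
    fix p assume p: "p \<in> {..<P}"
    have "wedge (b i) (B_act (Ez (m - j + int p)) (B_act (Sm (int p) f) (vac (m - 1))))
        = (\<Sum>t<T. B_act (Ez (m - j + int p - int t)) (wedge (b (i + int t)) (B_act (Sm (int p) f) (vac (m - 1)))))"
      by (rule wedge_b_E_sum) (use p in \<open>auto simp: T_def\<close>)
    also have "\<dots> = (\<Sum>t<T. \<Sum>q<Q. B_act (Ez (m - j + int p - int t)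
      * (h (i + int t - m + int q) * Sb (int q) (Sm (int p) f))) (vac m))"
      using p by (simp add: vertex additive.sum[OF additive_B_act] B_act_mult)
    finally show "wedge (b i) (B_act (Ez (m - j + int p)) (B_act (Sm (int p) f) (vac (m - 1))))
      = (\<Sum>t<T. \<Sum>q<Q. B_act (Ez (m - j + int p - int t)
      * (h (i + int t - m + int q) * Sb (int q) (Sm (int p) f))) (vac m))" .
  qed
  also have "\<dots> = (\<Sum>t<T. \<Sum>p<P. \<Sum>q<Q. B_act (Ez (m - j + int p - int t)
      * (h (i + int t - m + int q) * Sb (int q) (Sm (int p) f))) (vac m))"
    by (rule sum.swap)
  also have "\<dots> = B_act (\<Sum>t<T. Gamma f (i - m + int t) (- j + m - int t)) (vac m)"
    unfolding Gamma by (simp add: additive.sum[OF additive_B_act_left] algebra_simps)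
  also have "(\<Sum>t<T. Gamma f (i - m + int t) (- j + m - int t)) = vertex_series m f i (- j)"
  proof (rule vertex_series_eq[symmetric])
    show "Gamma f (i - m + int t) (- j + m - int t) = 0" if "t \<ge> T" for t
      unfolding Gamma using that by (auto intro!: sum.neutral simp: T_def)
  qed
  finally show ?thesis by simp
qed

theorem corollary9p4:
  fixes m :: int and f :: B
  shows "B_zw m f = (zw_monom m (- m) \<star> iota_zw) \<star> Gamma f"
proof -
  have add: "Modules.additive (\<lambda>f. vertex_series m f p q)" for p q
  proof
    fix f g
    \<comment> \<open>The double negation matches the exponent \<open>- j\<close> in
      \<open>vertex_series_act\<close>; additivity is then read off from the faithful action on
      [b]_m.\<close>
    have "B_act (vertex_series m (f + g) p (- (- q))) (vac m)
        = B_act (vertex_series m f p (- (- q)) + vertex_series m g p (- (- q))) (vac m)"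
      unfolding B_act_add_left vertex_series_act
      by (simp add: delta_fock_eq contr_fock_add wedge_add_right)
    then show "vertex_series m (f + g) p q = vertex_series m f p q + vertex_series m g p q"
      by (simp add: B_act_vac_inject)
  qed
  have "B_zw m = vertex_series m"
    unfolding B_zw_def
  proof (rule the_equality)
    show "(\<forall>p q. Modules.additive (\<lambda>f. vertex_series m f p q)) \<and> (\<forall>l i j. is_partition l \<longrightarrow>
        B_act (vertex_series m (Delta l) i (- j)) (vac m) = delta_fock i j (fock_basis m l))"
      by (simp add: add vertex_series_act fock_basis_eq_Delta)
    fix T assume T: "(\<forall>p q. Modules.additive (\<lambda>f. T f p q)) \<and> (\<forall>l i j. is_partition l \<longrightarrow>
        B_act (T (Delta l) i (- j)) (vac m) = delta_fock i j (fock_basis m l))"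
    have "T f p q = vertex_series m f p q" for f p q
    proof (induction f rule: Delta_induct)
      case (Delta l)
      with T have "B_act (T (Delta l) p (- (- q))) (vac m) = delta_fock p (- q) (fock_basis m l)"
        by blast
      also have "\<dots> = B_act (vertex_series m (Delta l) p (- (- q))) (vac m)"
        by (simp only: vertex_series_act fock_basis_eq_Delta)
      finally show ?case by (simp add: B_act_vac_inject)
    next
      case (diff f g)
      from T have "Modules.additive (\<lambda>f. T f p q)" by blast
      from additive.diff[OF this] diff show ?case by (simp add: additive.diff[OF add])
    qed
    then show "T = vertex_series m" by blast
  qed
  then show ?thesis by (simp add: vertex_series_def)
qed

end
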